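(* Let $D\subset\mathbb{R}^d$ be an open set of finite Lebesgue measure, let $p>d$ with $p>1$, let $f\in W^{-1,p'}(D)$ and let $m\in(0,|D|]$. Let $j:D\times\mathbb{R}\to\mathbb{R}$ be an integrand such that $j(x,\cdot)$ is lower semicontinuous, and suppose that for every $M>0$ there exists $a_M\in L^1(D)$ such that $$-a_M(x)\le j(x,s)\qquad\text{for a.e. }x\in D\text{ and all }|s|\le M.$$ For every open $\Omega\subset D$ let $u_\Omega$ be the state function defined in the context, and let $J(u)=\int_D j(x,u(x))\,dx$. Then the minimization problem $$\min\big\{J(u_\Omega)\ :\ \Omega\text{ open},\ \Omega\subset D,\ |\Omega|\le m\big\}$$ admits a solution $\Omega_{\mathrm{opt}}$, which is an open set.
   Context: $|\cdot|$ denotes Lebesgue measure in $\mathbb{R}^d$ and $p'=p/(p-1)$. "Integrand" means that $j$ is measurable with respect to the product of the Lebesgue $\sigma$-algebra on $D$ and the Borel $\sigma$-algebra on $\mathbb{R}$. $\Delta_p u=\operatorname{div}(|\nabla u|^{p-2}\nabla u)$. For an open set $\Omega\subset D$, the state function $u_\Omega$ is the weak solution of $-\Delta_p u_\Omega=f$ in $\Omega$, $u_\Omega=0$ on $\overline D\setminus\Omega$; equivalently, $u_\Omega$ is the unique minimizer of $\frac1p\int_D|\nabla u|^p\,dx-\langle f,u\rangle$ among all $u\in W^{1,p}_0(D)$ such that $u=0$ on $D\setminus\Omega$ (for $\Omega$ open this means $u\in W^{1,p}_0(\Omega)$, extended by zero). *)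

theory Defs
  imports "HOL-Analysis.Analysis"
begin

primrec C_k :: "nat \<Rightarrow> ('a::euclidean_space \<Rightarrow> real) \<Rightarrow> bool" where
  "C_k 0 \<phi> \<longleftrightarrow> continuous_on UNIV \<phi>"
| "C_k (Suc k) \<phi> \<longleftrightarrow> (\<forall>x. \<phi> differentiable (at x)) \<and>
     (\<forall>i\<in>Basis. C_k k (\<lambda>x. frechet_derivative \<phi> (at x) i))"

definition test_functions :: "'a::euclidean_space set \<Rightarrow> ('a \<Rightarrow> real) set" where
  "test_functions \<Omega> = {\<phi>. (\<forall>k. C_k k \<phi>) \<and>
     compact (closure {x. \<phi> x \<noteq> 0}) \<and> closure {x. \<phi> x \<noteq> 0} \<subseteq> \<Omega>}"

(* Functions represent their almost-everywhere classes throughout; the values of elements of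
   Lp p \<Omega> outside \<Omega> are irrelevant. *)
definition Lp :: "real \<Rightarrow> 'a::euclidean_space set \<Rightarrow> ('a \<Rightarrow> 'b::euclidean_space) set" where
  "Lp p \<Omega> = {u \<in> borel_measurable (lebesgue_on \<Omega>).
     integrable (lebesgue_on \<Omega>) (\<lambda>x. norm (u x) powr p)}"

definition Lp_norm :: "real \<Rightarrow> 'a::euclidean_space set \<Rightarrow> ('a \<Rightarrow> 'b::euclidean_space) \<Rightarrow> real" where
  "Lp_norm p \<Omega> u = (LINT x|lebesgue_on \<Omega>. norm (u x) powr p) powr (1 / p)"

definition locally_integrable_on ::
    "('a::euclidean_space \<Rightarrow> 'b::euclidean_space) \<Rightarrow> 'a set \<Rightarrow> bool" (infix "locally'_integrable'_on" 50) where
  "u locally_integrable_on \<Omega> \<longleftrightarrow> (\<forall>K. compact K \<and> K \<subseteq> \<Omega> \<longrightarrow> integrable (lebesgue_on K) u)"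

definition has_weak_gradient ::
    "'a::euclidean_space set \<Rightarrow> ('a \<Rightarrow> real) \<Rightarrow> ('a \<Rightarrow> 'a) \<Rightarrow> bool" where
  "has_weak_gradient \<Omega> u g \<longleftrightarrow>
     u locally_integrable_on \<Omega> \<and> g locally_integrable_on \<Omega> \<and>
     (\<forall>\<phi>\<in>test_functions \<Omega>. \<forall>i\<in>Basis.
        (LINT x|lebesgue_on \<Omega>. u x * frechet_derivative \<phi> (at x) i)
          = - (LINT x|lebesgue_on \<Omega>. (g x \<bullet> i) * \<phi> x))"

(* For open \<Omega> the weak gradient is unique up to null sets; a representative is chosen. *)
definition weak_gradient ::
    "'a::euclidean_space set \<Rightarrow> ('a \<Rightarrow> real) \<Rightarrow> 'a \<Rightarrow> 'a" where
  "weak_gradient \<Omega> u = (SOME g. has_weak_gradient \<Omega> u g)"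

definition W1p :: "real \<Rightarrow> 'a::euclidean_space set \<Rightarrow> ('a \<Rightarrow> real) set" where
  "W1p p \<Omega> = {u \<in> Lp p \<Omega>. \<exists>g \<in> Lp p \<Omega>. has_weak_gradient \<Omega> u g}"

definition W1p_norm :: "real \<Rightarrow> 'a::euclidean_space set \<Rightarrow> ('a \<Rightarrow> real) \<Rightarrow> real" where
  "W1p_norm p \<Omega> u = Lp_norm p \<Omega> u + Lp_norm p \<Omega> (weak_gradient \<Omega> u)"

(* Closure of the test functions in W1p p \<Omega>.  The extension by zero is built in, so that
   W1p_0 p \<Omega> is a subset of W1p_0 p D for open \<Omega> \<subseteq> D. *)
definition W1p_0 :: "real \<Rightarrow> 'a::euclidean_space set \<Rightarrow> ('a \<Rightarrow> real) set" where
  "W1p_0 p \<Omega> = {u \<in> W1p p \<Omega>. (\<forall>x. x \<notin> \<Omega> \<longrightarrow> u x = 0) \<and>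
     (\<exists>\<phi>. (\<forall>n. \<phi> n \<in> test_functions \<Omega>) \<and>
        (\<lambda>n. W1p_norm p \<Omega> (\<lambda>x. \<phi> n x - u x)) \<longlonglongrightarrow> 0)}"

(* The dual of W1p_0 p D, usually written W^{-1,p'}(D).  Boundedness makes its elements
   independent of the chosen representatives. *)
definition W1p_0_dual :: "real \<Rightarrow> 'a::euclidean_space set \<Rightarrow> (('a \<Rightarrow> real) \<Rightarrow> real) set" where
  "W1p_0_dual p D = {f.
     (\<forall>u\<in>W1p_0 p D. \<forall>v\<in>W1p_0 p D. f (\<lambda>x. u x + v x) = f u + f v) \<and>
     (\<forall>c. \<forall>u\<in>W1p_0 p D. f (\<lambda>x. c * u x) = c * f u) \<and>
     (\<exists>C. \<forall>u\<in>W1p_0 p D. \<bar>f u\<bar> \<le> C * W1p_norm p D u)}"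

(* Weak form of - div (|\<nabla>u|^{p-2} \<nabla>u) = f in \<Omega> with u = 0 outside \<Omega>.  Where \<nabla>u = 0, the field
   |\<nabla>u|^{p-2} \<nabla>u is 0 also for p < 2, as it should be. *)
definition p_Laplace_weak_solution ::
    "real \<Rightarrow> (('a::euclidean_space \<Rightarrow> real) \<Rightarrow> real) \<Rightarrow> 'a set \<Rightarrow> ('a \<Rightarrow> real) \<Rightarrow> bool" where
  "p_Laplace_weak_solution p f \<Omega> u \<longleftrightarrow> u \<in> W1p_0 p \<Omega> \<and>
     (\<forall>v\<in>W1p_0 p \<Omega>.
        (LINT x|lebesgue_on \<Omega>. norm (weak_gradient \<Omega> u x) powr (p - 2) *
            (weak_gradient \<Omega> u x \<bullet> weak_gradient \<Omega> v x)) = f v)"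

(* A representative of the weak solution, which is unique up to null sets. *)
definition state_function ::
    "real \<Rightarrow> (('a::euclidean_space \<Rightarrow> real) \<Rightarrow> real) \<Rightarrow> 'a set \<Rightarrow> 'a \<Rightarrow> real" where
  "state_function p f \<Omega> = (SOME u. p_Laplace_weak_solution p f \<Omega> u)"

definition lower_semicontinuous :: "(real \<Rightarrow> real) \<Rightarrow> bool" where
  "lower_semicontinuous h \<longleftrightarrow> (\<forall>s. \<forall>c < h s. \<forall>\<^sub>F t in nhds s. c < h t)"

definition integrand_on :: "'a::euclidean_space set \<Rightarrow> ('a \<Rightarrow> real \<Rightarrow> real) \<Rightarrow> bool" where
  "integrand_on D j \<longleftrightarrow>
     (\<lambda>(x, s). j x s) \<in> borel_measurable (lebesgue_on D \<Otimes>\<^sub>M borel)"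

(* The positive part need not be integrable, so the value is extended real; ennreal sends
   negative numbers to 0, hence this is the integral of the positive part minus that of the
   negative part. *)
definition cost :: "'a::euclidean_space set \<Rightarrow> ('a \<Rightarrow> real \<Rightarrow> real) \<Rightarrow> ('a \<Rightarrow> real) \<Rightarrow> ereal" where
  "cost D j u = enn2ereal (\<integral>\<^sup>+x. ennreal (j x (u x)) \<partial>lebesgue_on D)
              - enn2ereal (\<integral>\<^sup>+x. ennreal (- j x (u x)) \<partial>lebesgue_on D)"

end

theory Submission
  imports Defs "HOL-Complex_Analysis.Great_Picard" "HOL-Real_Asymp.Real_Asymp"
begin

text \<open>
  Since p > d, Morrey's inequality turns a bound on the gradients of Sobolev functions on D into a uniform
  Hoelder and sup bound, so the state functions u_n of a minimizing sequence of open sets converge, along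
  a subsequence, to a continuous function u, uniformly on compact sets.  The optimal set is {u \<noteq> 0}:
  it is open, and its measure is at most m by Fatou's lemma.  A test function with compact support in
  {u \<noteq> 0} is eventually admissible for the n-th problem, so u minimizes the energy among
  these test functions; truncating u near 0 shows that u is itself a limit of such test functions, hence
  u is the state function of {u \<noteq> 0}.  Fatou's lemma and the lower semicontinuity of j give
  the optimality.  Weak compactness is avoided throughout: bounded decreasing sequences of convex sets of
  Sobolev functions have a common strong limit point by uniform convexity.
\<close>

section \<open>Smooth functions\<close>

text \<open>The admissible sets have no compactness of their own, so the argument is moved to the
  state functions. For this \<open>sobolev_pair\<close> keeps the gradient as data next to the
  function: the function is an everywhere pointwise limit of test functions, which makes sense
  because p exceeds the dimension, and only the gradient is an L^p class. Sobolev classes and chosen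
  weak gradients return only at the interface with the definitions of the problem. The obstacle is
  that the gradients of a minimizing sequence need not converge strongly. Midpoint combinations of
  its tails retain what matters, namely the pointwise limit and every upper bound on the convex
  energy, and the convex sets of the overview are made of them. A second obstacle is that D may be
  unbounded: its finite measure still forces every ball of some fixed radius to meet the complement,
  whence the sup bound. \<open>Lp_energy\<close> is the p-th power of the norm, so that pointwise
  estimates can be integrated directly; the price is factors \<open>2 powr p\<close> and bounds
  stated for every M strictly above the energy.\<close>

definition smooth :: "('a::euclidean_space \<Rightarrow> real) \<Rightarrow> bool" where
  "smooth \<phi> \<longleftrightarrow> (\<forall>k. C_k k \<phi>)"

lemma frechet_derivative_eqI:
  "(f has_derivative F) (at x) \<Longrightarrow> frechet_derivative f (at x) = F"
  using frechet_derivative_at by metis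

text \<open>\<open>C_k\<close> asks for differentiability at every level and for continuity only at
  the last one, so the base case is that a differentiable function is continuous.\<close>

lemma C_k_SucD: "C_k (Suc k) f \<Longrightarrow> C_k k f"
proof (induction k arbitrary: f)
  case 0
  then show ?case
    by (auto intro!: continuous_at_imp_continuous_on differentiable_imp_continuous_within)
next
  case (Suc k)
  then show ?case by (metis C_k.simps(2))
qed

lemma C_k_const: "C_k k (\<lambda>x. c)"
  by (induction k arbitrary: c) (auto simp: frechet_derivative_const)

lemma C_k_add: "C_k k f \<Longrightarrow> C_k k g \<Longrightarrow> C_k k (\<lambda>x. f x + g x)"
proof (induction k arbitrary: f g)
  case 0
  then show ?case by (auto intro: continuous_on_add)
next
  case (Suc k)
  have "frechet_derivative (\<lambda>x. f x + g x) (at x) =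
      (\<lambda>i. frechet_derivative f (at x) i + frechet_derivative g (at x) i)" for x
    using Suc.prems
    by (intro frechet_derivative_eqI has_derivative_add) (auto simp: frechet_derivative_works)
  then show ?case using Suc by (auto intro: differentiable_add)
qed

lemma C_k_mult: "C_k k f \<Longrightarrow> C_k k g \<Longrightarrow> C_k k (\<lambda>x. f x * g x)"
proof (induction k arbitrary: f g)
  case 0
  then show ?case by (auto intro: continuous_on_mult)
next
  case (Suc k)
  have "frechet_derivative (\<lambda>x. f x * g x) (at x) =
      (\<lambda>i. f x * frechet_derivative g (at x) i + frechet_derivative f (at x) i * g x)" for x
    using Suc.prems
    by (intro frechet_derivative_eqI has_derivative_mult) (auto simp: frechet_derivative_works)
  moreover have "C_k k f" "C_k k g" using Suc.prems C_k_SucD by blast+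
  ultimately show ?case using Suc by (auto intro!: C_k_add differentiable_mult)
qed

text \<open>The outer function has one real variable, so a partial derivative of the composition is
  T'(f) times the partial derivative of f. The induction must generalize T, since the hypothesis is
  applied to T' in its place.\<close>

lemma C_k_compose:
  fixes T :: "real \<Rightarrow> real"
  shows "C_k k T \<Longrightarrow> C_k k f \<Longrightarrow> C_k k (\<lambda>x. T (f x))"
proof (induction k arbitrary: f T)
  case 0
  then show ?case by (auto intro: continuous_on_compose2)
next
  case (Suc k)
  have d: "((\<lambda>x. T (f x)) has_derivative
      (\<lambda>i. frechet_derivative T (at (f x)) 1 * frechet_derivative f (at x) i)) (at x)" for x
  proof -
    have 1: "(T has_derivative frechet_derivative T (at (f x))) (at (f x))"
      and 2: "(f has_derivative frechet_derivative f (at x)) (at x)"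
      using Suc.prems by (auto simp: frechet_derivative_works)
    \<comment> \<open>A linear map on the real line is multiplication by its value at 1.\<close>
    have "frechet_derivative T (at (f x)) = (\<lambda>s. frechet_derivative T (at (f x)) 1 * s)"
    proof
      fix s
      show "frechet_derivative T (at (f x)) s = frechet_derivative T (at (f x)) 1 * s"
        using linear_scale[OF has_derivative_linear[OF 1], of s 1] by (metis mult.commute mult_1_right real_scaleR_def)
    qed
    note 1 = has_derivative_eq_rhs[OF 1 this]
    show ?thesis
      by (rule has_derivative_compose[OF 2 1])
  qed
  have "C_k k (\<lambda>s. frechet_derivative T (at s) 1)" "C_k k f"
    using Suc.prems(1) C_k_SucD[OF Suc.prems(2)] by simp_all
  then have "C_k k (\<lambda>x. frechet_derivative T (at (f x)) 1)"
    by (rule Suc.IH)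
  then have "C_k k (\<lambda>x. frechet_derivative T (at (f x)) 1 * frechet_derivative f (at x) i)"
    if "i \<in> Basis" for i
    using Suc.prems(2) that by (intro C_k_mult) simp_all
  then show ?case
    using d by (auto simp: frechet_derivative_eqI[OF d] differentiable_def)
qed

lemma C_k_inner: "C_k k (\<lambda>x. x \<bullet> a)"
proof (cases k)
  case 0
  then show ?thesis by (simp add: continuous_on_inner)
next
  case (Suc k)
  have "((\<lambda>x. x \<bullet> a) has_derivative (\<lambda>i. i \<bullet> a)) (at x)" for x
    by (auto intro!: derivative_eq_intros)
  then have "(\<lambda>x. x \<bullet> a) differentiable (at x)"
    "frechet_derivative (\<lambda>x. x \<bullet> a) (at x) = (\<lambda>i. i \<bullet> a)" for x :: 'a
    by (auto simp: differentiable_def intro: frechet_derivative_eqI)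
  then show ?thesis unfolding Suc by (simp add: C_k_const)
qed

lemma smooth_const: "smooth (\<lambda>x. c)"
  and smooth_inner: "smooth (\<lambda>x. x \<bullet> a)"
  and smooth_add: "smooth f \<Longrightarrow> smooth g \<Longrightarrow> smooth (\<lambda>x. f x + g x)"
  and smooth_mult: "smooth f \<Longrightarrow> smooth g \<Longrightarrow> smooth (\<lambda>x. f x * g x)"
  and smooth_compose: "smooth T \<Longrightarrow> smooth f \<Longrightarrow> smooth (\<lambda>x. T (f x))"
  by (simp_all add: smooth_def C_k_const C_k_inner C_k_add C_k_mult C_k_compose)

lemma smooth_ident: "smooth (\<lambda>x::real. x)"
  using smooth_inner[of "1::real"] by simp

lemma smooth_diff: "smooth f \<Longrightarrow> smooth g \<Longrightarrow> smooth (\<lambda>x. f x - g x)"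
  using smooth_add[OF _ smooth_mult[OF smooth_const[of "-1"]], of f g] by simp

lemma smooth_prod: "finite I \<Longrightarrow> (\<And>i. i \<in> I \<Longrightarrow> smooth (f i)) \<Longrightarrow> smooth (\<lambda>x. \<Prod>i\<in>I. f i x)"
  by (induction I rule: finite_induct) (auto intro: smooth_const smooth_mult)

lemma smooth_differentiable: "smooth f \<Longrightarrow> f differentiable (at x)"
  unfolding smooth_def using C_k.simps(2) by blast

lemma smooth_continuous: "smooth f \<Longrightarrow> continuous_on S f"
  unfolding smooth_def by (metis C_k.simps(1) continuous_on_subset top_greatest)

lemma smooth_partial: "smooth f \<Longrightarrow> i \<in> Basis \<Longrightarrow> smooth (\<lambda>x. frechet_derivative f (at x) i)"
  unfolding smooth_def by (metis C_k.simps(2))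

section \<open>Flat functions, a smooth truncation, and bumps on boxes\<close>

text \<open>The polynomial in 1/t makes this family closed under differentiation, so that a single
  induction over \<open>C_k\<close> gives smoothness of all its members; \<open>flat 1\<close> is
  the classical function exp(-1/t).\<close>

definition flat :: "real poly \<Rightarrow> real \<Rightarrow> real" where
  "flat P t = (if t > 0 then poly P (1 / t) * exp (- (1 / t)) else 0)"

text \<open>The power x ^ k is there for the induction over the coefficients: it absorbs the factor
  x that \<open>pCons\<close> puts in front of the remaining polynomial.\<close>

lemma power_poly_exp_tendsto_0:
  "((\<lambda>x::real. x ^ k * poly P x * exp (- x)) \<longlongrightarrow> 0) at_top"
proof (induction P arbitrary: k)
  case 0
  then show ?case by simp
next
  case (pCons a P)
  have "((\<lambda>x::real. a * (x ^ k / exp x) + x ^ Suc k * poly P x * exp (- x)) \<longlongrightarrow> a * 0 + 0) at_top"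
    by (intro tendsto_intros tendsto_power_div_exp_0 pCons.IH)
  then show ?case by (simp add: algebra_simps exp_minus divide_inverse)
qed

text \<open>With x = 1/t, differentiating P(x) exp(-x) in t brings out the inner derivative -x^2,
  which gives the polynomial x^2 (P - P').\<close>

lemma flat_deriv: "(flat P has_real_derivative flat ([:0, 0, 1:] * (P - pderiv P)) t) (at t)"
proof -
  consider "t > 0" | "t < 0" | "t = 0" by linarith
  then show ?thesis
  proof cases
    case 1
    have "((\<lambda>t. poly P (1 / t) * exp (- (1 / t))) has_real_derivative
        flat ([:0, 0, 1:] * (P - pderiv P)) t) (at t)"
      using 1 by (auto intro!: derivative_eq_intros DERIV_chain'[OF _ poly_DERIV]
          simp: flat_def field_simps power2_eq_square)
    then show ?thesis
      by (rule has_field_derivative_transform_within_open[of _ _ _ "{0<..}"])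
        (use 1 in \<open>auto simp: flat_def\<close>)
  next
    case 2
    have "((\<lambda>t. 0) has_real_derivative flat ([:0, 0, 1:] * (P - pderiv P)) t) (at t)"
      using 2 by (auto simp: flat_def)
    then show ?thesis
      by (rule has_field_derivative_transform_within_open[of _ _ _ "{..<0}"])
        (use 2 in \<open>auto simp: flat_def\<close>)
  next
    \<comment> \<open>From the right the difference quotient at 0 is x P(x) exp(-x) with x = 1/h
      tending to infinity; from the left it vanishes.\<close>
    case 3
    have "((\<lambda>h. flat P h / h) \<longlongrightarrow> 0) (at_left 0)"
      by (rule tendsto_eventually) (auto simp: flat_def eventually_at_filter)
    moreover have "((\<lambda>h. flat P h / h) \<longlongrightarrow> 0) (at_right 0)"
    proof -
      have "((\<lambda>h. (inverse h) ^ 1 * poly P (inverse h) * exp (- inverse h)) \<longlongrightarrow> 0) (at_right (0::real))"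
        by (rule filterlim_compose[OF power_poly_exp_tendsto_0 filterlim_inverse_at_top_right])
      then show ?thesis
        by (rule Lim_transform_eventually)
          (auto simp: flat_def eventually_at_filter divide_inverse mult_ac)
    qed
    ultimately have "((\<lambda>h. flat P h / h) \<longlongrightarrow> 0) (at 0)"
      by (simp add: filterlim_at_split)
    then show ?thesis using 3 by (simp add: DERIV_def flat_def)
  qed
qed

lemma smooth_flat: "smooth (flat P)"
proof -
  have "C_k k (flat P)" for k
  proof (induction k arbitrary: P)
    case 0
    then show ?case
      by (auto intro!: continuous_at_imp_continuous_on DERIV_isCont[OF flat_deriv])
  next
    case (Suc k)
    have "frechet_derivative (flat P) (at t) 1 = flat ([:0, 0, 1:] * (P - pderiv P)) t" for t
      using flat_deriv[of P t]
      by (auto dest!: frechet_derivative_eqI simp: has_field_derivative_def)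
    moreover have "flat P differentiable (at t)" for t
      using flat_deriv[of P t] by (auto simp: real_differentiable_def)
    ultimately show ?case using Suc[of "[:0, 0, 1:] * (P - pderiv P)"] by simp
  qed
  then show ?thesis by (simp add: smooth_def)
qed

text \<open>Rescaling to T(N s)/N later gives functions that vanish near 0 and converge to the
  identity, with derivatives bounded by the same C; the two limits at infinity make values and
  gradients converge. With h(t) = exp(-1/t) for t > 0, at most one summand of h(s - 1) + h(-s - 1)
  is nonzero at each s, and both vanish for |s| \<le> 1.\<close>

lemma ex_smooth_truncation:
  obtains T T' :: "real \<Rightarrow> real" and C where "smooth T" "\<And>s. (T has_real_derivative T' s) (at s)"
    "continuous_on UNIV T'" "\<And>s. \<bar>s\<bar> \<le> 1 \<Longrightarrow> T s = 0" "\<And>s. \<bar>T' s\<bar> \<le> C"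
    "(T' \<longlongrightarrow> 1) at_infinity" "((\<lambda>s. T s / s) \<longlongrightarrow> 1) at_infinity"
proof -
  define h where "h = flat 1"
  define h' where "h' = flat [:0, 0, 1:]"
  define T where "T = (\<lambda>s. s * (h (s - 1) + h (- s - 1)))"
  define T' where "T' = (\<lambda>s. h (s - 1) + h (- s - 1) + s * (h' (s - 1) - h' (- s - 1)))"
  have h: "(h has_real_derivative h' t) (at t)" for t
    using flat_deriv[of 1 t] by (simp add: h_def h'_def pderiv_1)
  have hs: "smooth h" "smooth h'" by (simp_all add: h_def h'_def smooth_flat)
  have cont: "continuous_on UNIV h" "continuous_on UNIV h'"
    using hs smooth_continuous by auto
  have 1: "smooth T" unfolding T_def
    by (intro smooth_mult smooth_add smooth_ident smooth_compose[OF hs(1)] smooth_diff smooth_const)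
      (use smooth_diff[OF smooth_const smooth_ident, of 0] in simp)
  have 2: "(T has_real_derivative T' s) (at s)" for s
    unfolding T_def T'_def
    by (rule derivative_eq_intros DERIV_chain'[where g=h, OF _ h] refl)+ (simp add: algebra_simps)
  have 3: "continuous_on UNIV T'" unfolding T'_def
    by (intro continuous_intros continuous_on_compose2[OF cont(1)]
        continuous_on_compose2[OF cont(2)]) auto
  have 4: "T s = 0" if "\<bar>s\<bar> \<le> 1" for s
    using that by (auto simp: T_def h_def flat_def)
  have T'even: "T' (- s) = T' s" for s by (simp add: T'_def algebra_simps)
  have Todd: "T (- s) = - T s" for s by (simp add: T_def algebra_simps)
  have T't: "(T' \<longlongrightarrow> 1) at_top"
  proof (rule Lim_transform_eventually)
    show "((\<lambda>s. exp (- (1 / (s - 1))) + s * ((1 / (s - 1))\<^sup>2 * exp (- (1 / (s - 1))))) \<longlongrightarrow> (1::real)) at_top"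
      by real_asymp
    show "\<forall>\<^sub>F s in at_top. exp (- (1 / (s - 1))) + s * ((1 / (s - 1))\<^sup>2 * exp (- (1 / (s - 1)))) = T' s"
      using eventually_gt_at_top[of 1]
      by eventually_elim (auto simp: T'_def h_def h'_def flat_def power2_eq_square)
  qed
  have Tt: "((\<lambda>s. T s / s) \<longlongrightarrow> 1) at_top"
  proof (rule Lim_transform_eventually)
    show "((\<lambda>s. exp (- (1 / (s - 1)))) \<longlongrightarrow> (1::real)) at_top"
      by real_asymp
    show "\<forall>\<^sub>F s in at_top. exp (- (1 / (s - 1))) = T s / s"
      using eventually_gt_at_top[of 1]
      by eventually_elim (auto simp: T_def h_def flat_def)
  qed
  have 5: "(T' \<longlongrightarrow> 1) at_infinity"
    unfolding at_infinity_eq_at_top_bot filterlim_sup filterlim_at_bot_mirror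
    using T't by (simp add: filterlim_sup filterlim_at_bot_mirror T'even)
  have 6: "((\<lambda>s. T s / s) \<longlongrightarrow> 1) at_infinity"
    unfolding at_infinity_eq_at_top_bot
    using Tt by (simp add: filterlim_sup filterlim_at_bot_mirror Todd)
  \<comment> \<open>Beyond R the derivative is within 1 of its limit 1, hence at most 2; on [-R, R]
    it is bounded by continuity.\<close>
  obtain R where R: "\<And>s. \<bar>s\<bar> \<ge> R \<Longrightarrow> \<bar>T' s - 1\<bar> < 1"
    using tendstoD[OF 5, of 1] unfolding eventually_at_infinity by (auto simp: dist_real_def)
  have "compact (T' ` {-R..R})"
    using 3 by (intro compact_continuous_image) (auto intro: continuous_on_subset)
  then have "bounded (T' ` {-R..R})" by (rule compact_imp_bounded)
  then obtain C where C: "\<And>s. s \<in> {-R..R} \<Longrightarrow> \<bar>T' s\<bar> \<le> C"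
    unfolding bounded_iff by (metis imageI real_norm_def)
  have 7: "\<bar>T' s\<bar> \<le> max C 2" for s
  proof (cases "\<bar>s\<bar> \<ge> R")
    case True
    then show ?thesis using R[of s] by linarith
  next
    case False
    then have "\<bar>T' s\<bar> \<le> C" by (intro C) auto
    then show ?thesis by simp
  qed
  show thesis using that[OF 1 2 3 4 7 5 6] .
qed

text \<open>These bumps pass statements about test functions on to indicators of boxes. For every n
  they are positive exactly on the open box, and raising n sharpens the factors exp(-1/(n s))
  towards 1.\<close>

lemma ex_test_functions_box:
  assumes "cbox a b \<subseteq> \<Omega>"
  obtains \<phi> where "\<And>n. \<phi> n \<in> test_functions \<Omega>" "\<And>n x. 0 \<le> \<phi> n x" "\<And>n x. \<phi> n x \<le> 1"
    "\<And>x. (\<lambda>n. \<phi> n x) \<longlonglongrightarrow> indicator (box a b) x"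
proof -
  define h where "h = flat 1"
  have h01: "0 \<le> h t" "h t \<le> 1" for t by (auto simp: h_def flat_def)
  have h0: "h t = 0 \<longleftrightarrow> t \<le> 0" for t by (auto simp: h_def flat_def)
  define \<phi> where "\<phi> = (\<lambda>(n::nat) x. \<Prod>i\<in>Basis. h (real (Suc n) * (x \<bullet> i - a \<bullet> i)) * h (real (Suc n) * (b \<bullet> i - x \<bullet> i)))"
  have ne: "{x. \<phi> n x \<noteq> 0} = box a b" for n
    by (auto simp: \<phi>_def prod_zero_iff h0 mem_box not_le zero_less_mult_iff)
  have cl: "closure {x. \<phi> n x \<noteq> 0} \<subseteq> cbox a b" for n
    unfolding ne by (intro closure_minimal box_subset_cbox) auto
  have "smooth (\<phi> n)" for n
    unfolding \<phi>_def h_def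
    by (intro smooth_prod smooth_mult smooth_compose[OF smooth_flat] smooth_diff smooth_const smooth_inner) auto
  moreover have "compact (closure {x. \<phi> n x \<noteq> 0})" for n
    using cl compact_cbox by (metis bounded_cbox bounded_subset closed_closure compact_eq_bounded_closed)
  ultimately have "\<phi> n \<in> test_functions \<Omega>" for n
    using cl assms by (fastforce simp: test_functions_def smooth_def)
  moreover have "0 \<le> \<phi> n x" "\<phi> n x \<le> 1" for n x
    by (auto simp: \<phi>_def h01 intro!: prod_nonneg prod_le_1 mult_le_one)
  moreover have "(\<lambda>n. \<phi> n x) \<longlonglongrightarrow> indicator (box a b) x" for x
  proof (cases "x \<in> box a b")
    case False
    then have "\<phi> n x = 0" for n using ne by blast
    then show ?thesis using False by simp
  next
    case True
    have *: "(\<lambda>n. h (real (Suc n) * t)) \<longlonglongrightarrow> 1" if "t > 0" for t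
    proof -
      have "(\<lambda>n. exp (- (1 / (real (Suc n) * t)))) \<longlonglongrightarrow> 1" using that by real_asymp
      moreover have "exp (- (1 / (real (Suc n) * t))) = h (real (Suc n) * t)" for n
        using that by (simp add: h_def flat_def del: of_nat_Suc)
      ultimately show ?thesis by simp
    qed
    have "(\<lambda>n. \<phi> n x) \<longlonglongrightarrow> (\<Prod>i\<in>(Basis::'a set). 1 * 1)"
      unfolding \<phi>_def using True by (intro tendsto_prod tendsto_mult *) (auto simp: mem_box)
    then show ?thesis using True by simp
  qed
  ultimately show thesis by (rule that)
qed

section \<open>Test functions and integration by parts\<close>

definition grad :: "('a::euclidean_space \<Rightarrow> real) \<Rightarrow> 'a \<Rightarrow> 'a" where
  "grad \<phi> x = (\<Sum>i\<in>Basis. frechet_derivative \<phi> (at x) i *\<^sub>R i)"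

lemma grad_inner: "i \<in> Basis \<Longrightarrow> grad \<phi> x \<bullet> i = frechet_derivative \<phi> (at x) i"
  by (simp add: grad_def inner_sum_left inner_Basis if_distrib cong: if_cong)

lemma grad_eqI:
  assumes "(\<phi> has_derivative (\<lambda>v. g \<bullet> v)) (at x)" shows "grad \<phi> x = g"
  by (simp add: grad_def frechet_derivative_eqI[OF assms] euclidean_representation)

lemma smooth_has_derivative:
  assumes "smooth \<phi>" shows "(\<phi> has_derivative (\<lambda>v. grad \<phi> x \<bullet> v)) (at x)"
proof -
  have 1: "(\<phi> has_derivative frechet_derivative \<phi> (at x)) (at x)"
    using smooth_differentiable[OF assms] frechet_derivative_works by blast
  interpret linear "frechet_derivative \<phi> (at x)" by (rule has_derivative_linear[OF 1])
  have "frechet_derivative \<phi> (at x) v = grad \<phi> x \<bullet> v" for v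
  proof -
    have "frechet_derivative \<phi> (at x) v = frechet_derivative \<phi> (at x) (\<Sum>i\<in>Basis. (v \<bullet> i) *\<^sub>R i)"
      by (simp add: euclidean_representation)
    also have "\<dots> = (\<Sum>i\<in>Basis. (v \<bullet> i) *\<^sub>R frechet_derivative \<phi> (at x) i)"
      by (simp only: sum scale)
    also have "\<dots> = grad \<phi> x \<bullet> v"
      by (simp add: grad_def inner_sum_left inner_commute[of v] mult.commute)
    finally show ?thesis .
  qed
  then have "frechet_derivative \<phi> (at x) = (\<lambda>v. grad \<phi> x \<bullet> v)" by blast
  with 1 show ?thesis by simp
qed

lemma continuous_on_grad: "smooth \<phi> \<Longrightarrow> continuous_on S (grad \<phi>)"
  unfolding grad_def
  by (intro continuous_intros smooth_continuous smooth_partial)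

lemma grad_add: "smooth \<phi> \<Longrightarrow> smooth \<psi> \<Longrightarrow> grad (\<lambda>x. \<phi> x + \<psi> x) x = grad \<phi> x + grad \<psi> x"
  by (rule grad_eqI) (auto intro!: derivative_eq_intros smooth_has_derivative simp: inner_add_left)

lemma grad_cmult: "smooth \<phi> \<Longrightarrow> grad (\<lambda>x. c * \<phi> x) x = c *\<^sub>R grad \<phi> x"
  by (rule grad_eqI) (auto intro!: derivative_eq_intros smooth_has_derivative)

lemma grad_zero: "grad (\<lambda>x. 0) x = 0"
  by (rule grad_eqI) auto

lemma grad_compose:
  assumes "(T has_real_derivative d) (at (\<phi> x))" "smooth \<phi>"
  shows "grad (\<lambda>x. T (\<phi> x)) x = d *\<^sub>R grad \<phi> x"
  using has_derivative_compose[OF smooth_has_derivative[OF assms(2)] assms(1)[unfolded has_field_derivative_def]]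
  by (intro grad_eqI) simp

text \<open>Any compact set outside which the function vanishes may take the place of the support,
  so closure properties follow from unions and intersections of such sets.\<close>

lemma test_functions_iff:
  "\<phi> \<in> test_functions \<Omega> \<longleftrightarrow> smooth \<phi> \<and> (\<exists>K. compact K \<and> K \<subseteq> \<Omega> \<and> (\<forall>x. x \<notin> K \<longrightarrow> \<phi> x = 0))"
proof
  assume "\<phi> \<in> test_functions \<Omega>"
  then show "smooth \<phi> \<and> (\<exists>K. compact K \<and> K \<subseteq> \<Omega> \<and> (\<forall>x. x \<notin> K \<longrightarrow> \<phi> x = 0))"
    using closure_subset[of "{x. \<phi> x \<noteq> 0}"] unfolding test_functions_def smooth_def by blast
next
  assume "smooth \<phi> \<and> (\<exists>K. compact K \<and> K \<subseteq> \<Omega> \<and> (\<forall>x. x \<notin> K \<longrightarrow> \<phi> x = 0))"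
  then obtain K where K: "smooth \<phi>" "compact K" "K \<subseteq> \<Omega>" "\<And>x. x \<notin> K \<Longrightarrow> \<phi> x = 0" by blast
  then have "closure {x. \<phi> x \<noteq> 0} \<subseteq> K"
    by (intro closure_minimal compact_imp_closed) auto
  moreover have "compact (closure {x. \<phi> x \<noteq> 0})"
    using calculation K(2) by (meson bounded_subset closed_closure compact_eq_bounded_closed)
  ultimately show "\<phi> \<in> test_functions \<Omega>"
    using K by (auto simp: test_functions_def smooth_def)
qed

lemma grad_outside:
  assumes "closed K" "\<And>x. x \<notin> K \<Longrightarrow> \<phi> x = 0" "x \<notin> K" shows "grad \<phi> x = 0"
proof (rule grad_eqI)
  have "((\<lambda>x. 0) has_derivative (\<lambda>v. 0 \<bullet> v)) (at x)" by simp
  then show "(\<phi> has_derivative (\<lambda>v. 0 \<bullet> v)) (at x)"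
    by (rule has_derivative_transform_within_open[of _ _ _ _ "- K"]) (use assms in \<open>auto simp: open_Compl\<close>)
qed

lemma test_functions_obtain:
  assumes "\<phi> \<in> test_functions \<Omega>"
  obtains K where "smooth \<phi>" "compact K" "K \<subseteq> \<Omega>" "\<And>x. x \<notin> K \<Longrightarrow> \<phi> x = 0" "\<And>x. x \<notin> K \<Longrightarrow> grad \<phi> x = 0"
  using assms unfolding test_functions_iff by (metis compact_imp_closed grad_outside)

lemma test_functions_smooth: "\<phi> \<in> test_functions \<Omega> \<Longrightarrow> smooth \<phi>"
  by (simp add: test_functions_iff)

lemma test_functions_outside:
  "\<phi> \<in> test_functions \<Omega> \<Longrightarrow> x \<notin> \<Omega> \<Longrightarrow> \<phi> x = 0"
  "\<phi> \<in> test_functions \<Omega> \<Longrightarrow> x \<notin> \<Omega> \<Longrightarrow> grad \<phi> x = 0"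
  by (metis test_functions_obtain subsetD)+

lemma test_functions_mono: "\<Omega> \<subseteq> \<Omega>' \<Longrightarrow> \<phi> \<in> test_functions \<Omega> \<Longrightarrow> \<phi> \<in> test_functions \<Omega>'"
  unfolding test_functions_iff by blast

lemma test_functions_zero: "(\<lambda>x. 0) \<in> test_functions \<Omega>"
  unfolding test_functions_iff using smooth_const by (auto intro: exI[of _ "{}"])

lemma test_functions_cmult: "\<phi> \<in> test_functions \<Omega> \<Longrightarrow> (\<lambda>x. c * \<phi> x) \<in> test_functions \<Omega>"
  unfolding test_functions_iff using smooth_mult[OF smooth_const] by (metis mult_zero_right)

lemma test_functions_add:
  assumes "\<phi> \<in> test_functions \<Omega>" "\<psi> \<in> test_functions \<Omega>"
  shows "(\<lambda>x. \<phi> x + \<psi> x) \<in> test_functions \<Omega>"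
proof -
  obtain K L where "smooth \<phi>" "compact K" "K \<subseteq> \<Omega>" "\<And>x. x \<notin> K \<Longrightarrow> \<phi> x = 0"
    "smooth \<psi>" "compact L" "L \<subseteq> \<Omega>" "\<And>x. x \<notin> L \<Longrightarrow> \<psi> x = 0"
    using assms unfolding test_functions_iff by blast
  then show ?thesis
    unfolding test_functions_iff by (intro conjI smooth_add exI[of _ "K \<union> L"]) auto
qed

section \<open>Compactly supported functions and integration by parts\<close>

lemma integrable_compact_support:
  fixes f :: "'a::euclidean_space \<Rightarrow> 'b::euclidean_space"
  assumes "continuous_on UNIV f" "compact K" "\<And>x. x \<notin> K \<Longrightarrow> f x = 0"
  shows "integrable lborel f" "integrable lebesgue f"
proof -
  have "integrable lborel (\<lambda>x. indicat_real K x *\<^sub>R f x)"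
    using assms by (intro borel_integrable_compact) (auto intro: continuous_on_subset)
  moreover have "(\<lambda>x. indicat_real K x *\<^sub>R f x) = f"
    using assms(3) by (auto simp: indicator_def)
  ultimately show 1: "integrable lborel f" by simp
  then show "integrable lebesgue f" using integrable_completion borel_measurable_integrable by blast
qed

lemma bounded_compact_support:
  fixes f :: "'a::euclidean_space \<Rightarrow> 'b::euclidean_space"
  assumes "continuous_on UNIV f" "compact K" "\<And>x. x \<notin> K \<Longrightarrow> f x = 0"
  obtains B where "B > 0" "\<And>x. norm (f x) \<le> B"
proof -
  have "bounded (f ` K)"
    using assms by (intro compact_imp_bounded compact_continuous_image) (auto intro: continuous_on_subset)
  then obtain B where "B > 0" "\<And>x. x \<in> K \<Longrightarrow> norm (f x) \<le> B"
    unfolding bounded_pos by blast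
  then have "B > 0 \<and> (\<forall>x. norm (f x) \<le> B)" using assms(3) by (metis less_imp_le norm_zero)
  then show ?thesis using that by blast
qed

lemma lebesgue_on_zero_outside:
  fixes f :: "'a::euclidean_space \<Rightarrow> 'b::euclidean_space"
  assumes "S \<in> sets lebesgue" "\<And>x. x \<notin> S \<Longrightarrow> f x = 0"
  shows "integral\<^sup>L (lebesgue_on S) f = integral\<^sup>L lebesgue f"
    "integrable (lebesgue_on S) f \<longleftrightarrow> integrable lebesgue f"
proof -
  have "(\<lambda>x. if x \<in> S then f x else 0) = f" using assms(2) by auto
  then show "integral\<^sup>L (lebesgue_on S) f = integral\<^sup>L lebesgue f"
    "integrable (lebesgue_on S) f \<longleftrightarrow> integrable lebesgue f"
    using Lebesgue_Measure.integral_restrict_UNIV[OF assms(1), of f]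
      Lebesgue_Measure.integrable_restrict_UNIV[OF assms(1), of f] by simp_all
qed

text \<open>Translation invariance makes the integral of every difference quotient vanish, and
  dominated convergence passes to the derivative.\<close>

lemma integral_partial_eq_0:
  assumes w: "smooth w" "compact K" "\<And>x. x \<notin> K \<Longrightarrow> w x = 0" and i: "i \<in> Basis"
  shows "(LINT x|lebesgue. frechet_derivative w (at x) i) = 0"
proof -
  have g0: "x \<notin> K \<Longrightarrow> grad w x = 0" for x
    using grad_outside[OF compact_imp_closed] w by blast
  have wc: "continuous_on UNIV w" "continuous_on UNIV (grad w)"
    using w by (auto intro: smooth_continuous continuous_on_grad)
  have wm [measurable]: "w \<in> borel_measurable borel" using wc(1) by (simp add: borel_measurable_continuous_onI)
  have gm [measurable]: "grad w \<in> borel_measurable borel" using wc(2) by (simp add: borel_measurable_continuous_onI)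
  obtain L where L: "L > 0" "\<And>x. norm (grad w x) \<le> L"
    using bounded_compact_support[OF wc(2) w(2)] g0 by metis
  obtain R where R: "R > 0" "K \<subseteq> cball 0 R" 
    using bounded_subset_ballD[OF compact_imp_bounded[OF w(2)], of 0] ball_subset_cball by blast
  have wint: "integrable lborel w" using integrable_compact_support[OF wc(1) w(2,3)] by blast
  have "onorm (\<lambda>v. grad w x \<bullet> v) \<le> L" for x
    by (rule onorm_le) (metis Cauchy_Schwarz_ineq2 L(2) mult_right_mono norm_ge_zero order_trans real_norm_def)
  then have lip: "\<bar>w x - w y\<bar> \<le> L * norm (x - y)" for x y
    using differentiable_bound[of UNIV w "\<lambda>x v. grad w x \<bullet> v" L x y] smooth_has_derivative[OF w(1)]
    by auto
  define q where "q = (\<lambda>(n::nat) x. (w (inverse (real (Suc n)) *\<^sub>R i + x) - w x) * real (Suc n))"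
  have int_shift: "integrable lborel (\<lambda>x. w (c + x))" "(LINT x|lborel. w (c + x)) = (LINT x|lborel. w x)" for c
  proof -
    have "integrable (distr lborel borel ((+) c)) w" using wint by (simp add: lborel_distr_plus)
    then show "integrable lborel (\<lambda>x. w (c + x))" by (subst (asm) integrable_distr_eq) auto
    have "(LINT x|distr lborel borel ((+) c). w x) = (LINT x|lborel. w (c + x))"
      by (subst integral_distr) auto
    then show "(LINT x|lborel. w (c + x)) = (LINT x|lborel. w x)" by (simp add: lborel_distr_plus)
  qed
  have q0: "integral\<^sup>L lborel (q n) = 0" for n
    unfolding q_def using int_shift wint by simp
  have "(\<lambda>n. integral\<^sup>L lborel (q n)) \<longlonglongrightarrow> integral\<^sup>L lborel (\<lambda>x. grad w x \<bullet> i)"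
  proof (rule integral_dominated_convergence)
    \<comment> \<open>The quotients are bounded by the Lipschitz constant L, and since the steps
      have length at most 1, they vanish outside the ball of radius R + 1.\<close>
    show "integrable lborel (\<lambda>x. indicat_real (cball (0::'a) (R + 1)) x *\<^sub>R L)"
      by (intro borel_integrable_compact) auto
    show "AE x in lborel. (\<lambda>n. q n x) \<longlonglongrightarrow> grad w x \<bullet> i"
    proof (rule AE_I2)
      fix x
      have "((\<lambda>t. x + t *\<^sub>R i) has_derivative (\<lambda>t. t *\<^sub>R i)) (at 0)"
        by (auto intro!: derivative_eq_intros)
      from has_derivative_compose[OF this, of w "\<lambda>v. grad w x \<bullet> v"] smooth_has_derivative[OF w(1), of x]
      have "((\<lambda>t. w (x + t *\<^sub>R i)) has_real_derivative (grad w x \<bullet> i)) (at 0)"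
        by (simp add: has_field_derivative_def mult.commute[of _ "grad w x \<bullet> i"])
      then have "(\<lambda>t. (w (x + t *\<^sub>R i) - w x) / t) \<midarrow>0\<rightarrow> grad w x \<bullet> i"
        by (simp add: DERIV_def)
      moreover have "filterlim (\<lambda>n. inverse (real (Suc n))) (at 0) sequentially"
        unfolding filterlim_at using LIMSEQ_inverse_real_of_nat by auto
      ultimately have "(\<lambda>n. (w (x + inverse (real (Suc n)) *\<^sub>R i) - w x) / inverse (real (Suc n))) \<longlonglongrightarrow> grad w x \<bullet> i"
        by (rule filterlim_compose)
      then show "(\<lambda>n. q n x) \<longlonglongrightarrow> grad w x \<bullet> i"
        by (simp add: q_def divide_inverse add.commute del: of_nat_Suc)
    qed
    show "AE x in lborel. norm (q n x) \<le> indicat_real (cball 0 (R + 1)) x *\<^sub>R L" for n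
    proof (rule AE_I2)
      fix x
      have n1: "norm (inverse (real (Suc n)) *\<^sub>R i) \<le> 1" using i by (simp add: inverse_le_1_iff)
      show "norm (q n x) \<le> indicat_real (cball 0 (R + 1)) x *\<^sub>R L"
      proof (cases "x \<in> cball 0 (R + 1)")
        case True
        have "\<bar>w (inverse (real (Suc n)) *\<^sub>R i + x) - w x\<bar> \<le> L * inverse (real (Suc n))"
          using lip[of "inverse (real (Suc n)) *\<^sub>R i + x" x] i by simp
        then have "\<bar>q n x\<bar> \<le> L"
          by (simp add: q_def abs_mult divide_inverse[symmetric] pos_le_divide_eq del: of_nat_Suc)
        then show ?thesis using True by simp
      next
        case False
        then have "x \<notin> K" using R by auto
        moreover have "inverse (real (Suc n)) *\<^sub>R i + x \<notin> K"
        proof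
          assume "inverse (real (Suc n)) *\<^sub>R i + x \<in> K"
          then have "norm (inverse (real (Suc n)) *\<^sub>R i + x) \<le> R" using R by auto
          with n1 have "norm x \<le> R + 1"
            using norm_triangle_ineq4[of "inverse (real (Suc n)) *\<^sub>R i + x" "inverse (real (Suc n)) *\<^sub>R i"] by simp
          with False show False by simp
        qed
        ultimately show ?thesis using False by (simp add: q_def w(3))
      qed
    qed
  qed (simp_all add: q_def)
  then have "integral\<^sup>L lborel (\<lambda>x. grad w x \<bullet> i) = 0"
    unfolding q0 using LIMSEQ_unique tendsto_const by blast
  then show ?thesis
    using i by (subst integral_completion) (simp_all add: grad_inner[symmetric])
qed

text \<open>Only one factor has compact support, but this gives compact support to the product,
  whose partial derivatives integrate to zero.\<close>

lemma integration_by_parts: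
  assumes "smooth \<phi>" "\<psi> \<in> test_functions \<Omega>" "i \<in> Basis"
  shows "(LINT x|lebesgue. \<phi> x * frechet_derivative \<psi> (at x) i) = - (LINT x|lebesgue. (grad \<phi> x \<bullet> i) * \<psi> x)"
proof -
  obtain K where K: "smooth \<psi>" "compact K" "\<And>x. x \<notin> K \<Longrightarrow> \<psi> x = 0" "\<And>x. x \<notin> K \<Longrightarrow> grad \<psi> x = 0"
    using test_functions_obtain[OF assms(2)] by metis
  have "frechet_derivative (\<lambda>x. \<phi> x * \<psi> x) (at x) i = \<phi> x * frechet_derivative \<psi> (at x) i + (grad \<phi> x \<bullet> i) * \<psi> x" for x
  proof -
    have "((\<lambda>x. \<phi> x * \<psi> x) has_derivative (\<lambda>v. \<phi> x * (grad \<psi> x \<bullet> v) + (grad \<phi> x \<bullet> v) * \<psi> x)) (at x)"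
      using has_derivative_mult[OF smooth_has_derivative[OF assms(1)] smooth_has_derivative[OF K(1)]] .
    then show ?thesis using assms(3) by (simp add: frechet_derivative_eqI grad_inner)
  qed
  moreover have "(LINT x|lebesgue. frechet_derivative (\<lambda>x. \<phi> x * \<psi> x) (at x) i) = 0"
    using K assms by (intro integral_partial_eq_0 smooth_mult) auto
  moreover have "integrable lebesgue (\<lambda>x. \<phi> x * frechet_derivative \<psi> (at x) i)"
    using K assms by (intro integrable_compact_support[of _ K] continuous_intros smooth_continuous smooth_partial)
      (auto simp: grad_inner[symmetric])
  moreover have "integrable lebesgue (\<lambda>x. (grad \<phi> x \<bullet> i) * \<psi> x)"
    using K assms by (intro integrable_compact_support[of _ K] continuous_intros smooth_continuous continuous_on_grad) auto
  ultimately show ?thesis by simp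
qed

section \<open>The fundamental lemma of the calculus of variations\<close>

text \<open>Open boxes are an intersection-stable generator of the Borel sets. The Borel sets over
  which f has integral 0 contain them, are closed under countable disjoint unions and, because the
  total integral is 0, under complements; hence they are all Borel sets.\<close>

lemma AE_0_if_integral_box_0:
  fixes f :: "'a::euclidean_space \<Rightarrow> real"
  assumes f: "integrable lebesgue f" and 0: "integral\<^sup>L lebesgue f = 0"
    and box: "\<And>c d. (LINT x|lebesgue. indicator (box c d) x * f x) = 0"
  shows "AE x in lebesgue. f x = 0"
proof -
  have si: "set_integrable lebesgue A f" if "A \<in> sets borel" for A
    using integrable_mult_indicator[OF _ f, of A] that
    by (auto simp: set_integrable_def)
  have bor: "(LINT x:A|lebesgue. f x) = 0" if "A \<in> sets borel" for A
  proof -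
    let ?G = "range (\<lambda>(a, b). box a b) :: 'a set set"
    have bs: "B \<in> sets borel" if "B \<in> sigma_sets UNIV ?G" for B :: "'a set"
      using that by (simp add: borel_eq_box)
    have "Int_stable ?G"
    proof (rule Int_stableI_image)
      fix i j :: "'a \<times> 'a"
      obtain a b c d where "i = (a, b)" "j = (c, d)" by (metis surj_pair)
      then show "\<exists>k\<in>UNIV. (case i of (a, b) \<Rightarrow> box a b) \<inter> (case j of (a, b) \<Rightarrow> box a b) = (case k of (a, b) \<Rightarrow> box a b)"
        using box_Int_box[of a b c d] by auto
    qed
    moreover have "?G \<subseteq> Pow UNIV" by simp
    moreover have "A \<in> sigma_sets UNIV ?G" using that by (simp add: borel_eq_box)
    ultimately show ?thesis
    proof (induction rule: sigma_sets_induct_disjoint)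
      case (compl A)
      then have A: "A \<in> sets borel" using bs by auto
      have "(LINT x:(UNIV - A) \<union> A|lebesgue. f x) = (LINT x:UNIV - A|lebesgue. f x) + (LINT x:A|lebesgue. f x)"
        using si A by (intro set_integral_Un) auto
      then show ?case using compl 0 by (simp add: set_lebesgue_integral_def)
    next
      case (union A)
      then have A: "range A \<subseteq> sets borel" using bs by auto
      then have "(LINT x:(\<Union> (range A))|lebesgue. f x) = (\<Sum>i. (LINT x:A i|lebesgue. f x))"
        using union by (intro lebesgue_integral_countable_add si) (auto simp: disjoint_family_on_def)
      then show ?case using union by simp
    qed (use box in \<open>auto simp: set_lebesgue_integral_def\<close>)
  qed
  have "(LINT x:A|lebesgue. f x) = (LINT x:A|lebesgue. 0)" if A: "A \<in> sets lebesgue" for A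
  proof -
    \<comment> \<open>A Lebesgue set is an F_sigma set up to a null set, which carries the statement
      from Borel to Lebesgue sets.\<close>
    obtain C T where C: "fsigma C" "T \<in> null_sets lebesgue" "C \<union> T = A" "disjnt C T"
      using lebesgue_set_almost_fsigma[OF A] .
    have "AE x in lebesgue. x \<notin> T" by (rule AE_not_in[OF C(2)])
    then have "AE x in lebesgue. indicator A x *\<^sub>R f x = indicator C x *\<^sub>R f x"
      by eventually_elim (use C in \<open>auto simp: indicator_def\<close>)
    moreover have Cb: "C \<in> sets borel" using C(1) by (induction rule: fsigma.induct) auto
    moreover have "(\<lambda>x. indicator C x *\<^sub>R f x) \<in> borel_measurable lebesgue"
      using borel_measurable_integrable[OF si[OF Cb, unfolded set_integrable_def]] .
    ultimately show ?thesis
      using bor[of C] f A unfolding set_lebesgue_integral_def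
      by (subst integral_cong_AE[of _ _ "\<lambda>x. indicator C x *\<^sub>R f x"])
        (auto intro!: borel_measurable_scaleR borel_measurable_indicator)
  qed
  then show ?thesis
    using density_unique_real[OF f, of "\<lambda>x. 0"] by simp
qed

lemma locally_integrable_on_mult:
  fixes u :: "'a::euclidean_space \<Rightarrow> real"
  assumes "u locally_integrable_on \<Omega>" "continuous_on UNIV \<phi>" "compact K" "K \<subseteq> \<Omega>" "\<And>x. x \<notin> K \<Longrightarrow> \<phi> x = 0"
    and [measurable]: "\<Omega> \<in> sets lebesgue"
  shows "integrable (lebesgue_on \<Omega>) (\<lambda>x. u x * \<phi> x)" "integrable lebesgue (\<lambda>x. u x * \<phi> x)"
proof -
  have K: "K \<in> sets lebesgue" using assms(3) by (simp add: fmeasurableD lmeasurable_compact)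
  obtain B where B: "B > 0" "\<And>x. norm (\<phi> x) \<le> B" using bounded_compact_support[OF assms(2,3,5)] by blast
  have "integrable (lebesgue_on K) u" using assms by (simp add: locally_integrable_on_def)
  then have 1: "integrable lebesgue (\<lambda>x. if x \<in> K then u x else 0)"
    by (subst Lebesgue_Measure.integrable_restrict_UNIV[OF K])
  have \<phi>: "\<phi> \<in> borel_measurable lebesgue"
    using assms(2) by (simp add: borel_measurable_continuous_onI measurable_completion)
  have "integrable lebesgue (\<lambda>x. (if x \<in> K then u x else 0) * \<phi> x)"
  proof (rule Bochner_Integration.integrable_bound)
    show "integrable lebesgue (\<lambda>x. B * (if x \<in> K then u x else 0))"
      using 1 by (rule integrable_mult_right)
    show "(\<lambda>x. (if x \<in> K then u x else 0) * \<phi> x) \<in> borel_measurable lebesgue"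
      using borel_measurable_integrable[OF 1] \<phi> by (rule borel_measurable_times)
    show "AE x in lebesgue. norm ((if x \<in> K then u x else 0) * \<phi> x) \<le> norm (B * (if x \<in> K then u x else 0))"
      using B by (intro AE_I2) (auto simp: abs_mult mult.commute intro!: mult_right_mono)
  qed
  moreover have "(\<lambda>x. (if x \<in> K then u x else 0) * \<phi> x) = (\<lambda>x. u x * \<phi> x)"
    using assms(5) by auto
  ultimately show 2: "integrable lebesgue (\<lambda>x. u x * \<phi> x)" by simp
  then show "integrable (lebesgue_on \<Omega>) (\<lambda>x. u x * \<phi> x)"
    using assms(4,5) by (subst lebesgue_on_zero_outside) auto
qed

lemma locally_integrable_on_mult_test:
  fixes u :: "'a::euclidean_space \<Rightarrow> real"
  assumes "u locally_integrable_on \<Omega>" "\<phi> \<in> test_functions \<Omega>" "\<Omega> \<in> sets lebesgue"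
  shows "integrable (lebesgue_on \<Omega>) (\<lambda>x. u x * \<phi> x)"
    "i \<in> Basis \<Longrightarrow> integrable (lebesgue_on \<Omega>) (\<lambda>x. u x * frechet_derivative \<phi> (at x) i)"
proof -
  obtain K where K: "smooth \<phi>" "compact K" "K \<subseteq> \<Omega>" "\<And>x. x \<notin> K \<Longrightarrow> \<phi> x = 0" "\<And>x. x \<notin> K \<Longrightarrow> grad \<phi> x = 0"
    using test_functions_obtain[OF assms(2)] by metis
  show "integrable (lebesgue_on \<Omega>) (\<lambda>x. u x * \<phi> x)"
    by (rule locally_integrable_on_mult[OF assms(1) smooth_continuous[OF K(1)] K(2,3,4) assms(3)])
  assume "i \<in> Basis"
  then show "integrable (lebesgue_on \<Omega>) (\<lambda>x. u x * frechet_derivative \<phi> (at x) i)"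
    using K(5) by (intro locally_integrable_on_mult[OF assms(1) smooth_continuous[OF smooth_partial[OF K(1)]] K(2,3) _ assms(3)])
       (auto simp: grad_inner[symmetric])
qed

text \<open>Smooth bumps converge to the indicator of an open box, so u has integral zero over every
  box whose closure lies in \<Omega>. Cutting u off to one closed box gives an integrable function
  to which \<open>AE_0_if_integral_box_0\<close> applies, and countably many closed boxes exhaust
  \<Omega>.\<close>

lemma fundamental_lemma_calculus_of_variations:
  fixes u :: "'a::euclidean_space \<Rightarrow> real"
  assumes \<Omega>: "open \<Omega>" and u: "u locally_integrable_on \<Omega>"
    and 0: "\<And>\<phi>. \<phi> \<in> test_functions \<Omega> \<Longrightarrow> (LINT x|lebesgue_on \<Omega>. u x * \<phi> x) = 0"
  shows "AE x in lebesgue_on \<Omega>. u x = 0"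
proof -
  have \<Omega>m: "\<Omega> \<in> sets lebesgue" using \<Omega> by (simp add: borel_open)
  have intK: "integrable lebesgue (\<lambda>x. if x \<in> cbox a b then u x else 0)" if "cbox a b \<subseteq> \<Omega>" for a b
    using u that by (subst Lebesgue_Measure.integrable_restrict_UNIV) (auto simp: locally_integrable_on_def)
  have box0: "(LINT x|lebesgue. indicator (box a b) x * u x) = 0" if ab: "cbox a b \<subseteq> \<Omega>" for a b
  proof -
    obtain \<phi> where \<phi>: "\<And>n. \<phi> n \<in> test_functions (cbox a b)" "\<And>n x. 0 \<le> \<phi> n x" "\<And>n x. \<phi> n x \<le> 1"
      "\<And>x. (\<lambda>n. \<phi> n x) \<longlonglongrightarrow> indicator (box a b) x"
      using ex_test_functions_box[OF order_refl[of "cbox a b"]] by metis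
    have \<phi>\<Omega>: "\<phi> n \<in> test_functions \<Omega>" for n using test_functions_mono[OF ab] \<phi>(1) by blast
    have \<phi>0: "\<phi> n x = 0" if "x \<notin> cbox a b" for n x using test_functions_outside(1)[OF \<phi>(1) that] .
    have 1: "integrable lebesgue (\<lambda>x. u x * \<phi> n x)" for n
      by (rule locally_integrable_on_mult(2)[OF u smooth_continuous[OF test_functions_smooth[OF \<phi>(1)]] compact_cbox ab \<phi>0 \<Omega>m])
    have 2: "(LINT x|lebesgue. u x * \<phi> n x) = 0" for n
      using 0[OF \<phi>\<Omega>, of n] test_functions_outside(1)[OF \<phi>\<Omega>] by (subst (asm) lebesgue_on_zero_outside[OF \<Omega>m]) auto
    have lim: "(\<lambda>n. u x * \<phi> n x) \<longlonglongrightarrow> indicator (box a b) x * u x" for x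
      using tendsto_mult[OF tendsto_const \<phi>(4)[of x], of "u x"] by (simp add: mult.commute)
    have "(\<lambda>n. LINT x|lebesgue. u x * \<phi> n x) \<longlonglongrightarrow> (LINT x|lebesgue. indicator (box a b) x * u x)"
    proof (rule integral_dominated_convergence)
      show "(\<lambda>x. indicator (box a b) x * u x) \<in> borel_measurable lebesgue"
        by (rule borel_measurable_LIMSEQ_metric[OF borel_measurable_integrable[OF 1] lim])
      show "integrable lebesgue (\<lambda>x. \<bar>if x \<in> cbox a b then u x else 0\<bar>)"
        using intK[OF ab] by (rule integrable_abs)
      show "AE x in lebesgue. norm (u x * \<phi> n x) \<le> \<bar>if x \<in> cbox a b then u x else 0\<bar>" for n
        using \<phi>(2,3) \<phi>0 by (intro AE_I2) (auto simp: abs_mult intro!: mult_left_le)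
    qed (use lim borel_measurable_integrable[OF 1] in auto)
    then show ?thesis unfolding 2 by (simp add: LIMSEQ_const_iff)
  qed
  have null: "AE x in lebesgue. x \<in> cbox a b \<longleftrightarrow> x \<in> box a b" for a b :: 'a
  proof -
    have "AE x in lebesgue. x \<notin> cbox a b - box a b"
      by (intro AE_not_in) (use negligible_frontier_interval in \<open>auto simp: negligible_iff_null_sets\<close>)
    then show ?thesis by eventually_elim (use box_subset_cbox in blast)
  qed
  have cb: "AE x in lebesgue. x \<in> cbox a b \<longrightarrow> u x = 0" if ab: "cbox a b \<subseteq> \<Omega>" for a b
  proof -
    define f where "f = (\<lambda>x. if x \<in> cbox a b then u x else 0)"
    have fi: "integrable lebesgue f" using intK[OF ab] by (simp add: f_def)
    have f0: "(LINT x|lebesgue. indicator (box c d) x * f x) = 0" for c d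
    proof -
      \<comment> \<open>The corners of the intersection of the two boxes: up to the null boundary,
        every box meets \<open>cbox a b\<close> in a box that stays inside \<Omega>.\<close>
      define p q where "p = (\<Sum>i\<in>Basis. max (a\<bullet>i) (c\<bullet>i) *\<^sub>R i)" and "q = (\<Sum>i\<in>Basis. min (b\<bullet>i) (d\<bullet>i) *\<^sub>R i)"
      have pq: "box p q = box a b \<inter> box c d" "cbox p q \<subseteq> cbox a b"
        by (auto simp: p_def q_def mem_box)
      then have m: "(\<lambda>x. indicator (box p q) x * f x) \<in> borel_measurable lebesgue"
        using fi by (intro borel_measurable_times borel_measurable_indicator) auto
      have pf: "indicator (box p q) x * f x = indicator (box p q) x * u x" for x
        using pq box_subset_cbox[of a b] by (auto simp: f_def indicator_def)
      have "AE x in lebesgue. indicator (box c d) x * f x = indicator (box p q) x * f x"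
        using null[of a b] by eventually_elim (auto simp: pq f_def indicator_def)
      then have "(LINT x|lebesgue. indicator (box c d) x * f x) = (LINT x|lebesgue. indicator (box p q) x * f x)"
        using fi m by (intro integral_cong_AE borel_measurable_times borel_measurable_indicator) auto
      then show ?thesis using box0[of p q] pq ab unfolding pf by simp
    qed
    have "AE x in lebesgue. indicator (box a b) x * f x = f x"
      using null[of a b] by eventually_elim (auto simp: f_def indicator_def)
    then have "(LINT x|lebesgue. indicator (box a b) x * f x) = integral\<^sup>L lebesgue f"
      using fi by (intro integral_cong_AE borel_measurable_times borel_measurable_indicator) auto
    then have "AE x in lebesgue. f x = 0"
      using f0 by (intro AE_0_if_integral_box_0[OF fi]) auto
    then show ?thesis by eventually_elim (auto simp: f_def)
  qed
  obtain \<D> where \<D>: "countable \<D>" "\<D> \<subseteq> Pow \<Omega>" "\<And>X. X \<in> \<D> \<Longrightarrow> \<exists>a b. X = cbox a b" "\<Union> \<D> = \<Omega>"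
    using open_countable_Union_open_cbox[OF \<Omega>] by metis
  have "AE x in lebesgue. x \<in> X \<longrightarrow> u x = 0" if "X \<in> \<D>" for X
    using \<D>(2,3) cb that by blast
  then have "AE x in lebesgue. \<forall>X\<in>\<D>. x \<in> X \<longrightarrow> u x = 0"
    by (subst AE_ball_countable[OF \<D>(1)]) blast
  then have "AE x in lebesgue. x \<in> \<Omega> \<longrightarrow> u x = 0"
    by eventually_elim (use \<D>(4) in blast)
  then show ?thesis using \<Omega>m by (simp add: AE_restrict_space_iff)
qed

section \<open>Weak gradients: uniqueness, differences, test functions\<close>

lemma weak_gradient_unique:
  fixes g h :: "'a::euclidean_space \<Rightarrow> 'a"
  assumes \<Omega>: "open \<Omega>" and g: "has_weak_gradient \<Omega> u g" and h: "has_weak_gradient \<Omega> u h"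
  shows "AE x in lebesgue_on \<Omega>. g x = h x"
proof -
  have \<Omega>m: "\<Omega> \<in> sets lebesgue" using \<Omega> by (simp add: borel_open)
  have gl: "(\<lambda>x. g x \<bullet> i) locally_integrable_on \<Omega>" "(\<lambda>x. h x \<bullet> i) locally_integrable_on \<Omega>" for i
    using g h by (auto simp: has_weak_gradient_def locally_integrable_on_def)
  have "AE x in lebesgue_on \<Omega>. g x \<bullet> i - h x \<bullet> i = 0" if i: "i \<in> Basis" for i
  proof (rule fundamental_lemma_calculus_of_variations[OF \<Omega>])
    show "(\<lambda>x. g x \<bullet> i - h x \<bullet> i) locally_integrable_on \<Omega>"
      using gl by (auto simp: locally_integrable_on_def)
    fix \<phi> assume \<phi>: "\<phi> \<in> test_functions \<Omega>"
    have "(LINT x|lebesgue_on \<Omega>. (g x \<bullet> i) * \<phi> x) = (LINT x|lebesgue_on \<Omega>. (h x \<bullet> i) * \<phi> x)"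
      using g h \<phi> i unfolding has_weak_gradient_def by fastforce
    then show "(LINT x|lebesgue_on \<Omega>. (g x \<bullet> i - h x \<bullet> i) * \<phi> x) = 0"
      using locally_integrable_on_mult_test(1)[OF gl(1) \<phi> \<Omega>m] locally_integrable_on_mult_test(1)[OF gl(2) \<phi> \<Omega>m]
      by (simp add: left_diff_distrib)
  qed
  then have "AE x in lebesgue_on \<Omega>. \<forall>i\<in>Basis. g x \<bullet> i - h x \<bullet> i = 0"
    by (simp add: AE_ball_countable countable_finite)
  then show ?thesis by eventually_elim (auto intro: euclidean_eqI)
qed

text \<open>The choice hidden in \<open>weak_gradient\<close> is harmless, since all candidates
  agree almost everywhere.\<close>

lemma weak_gradient_eq:
  assumes "open \<Omega>" "has_weak_gradient \<Omega> u g"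
  shows "AE x in lebesgue_on \<Omega>. weak_gradient \<Omega> u x = g x"
  using weak_gradient_unique[OF assms(1) _ assms(2)] someI[of "has_weak_gradient \<Omega> u", OF assms(2)]
  unfolding weak_gradient_def by blast

lemma has_weak_gradient_diff:
  assumes "open \<Omega>" "has_weak_gradient \<Omega> u g" "has_weak_gradient \<Omega> v h"
  shows "has_weak_gradient \<Omega> (\<lambda>x. u x - v x) (\<lambda>x. g x - h x)"
proof -
  have \<Omega>m: "\<Omega> \<in> sets lebesgue" using assms by (simp add: borel_open)
  have l: "u locally_integrable_on \<Omega>" "v locally_integrable_on \<Omega>"
    "(\<lambda>x. g x \<bullet> i) locally_integrable_on \<Omega>" "(\<lambda>x. h x \<bullet> i) locally_integrable_on \<Omega>" for i
    using assms(2,3) by (auto simp: has_weak_gradient_def locally_integrable_on_def)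
  show ?thesis
    unfolding has_weak_gradient_def
  proof (intro conjI ballI)
    fix \<phi> :: "'a \<Rightarrow> real" and i :: 'a assume "\<phi> \<in> test_functions \<Omega>" "i \<in> Basis"
    then show "(LINT x|lebesgue_on \<Omega>. (u x - v x) * frechet_derivative \<phi> (at x) i) = - (LINT x|lebesgue_on \<Omega>. ((g x - h x) \<bullet> i) * \<phi> x)"
      using assms(2,3) locally_integrable_on_mult_test[OF l(1) _ \<Omega>m] locally_integrable_on_mult_test[OF l(2) _ \<Omega>m]
        locally_integrable_on_mult_test(1)[OF l(3) _ \<Omega>m] locally_integrable_on_mult_test(1)[OF l(4) _ \<Omega>m]
      by (simp add: left_diff_distrib inner_diff_left has_weak_gradient_def)
  qed (use assms(2,3) in \<open>auto simp: has_weak_gradient_def locally_integrable_on_def\<close>)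
qed

lemma has_weak_gradient_test_function:
  assumes "open \<Omega>" "\<phi> \<in> test_functions \<Omega>"
  shows "has_weak_gradient \<Omega> \<phi> (grad \<phi>)"
proof -
  have \<Omega>m: "\<Omega> \<in> sets lebesgue" using assms by (simp add: borel_open)
  obtain K where K: "smooth \<phi>" "compact K" "K \<subseteq> \<Omega>" "\<And>x. x \<notin> K \<Longrightarrow> \<phi> x = 0" "\<And>x. x \<notin> K \<Longrightarrow> grad \<phi> x = 0"
    using test_functions_obtain[OF assms(2)] by metis
  have "integrable lebesgue \<phi>" "integrable lebesgue (grad \<phi>)"
    using integrable_compact_support(2)[OF smooth_continuous[OF K(1)] K(2,4)]
      integrable_compact_support(2)[OF continuous_on_grad[OF K(1)] K(2,5)] by auto
  then have "integrable (lebesgue_on L) \<phi>" "integrable (lebesgue_on L) (grad \<phi>)" if "compact L" for L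
    using that by (auto simp: integrable_restrict_space fmeasurableD lmeasurable_compact simp del: real_scaleR_def
        intro!: integrable_mult_indicator)
  moreover have "(LINT x|lebesgue_on \<Omega>. \<phi> x * frechet_derivative \<psi> (at x) i) = - (LINT x|lebesgue_on \<Omega>. (grad \<phi> x \<bullet> i) * \<psi> x)"
    if "\<psi> \<in> test_functions \<Omega>" "i \<in> Basis" for \<psi> i
    using integration_by_parts[OF K(1) that] test_functions_outside(1)[OF assms(2)] test_functions_outside(1)[OF that(1)]
    by (simp add: lebesgue_on_zero_outside(1)[OF \<Omega>m])
  ultimately show ?thesis by (simp add: has_weak_gradient_def locally_integrable_on_def)
qed

section \<open>Morrey's inequality\<close>

lemma integral_lborel_affine:
  fixes f :: "'a::euclidean_space \<Rightarrow> real"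
  assumes "c \<noteq> 0" "f \<in> borel_measurable borel"
  shows "(LINT x|lborel. f (t + c *\<^sub>R x)) = (LINT x|lborel. f x) / \<bar>c\<bar> ^ DIM('a)"
proof -
  have "(LINT x|lborel. f x) = (LINT x|density (distr lborel borel (\<lambda>x. t + c *\<^sub>R x)) (\<lambda>_. ennreal (\<bar>c\<bar> ^ DIM('a))). f x)"
    using lborel_affine[OF assms(1), of t] by simp
  also have "\<dots> = (LINT x|distr lborel borel (\<lambda>x. t + c *\<^sub>R x). (\<bar>c\<bar> ^ DIM('a)) *\<^sub>R f x)"
    using assms(2) by (subst integral_density) auto
  also have "\<dots> = (LINT x|lborel. (\<bar>c\<bar> ^ DIM('a)) *\<^sub>R f (t + c *\<^sub>R x))"
    using assms(2) by (subst integral_distr) auto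
  also have "\<dots> = \<bar>c\<bar> ^ DIM('a) * (LINT x|lborel. f (t + c *\<^sub>R x))"
    by simp
  finally show ?thesis using assms(1) by simp
qed

text \<open>Weighted Young inequality with equality at s = A. The free A is adjusted after
  integration over a cube, which yields Hoelder's inequality.\<close>

lemma Young_powr:
  fixes s A p :: real
  assumes "p > 1" "s \<ge> 0" "A > 0"
  shows "s \<le> s powr p / (p * A powr (p - 1)) + (1 - 1 / p) * A"
proof -
  define q where "q = p / (p - 1)"
  have q: "q > 1" "1 / p + 1 / q = 1" "(p - 1) * q = p"
    using assms(1) by (auto simp: q_def field_simps)
  have "s * A powr (p - 1) \<le> s powr p / p + (A powr (p - 1)) powr q / q"
    using Youngs_inequality[of p q s "A powr (p - 1)"] assms q by auto
  also have "(A powr (p - 1)) powr q = A powr p" using q by (simp add: powr_powr)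
  also have "\<dots> = A * A powr (p - 1)" using assms by (simp add: powr_mult_base)
  finally have "s * A powr (p - 1) \<le> s powr p / p + A * A powr (p - 1) / q" .
  then have "s \<le> (s powr p / p + A * A powr (p - 1) / q) / A powr (p - 1)"
    using assms by (simp add: pos_le_divide_eq)
  also have "\<dots> = s powr p / (p * A powr (p - 1)) + A * (1 / q)"
    using assms by (simp add: add_divide_distrib)
  also have "1 / q = 1 - 1 / p" using q by simp
  finally show ?thesis by (simp add: mult.commute)
qed

lemma Hoelder_bound:
  fixes s :: "'a::euclidean_space \<Rightarrow> real"
  assumes p: "p > 1" and s: "continuous_on UNIV s" "\<And>x. s x \<ge> 0"
    and J: "integral (cbox a b) (\<lambda>x. s x powr p) \<le> J" "J > 0" and V: "measure lborel (cbox a b) = V" "V > 0"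
  shows "integral (cbox a b) s \<le> J powr (1 / p) * V powr (1 - 1 / p)"
proof -
  \<comment> \<open>The value that minimizes the integrated bound J / (p A^(p-1)) + V (1 - 1/p)
    A.\<close>
  define A where "A = (J / V) powr (1 / p)"
  have A: "A > 0" using J V by (simp add: A_def)
  have sp: "continuous_on UNIV (\<lambda>x. s x powr p)"
    using s p by (intro continuous_on_powr' continuous_intros) auto
  have "integral (cbox a b) s \<le> integral (cbox a b) (\<lambda>x. s x powr p * inverse (p * A powr (p - 1)) + (1 - 1 / p) * A)"
    using Young_powr[OF p _ A] s
    by (intro integral_le integrable_continuous continuous_intros continuous_on_subset[OF sp] continuous_on_subset[OF s(1)])
      (auto simp: divide_inverse)
  also have "\<dots> = integral (cbox a b) (\<lambda>x. s x powr p) * inverse (p * A powr (p - 1)) + V * ((1 - 1 / p) * A)"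
    using V
    by (subst Henstock_Kurzweil_Integration.integral_add)
      (auto intro!: integrable_continuous continuous_intros continuous_on_subset[OF sp])
  also have "\<dots> \<le> J * inverse (p * A powr (p - 1)) + V * ((1 - 1 / p) * A)"
    using J p A by (intro add_right_mono mult_right_mono) auto
  also have "A powr (p - 1) = (J / V) powr (1 - 1 / p)"
    using p by (simp add: A_def powr_powr field_simps)
  also have "J * inverse (p * (J / V) powr (1 - 1 / p)) = J powr (1 / p) * V powr (1 - 1 / p) / p"
  proof -
    have "J = J powr (1 / p) * J powr (1 - 1 / p)" using J by (simp add: powr_add[symmetric])
    then show ?thesis using J V p by (simp add: powr_divide field_simps)
  qed
  also have "V * ((1 - 1 / p) * A) = (1 - 1 / p) * (J powr (1 / p) * V powr (1 - 1 / p))"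
    using J V by (simp add: A_def powr_divide powr_diff field_simps)
  finally show ?thesis by (simp add: algebra_simps)
qed

context
  fixes \<phi> :: "'a::euclidean_space \<Rightarrow> real" and p M :: real and K
  assumes \<phi>: "smooth \<phi>" and K: "compact K" "\<And>x. x \<notin> K \<Longrightarrow> \<phi> x = 0"
    and p: "p > real DIM('a)" "p > 1"
    and M: "M > 0" "(LINT x|lebesgue. norm (grad \<phi> x) powr p) \<le> M"
begin

text \<open>The map from y to x + t (y - x) scales by t, so the change of variables divides by t ^
  d, and the integral over the scaled cube is at most the integral over the whole space.\<close>

lemma grad_powr_affine:
  assumes "t > 0"
  shows "integral (cbox a b) (\<lambda>y. norm (grad \<phi> (x + t *\<^sub>R (y - x))) powr p) \<le> M / t ^ DIM('a)"
proof -
  define s where "s = (\<lambda>y. norm (grad \<phi> y) powr p)"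
  have sc: "continuous_on UNIV s" unfolding s_def
    using p \<phi> by (intro continuous_on_powr' continuous_intros continuous_on_grad) auto
  have s0: "y \<notin> K \<Longrightarrow> s y = 0" for y
    using grad_outside[OF compact_imp_closed[OF K(1)] K(2)] by (auto simp: s_def)
  have sb: "s \<in> borel_measurable borel" using sc by (simp add: borel_measurable_continuous_onI)
  define s' where "s' = (\<lambda>y. s ((x - t *\<^sub>R x) + t *\<^sub>R y))"
  have s'c: "continuous_on UNIV s'" unfolding s'_def
    by (intro continuous_on_compose2[OF sc] continuous_intros) auto
  have "compact ((\<lambda>y. inverse t *\<^sub>R (y - (x - t *\<^sub>R x))) ` K)"
    using K(1) by (intro compact_continuous_image continuous_intros)
  moreover have "s' y = 0" if "y \<notin> (\<lambda>y. inverse t *\<^sub>R (y - (x - t *\<^sub>R x))) ` K" for y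
  proof -
    have "(x - t *\<^sub>R x) + t *\<^sub>R y \<notin> K"
    proof
      assume "(x - t *\<^sub>R x) + t *\<^sub>R y \<in> K"
      then have "inverse t *\<^sub>R (((x - t *\<^sub>R x) + t *\<^sub>R y) - (x - t *\<^sub>R x)) \<in> (\<lambda>y. inverse t *\<^sub>R (y - (x - t *\<^sub>R x))) ` K"
        by blast
      with that assms show False by simp
    qed
    then show ?thesis by (simp add: s'_def s0)
  qed
  ultimately have s'i: "integrable lborel s'"
    using integrable_compact_support(1)[OF s'c] by blast
  have "integral (cbox a b) (\<lambda>y. norm (grad \<phi> (x + t *\<^sub>R (y - x))) powr p) = integral (cbox a b) s'"
    by (simp add: s'_def s_def algebra_simps)
  also have "\<dots> \<le> integral UNIV s'"
    using s'c integrable_on_lborel[OF s'i]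
    by (intro integral_subset_le integrable_continuous continuous_on_subset[OF s'c]) (auto simp: s'_def s_def)
  also have "\<dots> = (LINT y|lborel. s' y)" using integral_lborel[OF s'i] .
  also have "\<dots> = (LINT y|lborel. s y) / t ^ DIM('a)"
    unfolding s'_def using integral_lborel_affine[OF _ sb, of t "x - t *\<^sub>R x"] assms by simp
  also have "\<dots> \<le> M / t ^ DIM('a)"
    using M(2) assms sb by (intro divide_right_mono) (auto simp: s_def integral_completion)
  finally show ?thesis .
qed

text \<open>The integral over y in Q of \<phi>(x + t (y - x)) joins |Q| \<phi>(x) at t = 0 to the
  integral of \<phi> at t = 1. Hoelder's inequality bounds its t-derivative by c0 t^(-d/p), which is
  integrable at 0 precisely because p > d.\<close>

lemma Morrey_cube:
  assumes r: "r > 0" and x: "x \<in> cbox c (c + r *\<^sub>R One)"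
  shows "\<bar>r ^ DIM('a) * \<phi> x - integral (cbox c (c + r *\<^sub>R One)) \<phi>\<bar>
    \<le> real DIM('a) * r * M powr (1 / p) * (r ^ DIM('a)) powr (1 - 1 / p) / (1 - real DIM('a) / p)"
proof -
  define Q where "Q = cbox c (c + r *\<^sub>R One)"
  define d where "d = real DIM('a)"
  define \<alpha> where "\<alpha> = 1 - d / p"
  have \<alpha>: "\<alpha> > 0" using p by (simp add: \<alpha>_def d_def)
  define c0 where "c0 = d * r * M powr (1 / p) * (r ^ DIM('a)) powr (1 - 1 / p)"
  have V: "measure lborel Q = r ^ DIM('a)" using r unfolding Q_def
    by (subst content_cbox) (auto simp: inner_add_left)
  define F where "F = (\<lambda>t. integral Q (\<lambda>y. \<phi> (x + t *\<^sub>R (y - x))))"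
  define F' where "F' = (\<lambda>t. integral Q (\<lambda>y. grad \<phi> (x + t *\<^sub>R (y - x)) \<bullet> (y - x)))"
  have \<phi>c: "continuous_on UNIV \<phi>" "continuous_on UNIV (grad \<phi>)"
    using \<phi> smooth_continuous continuous_on_grad by auto
  have dF: "(F has_real_derivative F' t) (at t)" for t
    unfolding F_def F'_def Q_def
  proof (rule leibniz_rule_field_derivative)
    fix t y
    have "((\<lambda>t. x + t *\<^sub>R (y - x)) has_derivative (\<lambda>t. t *\<^sub>R (y - x))) (at t)"
      by (auto intro!: derivative_eq_intros)
    from has_derivative_compose[OF this smooth_has_derivative[OF \<phi>]]
    show "((\<lambda>t. \<phi> (x + t *\<^sub>R (y - x))) has_real_derivative grad \<phi> (x + t *\<^sub>R (y - x)) \<bullet> (y - x)) (at t)"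
      by (simp add: has_field_derivative_def mult.commute[of _ "grad \<phi> (x + t *\<^sub>R (y - x)) \<bullet> (y - x)"])
  next
    show "continuous_on (UNIV \<times> cbox c (c + r *\<^sub>R One)) (\<lambda>(t, y). grad \<phi> (x + t *\<^sub>R (y - x)) \<bullet> (y - x))"
      unfolding split_beta by (intro continuous_intros continuous_on_compose2[OF \<phi>c(2)]) auto
  qed (auto intro!: integrable_continuous continuous_intros continuous_on_compose2[OF \<phi>c(1)])
  have yx: "norm (y - x) \<le> d * r" if "y \<in> Q" for y
  proof -
    have "norm (y - x) \<le> (\<Sum>i\<in>Basis. \<bar>(y - x) \<bullet> i\<bar>)" by (rule norm_le_l1)
    also have "\<dots> \<le> (\<Sum>i\<in>(Basis::'a set). r)"
    proof (rule sum_mono)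
      fix i :: 'a assume i: "i \<in> Basis"
      have "c \<bullet> i \<le> x \<bullet> i" "x \<bullet> i \<le> c \<bullet> i + r" "c \<bullet> i \<le> y \<bullet> i" "y \<bullet> i \<le> c \<bullet> i + r"
        using x that i by (auto simp: Q_def mem_box inner_add_left)
      then show "\<bar>(y - x) \<bullet> i\<bar> \<le> r" by (simp add: inner_diff_left)
    qed
    finally show ?thesis by (simp add: d_def)
  qed
  have F': "\<bar>F' t\<bar> \<le> c0 * t powr (- d / p)" if t: "t > 0" for t
  proof -
    let ?s = "\<lambda>y. norm (grad \<phi> (x + t *\<^sub>R (y - x)))"
    have sc: "continuous_on UNIV ?s" by (intro continuous_intros continuous_on_compose2[OF \<phi>c(2)]) auto
    have "norm (F' t) \<le> integral Q (\<lambda>y. (d * r) * ?s y)"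
      unfolding F'_def Q_def
    proof (rule integral_norm_bound_integral)
      show "norm (grad \<phi> (x + t *\<^sub>R (y - x)) \<bullet> (y - x)) \<le> d * r * ?s y" if "y \<in> cbox c (c + r *\<^sub>R One)" for y
      proof -
        have "norm (grad \<phi> (x + t *\<^sub>R (y - x)) \<bullet> (y - x)) \<le> ?s y * norm (y - x)"
          using Cauchy_Schwarz_ineq2 by simp
        also have "\<dots> \<le> ?s y * (d * r)"
          using yx that by (intro mult_left_mono) (auto simp: Q_def)
        finally show ?thesis by (simp add: mult_ac)
      qed
    qed (intro integrable_continuous continuous_intros continuous_on_compose2[OF \<phi>c(2)]; simp)+
    also have "\<dots> = (d * r) * integral Q ?s" by simp
    also have "\<dots> \<le> (d * r) * ((M / t ^ DIM('a)) powr (1 / p) * (r ^ DIM('a)) powr (1 - 1 / p))"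
      using r t M V[unfolded Q_def] unfolding Q_def
      by (intro mult_left_mono Hoelder_bound[OF p(2) sc] grad_powr_affine) (auto simp: d_def)
    also have "(M / t ^ DIM('a)) powr (1 / p) = M powr (1 / p) * t powr (- d / p)"
      using M t by (simp add: powr_divide powr_realpow[symmetric] powr_powr d_def powr_minus_divide)
    finally show ?thesis by (simp add: c0_def mult_ac)
  qed
  \<comment> \<open>An antiderivative of the bound on F'. That bound blows up at 0, so F' is not
    integrated; instead H + F and H - F are shown to be increasing, which takes continuity at 0 but
    derivatives only inside the interval.\<close>
  define H where "H = (\<lambda>t. c0 / \<alpha> * t powr \<alpha>)"
  have dH: "(H has_real_derivative c0 * t powr (- d / p)) (at t)" if "t > 0" for t
    unfolding H_def using \<alpha> that by (auto intro!: derivative_eq_intros simp: \<alpha>_def)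
  have Hc: "continuous_on {0..1} H" unfolding H_def
    using \<alpha> by (intro continuous_intros continuous_on_powr') auto
  have Fc: "continuous_on {0..1} F"
    using dF by (meson DERIV_isCont continuous_at_imp_continuous_on)
  have "H 0 + F 0 \<le> H 1 + F 1"
  proof (rule DERIV_nonneg_imp_increasing_open[of 0 1 "\<lambda>t. H t + F t"])
    show "\<exists>y. ((\<lambda>t. H t + F t) has_real_derivative y) (at t) \<and> 0 \<le> y" if "0 < t" for t
      using DERIV_add[OF dH[OF that] dF[of t]] F'[OF that] by (intro exI conjI) auto
  qed (use Hc Fc in \<open>auto intro: continuous_on_add\<close>)
  moreover have "H 0 - F 0 \<le> H 1 - F 1"
  proof (rule DERIV_nonneg_imp_increasing_open[of 0 1 "\<lambda>t. H t - F t"])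
    show "\<exists>y. ((\<lambda>t. H t - F t) has_real_derivative y) (at t) \<and> 0 \<le> y" if "0 < t" for t
      using DERIV_diff[OF dH[OF that] dF[of t]] F'[OF that] by (intro exI conjI) auto
  qed (use Hc Fc in \<open>auto intro: continuous_on_diff\<close>)
  moreover have "H 0 = 0" "H 1 = c0 / \<alpha>" using \<alpha> by (auto simp: H_def)
  moreover have "F 0 = r ^ DIM('a) * \<phi> x" using V by (simp add: F_def Q_def)
  moreover have "F 1 = integral Q \<phi>" by (simp add: F_def)
  ultimately show ?thesis unfolding Q_def[symmetric] c0_def \<alpha>_def d_def by linarith
qed

text \<open>Both points lie in one cube of side |x - y|, whose lower corner is their coordinatewise
  minimum, and both values are compared with the average over it, whence the factor 2.\<close>

lemma Morrey_inequality:
  "\<bar>\<phi> x - \<phi> y\<bar> \<le> 2 * real DIM('a) / (1 - real DIM('a) / p) * norm (x - y) powr (1 - real DIM('a) / p) * M powr (1 / p)"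
proof (cases "x = y")
  case False
  define r where "r = norm (x - y)"
  have r: "r > 0" using False by (simp add: r_def)
  define c where "c = (\<Sum>i\<in>Basis. min (x \<bullet> i) (y \<bullet> i) *\<^sub>R i)"
  have xy: "x \<in> cbox c (c + r *\<^sub>R One)" "y \<in> cbox c (c + r *\<^sub>R One)"
    using Basis_le_norm[of _ "x - y"] by (auto simp: c_def mem_box inner_add_left inner_diff_left r_def abs_le_iff min_def algebra_simps)
  let ?B = "real DIM('a) * r * M powr (1 / p) * (r ^ DIM('a)) powr (1 - 1 / p) / (1 - real DIM('a) / p)"
  have "\<bar>r ^ DIM('a) * \<phi> x - r ^ DIM('a) * \<phi> y\<bar> \<le> 2 * ?B"
    using Morrey_cube[OF r xy(1)] Morrey_cube[OF r xy(2)] by linarith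
  then have "\<bar>\<phi> x - \<phi> y\<bar> * r ^ DIM('a) \<le> 2 * ?B"
  proof -
    have "r ^ DIM('a) * \<phi> x - r ^ DIM('a) * \<phi> y = (\<phi> x - \<phi> y) * r ^ DIM('a)" by (simp add: algebra_simps)
    moreover have "\<bar>(\<phi> x - \<phi> y) * r ^ DIM('a)\<bar> = \<bar>\<phi> x - \<phi> y\<bar> * r ^ DIM('a)" using r by (simp add: abs_mult)
    ultimately show ?thesis using \<open>\<bar>r ^ DIM('a) * \<phi> x - r ^ DIM('a) * \<phi> y\<bar> \<le> 2 * ?B\<close> by presburger
  qed
  then have "\<bar>\<phi> x - \<phi> y\<bar> \<le> 2 * ?B / r ^ DIM('a)"
    by (subst pos_le_divide_eq[OF zero_less_power[OF r]])
  also have "\<dots> = 2 * real DIM('a) / (1 - real DIM('a) / p) * (r * (r ^ DIM('a)) powr (1 - 1 / p) / r ^ DIM('a)) * M powr (1 / p)"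
    by (simp add: divide_inverse mult_ac)
  also have "r * (r ^ DIM('a)) powr (1 - 1 / p) / r ^ DIM('a) = r powr (1 - real DIM('a) / p)"
  proof -
    have "r powr (1 + (real DIM('a) * (1 - 1 / p) - real DIM('a))) = r powr (1 - real DIM('a) / p)"
      by (simp add: algebra_simps)
    then show ?thesis using r by (simp add: powr_realpow[symmetric] powr_powr powr_add powr_diff)
  qed
  finally show ?thesis by (simp add: r_def)
qed auto

end

text \<open>A ball of radius R inside D would have volume at least R times that of the unit ball,
  which exceeds the measure of D. Taking R \<ge> 1 gives R \<le> R ^ d and spares roots. This stands
  in for boundedness of D.\<close>

lemma ex_radius_meets_complement:
  fixes D :: "'a::euclidean_space set"
  assumes "D \<in> sets lebesgue" "emeasure lebesgue D < \<infinity>"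
  obtains R where "R > 0" "\<And>x. \<exists>y. y \<notin> D \<and> norm (x - y) \<le> R"
proof -
  define R where "R = 1 + measure lebesgue D / unit_ball_vol (real DIM('a))"
  have u: "unit_ball_vol (real DIM('a)) > 0" by simp
  have R: "R \<ge> 1" by (simp add: R_def)
  have "\<exists>y. y \<notin> D \<and> norm (x - y) \<le> R" for x
  proof (rule ccontr)
    assume "\<nexists>y. y \<notin> D \<and> norm (x - y) \<le> R"
    then have "cball x R \<subseteq> D" by (auto simp: dist_norm)
    then have "measure lebesgue (cball x R) \<le> measure lebesgue D"
      using assms by (intro measure_mono_fmeasurable) (auto simp: fmeasurable_def)
    moreover have "measure lebesgue (cball x R) = unit_ball_vol (real DIM('a)) * R ^ DIM('a)"
      using R by (simp add: content_cball)
    moreover have "R \<le> R ^ DIM('a)" using R by (simp add: self_le_power)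
    then have "unit_ball_vol (real DIM('a)) * R \<le> unit_ball_vol (real DIM('a)) * R ^ DIM('a)"
      by (simp add: u)
    moreover have "measure lebesgue D < unit_ball_vol (real DIM('a)) * R"
      using u less_imp_neq[OF u] by (simp add: R_def distrib_left)
    ultimately show False by linarith
  qed
  then show ?thesis using R by (intro that[of R]) auto
qed

section \<open>Convexity of powers of the norm\<close>

text \<open>Stands in for Minkowski's inequality: both norms are at most the larger one. The
  constant is not sharp, but convergence arguments do not see it.\<close>

lemma norm_add_powr_le:
  fixes a b :: "'a::real_normed_vector"
  assumes "p > 0"
  shows "norm (a + b) powr p \<le> 2 powr p * (norm a powr p + norm b powr p)"
proof -
  have "norm (a + b) powr p \<le> (2 * max (norm a) (norm b)) powr p"
    using assms norm_triangle_ineq[of a b] by (intro powr_mono2) auto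
  also have "\<dots> = 2 powr p * max (norm a) (norm b) powr p" by (simp add: powr_mult)
  also have "max (norm a) (norm b) powr p \<le> norm a powr p + norm b powr p"
    by (simp add: max_def)
  finally show ?thesis by simp
qed

lemma powr_tangent_strict:
  fixes s a p :: real
  assumes "p > 1" "s \<ge> 0" "a > 0" "s \<noteq> a"
  shows "a powr p + p * a powr (p - 1) * (s - a) < s powr p"
proof -
  have d: "((\<lambda>x. x powr p) has_real_derivative p * x powr (p - 1)) (at x)" if "x > 0" for x
    using that by (auto intro!: derivative_eq_intros)
  have base: "a powr p = a * a powr (p - 1)" using assms powr_mult_base[of a "p - 1"] by simp
  consider "s = 0" | "0 < s" "s < a" | "a < s" using assms by linarith
  then show ?thesis
  proof cases
    \<comment> \<open>The derivative formula is stated for positive points, so s = 0 is computed by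
      hand: the claim reduces to a^p < p a^p.\<close>
    case 1
    have "a powr (p - 1) * a < p * (a powr (p - 1) * a)" using assms by simp
    then show ?thesis using 1 base by (simp add: mult_ac)
  next
    case 2
    obtain z where z: "s < z" "z < a" "a powr p - s powr p = (a - s) * (p * z powr (p - 1))"
      using MVT2[OF 2(2), of "\<lambda>x. x powr p" "\<lambda>x. p * x powr (p - 1)"] d 2 by (meson less_le_trans)
    have "z powr (p - 1) < a powr (p - 1)" using z assms by (intro powr_less_mono2) auto
    then have "(a - s) * (p * z powr (p - 1)) < (a - s) * (p * a powr (p - 1))" using 2 assms by simp
    then show ?thesis using z(3) by (simp add: algebra_simps)
  next
    case 3
    obtain z where z: "a < z" "z < s" "s powr p - a powr p = (s - a) * (p * z powr (p - 1))"
      using MVT2[OF 3, of "\<lambda>x. x powr p" "\<lambda>x. p * x powr (p - 1)"] d assms by (meson less_le_trans)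
    have "a powr (p - 1) < z powr (p - 1)" using z assms by (intro powr_less_mono2) auto
    then have "(s - a) * (p * a powr (p - 1)) < (s - a) * (p * z powr (p - 1))" using 3 assms by simp
    then show ?thesis using z(3) by (simp add: algebra_simps)
  qed
qed

lemma powr_tangent:
  fixes s a p :: real
  assumes "p > 1" "s \<ge> 0" "a \<ge> 0"
  shows "a powr p + p * a powr (p - 1) * (s - a) \<le> s powr p"
proof -
  consider "a = 0" | "s = a" | "a > 0" "s \<noteq> a" using assms by linarith
  then show ?thesis
    using powr_tangent_strict[OF assms(1,2), of a] by cases auto
qed

section \<open>The duality map and uniform convexity\<close>

text \<open>The gradient of |a|^p / p, which is also the flux of the p-Laplacian. At a = 0 it
  vanishes, also for p < 2.\<close>

definition dual_vector :: "real \<Rightarrow> 'a::real_inner \<Rightarrow> 'a" where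
  "dual_vector p a = norm a powr (p - 2) *\<^sub>R a"

lemma norm_dual_vector: "norm (dual_vector p a) = norm a powr (p - 1)"
proof (cases "a = 0")
  case False
  then show ?thesis using powr_mult_base[of "norm a" "p - 2"]
    by (simp add: dual_vector_def mult.commute)
qed (simp add: dual_vector_def)

text \<open>Cauchy-Schwarz reduces this to the scalar tangent inequality for the norms. Integrated,
  it is the convexity fact behind lower semicontinuity and both directions of the Euler-Lagrange
  equation.\<close>

lemma norm_powr_tangent:
  fixes a b :: "'a::real_inner"
  assumes "p > 1"
  shows "norm a powr p + p * (dual_vector p a \<bullet> (b - a)) \<le> norm b powr p"
proof (cases "a = 0")
  case False
  have "dual_vector p a \<bullet> (b - a) = norm a powr (p - 2) * (a \<bullet> b) - norm a powr (p - 2) * (norm a)\<^sup>2"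
    by (simp add: dual_vector_def inner_diff_right power2_norm_eq_inner algebra_simps)
  also have "\<dots> \<le> norm a powr (p - 2) * (norm a * norm b) - norm a powr (p - 2) * (norm a)\<^sup>2"
    using norm_cauchy_schwarz[of a b] by (intro diff_right_mono mult_left_mono) auto
  also have "\<dots> = norm a powr (p - 1) * (norm b - norm a)"
    using False powr_mult_base[of "norm a" "p - 2"] by (simp add: power2_eq_square algebra_simps)
  finally have "p * (dual_vector p a \<bullet> (b - a)) \<le> p * (norm a powr (p - 1) * (norm b - norm a))"
    using assms by (intro mult_left_mono) auto
  then show ?thesis using powr_tangent[OF assms, of "norm b" "norm a"] by (simp add: mult_ac)
qed (simp add: dual_vector_def)

lemma continuous_on_dual_vector:
  assumes "p > 1" shows "continuous_on UNIV (dual_vector p)"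
proof (rule continuous_at_imp_continuous_on, rule ballI)
  fix a :: 'a
  show "isCont (dual_vector p) a"
  proof (cases "a = 0")
    case True
    \<comment> \<open>For p < 2 the scalar factor of the vector is unbounded near 0, but its norm
      |x|^(p-1) still tends to 0.\<close>
    have "continuous_on UNIV (\<lambda>x::'a. norm x powr (p - 1))"
      using assms by (intro continuous_on_powr' continuous_intros) auto
    then have "isCont (\<lambda>x::'a. norm x powr (p - 1)) 0" by (simp add: continuous_on_eq_continuous_at)
    then have "(\<lambda>x. norm (dual_vector p x)) \<midarrow>(0::'a)\<rightarrow> 0"
      using assms by (simp add: norm_dual_vector isCont_def)
    then have "dual_vector p \<midarrow>(0::'a)\<rightarrow> 0" by (simp add: tendsto_norm_zero_iff)
    then show ?thesis using True by (simp add: isCont_def dual_vector_def)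
  next
    case False
    then show ?thesis unfolding dual_vector_def by (intro continuous_intros) auto
  qed
qed

text \<open>Young's inequality up to constants: whichever of r and e s is the smaller is estimated
  by the larger one. The free e lets either term be made small.\<close>

lemma powr_mult_le:
  fixes s r e p :: real
  assumes "p > 1" "s \<ge> 0" "r \<ge> 0" "e > 0"
  shows "s powr (p - 1) * r \<le> e * s powr p + e powr (1 - p) * r powr p"
proof (cases "r \<le> e * s")
  case True
  have "s powr (p - 1) * r \<le> s powr (p - 1) * (e * s)" using True by (intro mult_left_mono) auto
  also have "\<dots> = e * s powr p" using assms powr_mult_base[of s "p - 1"] by (simp add: mult_ac)
  also have "\<dots> \<le> \<dots> + e powr (1 - p) * r powr p" by simp
  finally show ?thesis .
next
  case False
  then have "s \<le> r / e" using assms by (simp add: pos_le_divide_eq mult.commute)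
  then have "s powr (p - 1) * r \<le> (r / e) powr (p - 1) * r"
    using assms by (intro mult_right_mono powr_mono2) auto
  also have "\<dots> = e powr (1 - p) * r powr p"
  proof -
    have "(r / e) powr (p - 1) = r powr (p - 1) * e powr (1 - p)"
      using assms powr_minus_divide[of e "p - 1"] by (simp add: powr_divide)
    then show ?thesis using assms powr_mult_base[of r "p - 1"] by (simp add: mult_ac)
  qed
  also have "\<dots> \<le> e * s powr p + \<dots>" using assms by simp
  finally show ?thesis .
qed

text \<open>Adding the tangent inequalities at the midpoint towards a and towards b cancels the
  first-order terms.\<close>

lemma norm_powr_midpoint_le:
  fixes a b :: "'a::real_inner"
  assumes "p > 1"
  shows "norm ((1/2) *\<^sub>R (a + b)) powr p \<le> (norm a powr p + norm b powr p) / 2"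
proof -
  let ?m = "(1/2) *\<^sub>R (a + b)"
  have "b - ?m = - (a - ?m)" by (simp add: algebra_simps) (simp add: scaleR_add_left[symmetric] scaleR_2[symmetric])
  then have "dual_vector p ?m \<bullet> (b - ?m) = - (dual_vector p ?m \<bullet> (a - ?m))" by (metis inner_minus_right)
  then show ?thesis
    using norm_powr_tangent[OF assms, of ?m a] norm_powr_tangent[OF assms, of ?m b] by (simp add: algebra_simps)
qed

text \<open>If the norms agree, the parallelogram law makes the midpoint strictly shorter; if they
  differ, strict convexity of the scalar power gives a strict inequality already for the mean of the
  norms.\<close>

lemma norm_powr_midpoint_eqD:
  fixes a b :: "'a::real_inner"
  assumes p: "p > 1" and eq: "norm ((1/2) *\<^sub>R (a + b)) powr p = (norm a powr p + norm b powr p) / 2"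
  shows "a = b"
proof (rule ccontr)
  assume "a \<noteq> b"
  define m where "m = (norm a + norm b) / 2"
  have le: "norm ((1/2) *\<^sub>R (a + b)) \<le> m" using norm_triangle_ineq[of a b] by (simp add: m_def)
  show False
  proof (cases "norm a = norm b")
    case True
    have "(norm (a + b))\<^sup>2 + (norm (a - b))\<^sup>2 = 2 * ((norm a)\<^sup>2 + (norm b)\<^sup>2)"
      by (simp add: power2_norm_eq_inner inner_simps inner_commute)
    moreover have "(norm (a - b))\<^sup>2 > 0" using \<open>a \<noteq> b\<close> by simp
    moreover have "2 * ((norm a)\<^sup>2 + (norm b)\<^sup>2) = (2 * norm a)\<^sup>2" using True by (simp add: power_mult_distrib)
    ultimately have "(norm (a + b))\<^sup>2 < (2 * norm a)\<^sup>2" by linarith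
    then have "norm (a + b) < 2 * norm a" by (rule power2_less_imp_less) simp
    then have "norm ((1/2) *\<^sub>R (a + b)) powr p < norm a powr p"
      using p by (intro powr_less_mono2) auto
    then show False using eq True by simp
  next
    case False
    then have m: "m > 0" "norm a \<noteq> m" "norm b \<noteq> m"
      by (auto simp: m_def) (smt (verit) norm_ge_zero)
    have "norm ((1/2) *\<^sub>R (a + b)) powr p \<le> m powr p" using le p by (intro powr_mono2) auto
    moreover have "m powr p + p * m powr (p - 1) * (norm a - m) < norm a powr p"
      "m powr p + p * m powr (p - 1) * (norm b - m) < norm b powr p"
      using m p by (auto intro!: powr_tangent_strict)
    moreover have "norm b - m = - (norm a - m)" by (simp add: m_def field_simps)
    then have "p * m powr (p - 1) * (norm b - m) = - (p * m powr (p - 1) * (norm a - m))"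
      by (metis mult_minus_right)
    moreover define X where "X = p * m powr (p - 1) * (norm a - m)"
    ultimately have "norm ((1/2) *\<^sub>R (a + b)) powr p \<le> m powr p" "m powr p + X < norm a powr p"
      "m powr p + - X < norm b powr p" by (simp_all only: X_def)
    then have "(norm a powr p + norm b powr p) / 2 \<le> m powr p" "2 * m powr p < norm a powr p + norm b powr p"
      unfolding eq by simp_all
    then show False by simp
  qed
qed

text \<open>This form of uniform convexity is homogeneous of degree p and linear in the midpoint deficit, so it
  can be integrated for every p > 1.  The constant comes from compactness of the normalized pairs.\<close>

lemma norm_powr_uniformly_convex:
  fixes p e :: real
  assumes p: "p > 1" and e: "e > 0"
  obtains C where "C \<ge> 0" "\<And>a b :: 'a::euclidean_space. norm (a - b) powr p \<le> e * (norm a powr p + norm b powr p)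
      + C * ((norm a powr p + norm b powr p) / 2 - norm ((1/2) *\<^sub>R (a + b)) powr p)"
proof -
  \<comment> \<open>Normalized pairs whose difference reaches the threshold e. Their components are
    distinct, so the midpoint deficit is positive on this compact set.\<close>
  define S where "S = {x::'a \<times> 'a. (norm (fst x)) powr p + (norm (snd x)) powr p = 1 \<and> e \<le> norm (fst x - snd x) powr p}"
  define def where "def = (\<lambda>x::'a\<times>'a. (norm (fst x) powr p + norm (snd x) powr p) / 2 - norm ((1/2) *\<^sub>R (fst x + snd x)) powr p)"
  have cont: "continuous_on UNIV (\<lambda>x::'a\<times>'a. norm (fst x) powr p + norm (snd x) powr p)"
    "continuous_on UNIV (\<lambda>x::'a\<times>'a. norm (fst x - snd x) powr p)" "continuous_on UNIV def"
    unfolding def_def using p by (intro continuous_intros continuous_on_powr'; simp)+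
  have "closed S" unfolding S_def
    by (intro closed_Collect_conj closed_Collect_eq closed_Collect_le cont continuous_intros)
  moreover have "bounded S"
  proof -
    have "norm x \<le> 2" if "x \<in> S" for x
    proof -
      have "norm (fst x) powr p \<ge> 0" "norm (snd x) powr p \<ge> 0" "norm (fst x) powr p + norm (snd x) powr p = 1"
        using that by (auto simp: S_def)
      then have "norm (fst x) powr p \<le> 1" "norm (snd x) powr p \<le> 1" by linarith+
      then have "norm (fst x) \<le> 1" "norm (snd x) \<le> 1"
        using p powr_less_mono2[of p 1] by (force simp: not_le[symmetric])+
      then show ?thesis using norm_Pair_le[of "fst x" "snd x"] by simp
    qed
    then show ?thesis unfolding bounded_iff by blast
  qed
  ultimately have S: "compact S" by (simp add: compact_eq_bounded_closed)
  have defpos: "def x > 0" if "x \<in> S" for x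
  proof -
    have "fst x \<noteq> snd x" using that e p by (auto simp: S_def)
    then have "def x \<noteq> 0" using norm_powr_midpoint_eqD[OF p, of "fst x" "snd x"] by (auto simp: def_def)
    moreover have "def x \<ge> 0" using norm_powr_midpoint_le[OF p, of "fst x" "snd x"] by (simp add: def_def)
    ultimately show ?thesis by simp
  qed
  obtain c where c: "c > 0" "\<And>x. x \<in> S \<Longrightarrow> c \<le> def x"
  proof (cases "S = {}")
    case True
    then show ?thesis using that[of 1] by auto
  next
    case False
    then obtain x where "x \<in> S" "\<And>y. y \<in> S \<Longrightarrow> def x \<le> def y"
      using continuous_attains_inf[OF S False, of def] continuous_on_subset[OF cont(3)] by blast
    then show ?thesis using that[of "def x"] defpos by blast
  qed
  show ?thesis
  \<comment> \<open>The difference is at most 2^p N, and on normalized pairs in S the deficit is at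
    least c; after rescaling, N is at most the deficit divided by c.\<close>
  proof (rule that[of "2 powr p / c"])
    show "2 powr p / c \<ge> 0" using c by simp
    fix a b :: 'a
    define N where "N = norm a powr p + norm b powr p"
    have N0: "N \<ge> 0" by (simp add: N_def)
    have d0: "def (a, b) \<ge> 0" using norm_powr_midpoint_le[OF p, of a b] by (simp add: def_def)
    have "norm (a - b) powr p \<le> e * N + 2 powr p / c * def (a, b)"
    proof (cases "e * N \<le> norm (a - b) powr p \<and> N > 0")
      case False
      then consider "norm (a - b) powr p \<le> e * N" | "N = 0" using N0 by linarith
      then show ?thesis
      proof cases
        case 1
        moreover have "2 powr p / c * def (a, b) \<ge> 0" using d0 c by simp
        ultimately show ?thesis by linarith
      next
        case 2
        have "norm a powr p \<ge> 0" "norm b powr p \<ge> 0" by simp_all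
        then have "norm a powr p = 0 \<and> norm b powr p = 0" using 2 unfolding N_def by linarith
        then have "a = 0" "b = 0" by auto
        then show ?thesis using d0 c N0 e by simp
      qed
    next
      case True
      define t where "t = N powr (- 1 / p)"
      have t: "t > 0" using True by (simp add: t_def)
      have "t powr p = N powr (- 1)" using p by (simp add: t_def powr_powr)
      then have tp: "t powr p = 1 / N" using True by (simp add: powr_neg_one)
      have sc: "norm (t *\<^sub>R v) powr p = norm v powr p / N" for v :: 'a
        using t by (simp add: powr_mult tp)
      have "(t *\<^sub>R a, t *\<^sub>R b) \<in> S"
        using True unfolding S_def
        by (simp add: sc scaleR_diff_right[symmetric] add_divide_distrib[symmetric] N_def[symmetric] pos_le_divide_eq del: norm_scaleR)
      then have "c \<le> def (t *\<^sub>R a, t *\<^sub>R b)" by (rule c(2))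
      also have "\<dots> = def (a, b) / N"
      proof -
        have "(1/2) *\<^sub>R (t *\<^sub>R a + t *\<^sub>R b) = t *\<^sub>R ((1/2) *\<^sub>R (a + b))" by (simp add: algebra_simps)
        then have "norm ((1/2) *\<^sub>R (t *\<^sub>R a + t *\<^sub>R b)) powr p = norm ((1/2) *\<^sub>R (a + b)) powr p / N"
          using sc by metis
        then show ?thesis using sc by (simp add: def_def diff_divide_distrib add_divide_distrib del: norm_scaleR)
      qed
      finally have "N \<le> def (a, b) / c" using c True by (simp add: field_simps)
      moreover have "norm (a - b) powr p \<le> 2 powr p * N"
        using norm_add_powr_le[of p a "- b"] p by (simp add: N_def)
      ultimately have "norm (a - b) powr p \<le> 2 powr p * (def (a, b) / c)"
        by (meson mult_left_mono order_trans powr_ge_zero)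
      also have "\<dots> \<le> e * N + 2 powr p / c * def (a, b)" using e N0 by simp
      finally show ?thesis .
    qed
    then show "norm (a - b) powr p \<le> e * (norm a powr p + norm b powr p)
      + 2 powr p / c * ((norm a powr p + norm b powr p) / 2 - norm ((1/2) *\<^sub>R (a + b)) powr p)"
      by (simp add: N_def def_def)
  qed
qed

section \<open>The space of p-integrable functions\<close>

definition Lp_space :: "real \<Rightarrow> ('a::euclidean_space \<Rightarrow> 'b::euclidean_space) set" where
  "Lp_space p = {g \<in> borel_measurable lebesgue. integrable lebesgue (\<lambda>x. norm (g x) powr p)}"

text \<open>The p-th power of the norm, so that pointwise inequalities integrate without roots. The
  functions are taken on the whole space, so one measure serves for every open set.\<close>

definition Lp_energy :: "real \<Rightarrow> ('a::euclidean_space \<Rightarrow> 'b::euclidean_space) \<Rightarrow> real" where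
  "Lp_energy p g = (LINT x|lebesgue. norm (g x) powr p)"

lemma Lp_spaceD:
  assumes "g \<in> Lp_space p"
  shows "g \<in> borel_measurable lebesgue" "integrable lebesgue (\<lambda>x. norm (g x) powr p)"
  using assms by (auto simp: Lp_space_def)

lemma Lp_energy_nonneg: "Lp_energy p g \<ge> 0"
  by (simp add: Lp_energy_def)

lemma Lp_energy_zero: "Lp_energy p (\<lambda>x. 0) = 0"
  by (simp add: Lp_energy_def)

lemma Lp_space_cmult: "g \<in> Lp_space p \<Longrightarrow> (\<lambda>x. c *\<^sub>R g x) \<in> Lp_space p"
  and Lp_energy_cmult: "Lp_energy p (\<lambda>x. c *\<^sub>R g x) = \<bar>c\<bar> powr p * Lp_energy p g"
  by (auto simp: Lp_space_def Lp_energy_def powr_mult)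

lemma Lp_space_add:
  assumes "p > 0" "g \<in> Lp_space p" "h \<in> Lp_space p"
  shows "(\<lambda>x. g x + h x) \<in> Lp_space p"
proof -
  have [measurable]: "g \<in> borel_measurable lebesgue" "h \<in> borel_measurable lebesgue"
    using assms by (auto simp: Lp_space_def)
  have "integrable lebesgue (\<lambda>x. norm (g x + h x) powr p)"
  proof (rule Bochner_Integration.integrable_bound)
    show "integrable lebesgue (\<lambda>x. 2 powr p * (norm (g x) powr p + norm (h x) powr p))"
      using assms by (auto simp: Lp_space_def)
    show "AE x in lebesgue. norm (norm (g x + h x) powr p) \<le> norm (2 powr p * (norm (g x) powr p + norm (h x) powr p))"
      using norm_add_powr_le[OF assms(1)] by (intro AE_I2) simp
  qed measurable
  then show ?thesis by (simp add: Lp_space_def)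
qed

lemma Lp_space_diff: "p > 0 \<Longrightarrow> g \<in> Lp_space p \<Longrightarrow> h \<in> Lp_space p \<Longrightarrow> (\<lambda>x. g x - h x) \<in> Lp_space p"
  using Lp_space_add[OF _ _ Lp_space_cmult[of h p "-1"], of g] by simp

lemma Lp_energy_add_le:
  assumes "p > 0" "g \<in> Lp_space p" "h \<in> Lp_space p"
  shows "Lp_energy p (\<lambda>x. g x + h x) \<le> 2 powr p * (Lp_energy p g + Lp_energy p h)"
proof -
  have "Lp_energy p (\<lambda>x. g x + h x) \<le> (LINT x|lebesgue. 2 powr p * (norm (g x) powr p + norm (h x) powr p))"
    unfolding Lp_energy_def
    using Lp_spaceD[OF Lp_space_add[OF assms]] Lp_spaceD[OF assms(2)] Lp_spaceD[OF assms(3)]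
    by (intro integral_mono norm_add_powr_le[OF assms(1)]) auto
  then show ?thesis using Lp_spaceD[OF assms(2)] Lp_spaceD[OF assms(3)] by (simp add: Lp_energy_def)
qed

lemma Lp_energy_minus_commute: "Lp_energy p (\<lambda>x. g x - h x) = Lp_energy p (\<lambda>x. h x - g x)"
  by (simp add: Lp_energy_def norm_minus_commute)

lemma Lp_energy_triangle:
  assumes "p > 0" "f \<in> Lp_space p" "g \<in> Lp_space p" "h \<in> Lp_space p"
  shows "Lp_energy p (\<lambda>x. f x - h x) \<le> 2 powr p * (Lp_energy p (\<lambda>x. f x - g x) + Lp_energy p (\<lambda>x. g x - h x))"
  using Lp_energy_add_le[OF assms(1) Lp_space_diff[OF assms(1,2,3)] Lp_space_diff[OF assms(1,3,4)]] by simp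

lemma Lp_energy_tendsto_imp_Cauchy:
  assumes p: "p > 0" and g: "\<And>n. g n \<in> Lp_space p" and h: "h \<in> Lp_space p"
    and lim: "(\<lambda>n. Lp_energy p (\<lambda>x. g n x - h x)) \<longlonglongrightarrow> 0" and e: "e > 0"
  shows "\<exists>N. \<forall>m\<ge>N. \<forall>n\<ge>N. Lp_energy p (\<lambda>x. g m x - g n x) < e"
proof -
  have "e / (2 * 2 powr p) > 0" using e by simp
  then obtain N where N: "\<And>n. n \<ge> N \<Longrightarrow> Lp_energy p (\<lambda>x. g n x - h x) < e / (2 * 2 powr p)"
    using order_tendstoD(2)[OF lim] unfolding eventually_sequentially by blast
  have "Lp_energy p (\<lambda>x. g m x - g n x) < e" if "m \<ge> N" "n \<ge> N" for m n
  proof -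
    have "Lp_energy p (\<lambda>x. g m x - g n x) \<le> 2 powr p * (Lp_energy p (\<lambda>x. g m x - h x) + Lp_energy p (\<lambda>x. h x - g n x))"
      by (rule Lp_energy_triangle[OF p g h g])
    also have "\<dots> < 2 powr p * (e / (2 * 2 powr p) + e / (2 * 2 powr p))"
      using N[OF that(1)] N[OF that(2)] unfolding Lp_energy_minus_commute[of p h]
      by (intro mult_strict_left_mono add_strict_mono) auto
    finally show ?thesis by simp
  qed
  then show ?thesis by blast
qed

section \<open>Completeness of the space of p-integrable functions\<close>

text \<open>Fatou's lemma; the integrability of the limit is part of what it yields.\<close>

lemma Lp_energy_le_limit:
  assumes "p > 0" "\<And>n. g n \<in> borel_measurable lebesgue" "AE x in lebesgue. (\<lambda>n. g n x) \<longlonglongrightarrow> h x" "h \<in> borel_measurable lebesgue"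
    and "\<And>n. integrable lebesgue (\<lambda>x. norm (g n x) powr p)" "eventually (\<lambda>n. Lp_energy p (g n) \<le> e) sequentially"
  shows "h \<in> Lp_space p" "Lp_energy p h \<le> e"
proof -
  obtain n where "Lp_energy p (g n) \<le> e" using eventually_happens'[OF sequentially_bot assms(6)] by blast
  then have e: "e \<ge> 0" using Lp_energy_nonneg[of p "g n"] by linarith
  have [measurable]: "g n \<in> borel_measurable lebesgue" "h \<in> borel_measurable lebesgue" for n using assms by auto
  have "AE x in lebesgue. (\<lambda>n. ennreal (norm (g n x) powr p)) \<longlonglongrightarrow> ennreal (norm (h x) powr p)"
    using assms(3)
  proof eventually_elim
    case (elim x)
    then have "(\<lambda>n. norm (g n x) powr p) \<longlonglongrightarrow> norm (h x) powr p"
      using assms(1) by (intro tendsto_powr' tendsto_intros) auto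
    then show ?case by (rule tendsto_ennrealI)
  qed
  then have "(\<integral>\<^sup>+x. ennreal (norm (h x) powr p) \<partial>lebesgue) = (\<integral>\<^sup>+x. liminf (\<lambda>n. ennreal (norm (g n x) powr p)) \<partial>lebesgue)"
    by (intro nn_integral_cong_AE) (auto elim!: eventually_mono intro!: lim_imp_Liminf[symmetric])
  also have "\<dots> \<le> liminf (\<lambda>n. \<integral>\<^sup>+x. ennreal (norm (g n x) powr p) \<partial>lebesgue)"
    by (rule nn_integral_liminf) simp
  also have "\<dots> \<le> ennreal e"
  proof (rule Liminf_le)
    show "\<forall>\<^sub>F n in sequentially. (\<integral>\<^sup>+x. ennreal (norm (g n x) powr p) \<partial>lebesgue) \<le> ennreal e"
      using assms(6) by eventually_elim (simp add: nn_integral_eq_integral[OF assms(5)] Lp_energy_def ennreal_leI)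
  qed simp
  finally have le: "(\<integral>\<^sup>+x. ennreal (norm (h x) powr p) \<partial>lebesgue) \<le> ennreal e" .
  then have "integrable lebesgue (\<lambda>x. norm (h x) powr p)"
    by (intro integrableI_bounded) (auto simp: le_less_trans[OF le])
  then show "h \<in> Lp_space p" by (simp add: Lp_space_def)
  have "ennreal (Lp_energy p h) \<le> ennreal e"
    using le nn_integral_eq_integral[OF Lp_spaceD(2)[OF \<open>h \<in> Lp_space p\<close>]] by (simp add: Lp_energy_def)
  then show "Lp_energy p h \<le> e" using e by simp
qed

text \<open>Riesz-Fischer with energies in place of norms: the increments along a subsequence are
  divided by (1/2)^k before their energies are summed, so almost everywhere they are eventually at
  most (1/2)^k and the subsequence converges.\<close>

lemma Lp_complete:
  fixes g :: "nat \<Rightarrow> 'a::euclidean_space \<Rightarrow> 'b::euclidean_space"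
  assumes p: "p > 0" and g: "\<And>n. g n \<in> Lp_space p"
    and Cauchy: "\<And>e. e > 0 \<Longrightarrow> \<exists>N. \<forall>m\<ge>N. \<forall>n\<ge>N. Lp_energy p (\<lambda>x. g m x - g n x) < e"
  obtains h where "h \<in> Lp_space p" "(\<lambda>n. Lp_energy p (\<lambda>x. g n x - h x)) \<longlonglongrightarrow> 0"
proof -
  have [measurable]: "g n \<in> borel_measurable lebesgue" for n using g by (simp add: Lp_space_def)
  \<comment> \<open>The second factor pays for the division by (1/2)^k; the first one remains as a
    summable bound.\<close>
  define \<epsilon> where "\<epsilon> = (\<lambda>k::nat. (1/2)^k * ((1/2)^k) powr p :: real)"
  have \<epsilon>: "\<epsilon> k > 0" for k by (simp add: \<epsilon>_def)
  obtain N where N: "\<And>k m n. m \<ge> N k \<Longrightarrow> n \<ge> N k \<Longrightarrow> Lp_energy p (\<lambda>x. g m x - g n x) < \<epsilon> k"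
    using Cauchy[OF \<epsilon>] by metis
  \<comment> \<open>Adding up the N j makes the index monotone and at least as large as both k and N
    k.\<close>
  define r where "r = (\<lambda>k::nat. k + (\<Sum>j\<le>k. N j))"
  have rN: "r k \<ge> N k" for k
    unfolding r_def by (metis atMost_iff finite_atMost le_add2 member_le_sum order_refl order_trans zero_le)
  have rS: "r (Suc k) \<ge> r k" and rk: "r k \<ge> k" for k by (auto simp: r_def)
  define \<Delta> where "\<Delta> = (\<lambda>k x. (norm (g (r (Suc k)) x - g (r k) x) / (1/2)^k) powr p)"
  have \<Delta>: "(\<integral>\<^sup>+x. ennreal (\<Delta> k x) \<partial>lebesgue) \<le> ennreal ((1/2)^k)" for k
  proof -
    have eq: "\<Delta> k x = norm (g (r (Suc k)) x - g (r k) x) powr p / ((1/2)^k) powr p" for x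
      unfolding \<Delta>_def by (simp add: powr_divide)
    have i: "integrable lebesgue (\<Delta> k)"
      unfolding eq using Lp_spaceD(2)[OF Lp_space_diff[OF p g g]] by auto
    have "(\<integral>\<^sup>+x. ennreal (\<Delta> k x) \<partial>lebesgue) = ennreal (LINT x|lebesgue. \<Delta> k x)"
      using i by (intro nn_integral_eq_integral) (auto simp: \<Delta>_def)
    also have "(LINT x|lebesgue. \<Delta> k x) = Lp_energy p (\<lambda>x. g (r (Suc k)) x - g (r k) x) / ((1/2)^k) powr p"
      unfolding eq by (simp add: Lp_energy_def)
    also have "\<dots> \<le> \<epsilon> k / ((1/2)^k) powr p"
      using N[of k "r (Suc k)" "r k"] rN[of k] rS[of k] by (intro divide_right_mono) auto
    also have "\<dots> = (1/2)^k" by (simp add: \<epsilon>_def)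
    finally show ?thesis by (simp add: ennreal_leI)
  qed
  have "(\<integral>\<^sup>+x. (\<Sum>k. ennreal (\<Delta> k x)) \<partial>lebesgue) = (\<Sum>k. \<integral>\<^sup>+x. ennreal (\<Delta> k x) \<partial>lebesgue)"
    by (intro nn_integral_suminf) (auto simp: \<Delta>_def)
  also have "\<dots> \<le> (\<Sum>k. ennreal ((1/2)^k))" using \<Delta> by (intro suminf_le) auto
  also have "\<dots> < \<infinity>" by (simp add: suminf_ennreal2 summable_geometric)
  finally have "AE x in lebesgue. (\<Sum>k. ennreal (\<Delta> k x)) \<noteq> \<infinity>"
    by (intro nn_integral_PInf_AE) (auto simp: \<Delta>_def)
  then have conv: "AE x in lebesgue. convergent (\<lambda>k. g (r k) x)"
  proof eventually_elim
    case (elim x)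
    then have "summable (\<lambda>k. \<Delta> k x)" by (intro summable_suminf_not_top) (auto simp: \<Delta>_def)
    then have "(\<lambda>k. \<Delta> k x) \<longlonglongrightarrow> 0" by (rule summable_LIMSEQ_zero)
    then have "\<forall>\<^sub>F k in sequentially. \<Delta> k x < 1" by (rule order_tendstoD) simp
    then have "\<forall>\<^sub>F k in sequentially. norm (g (r (Suc k)) x - g (r k) x) \<le> (1/2)^k"
    proof eventually_elim
      case (elim k)
      define y where "y = norm (g (r (Suc k)) x - g (r k) x) / (1/2)^k"
      have "y powr p < 1" using elim by (simp add: \<Delta>_def y_def)
      have "\<not> 1 < y"
      proof
        assume "1 < y"
        then have "1 powr p < y powr p" using p by (intro powr_less_mono2) auto
        with \<open>y powr p < 1\<close> show False by simp
      qed
      then have "y \<le> 1" by simp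
      then show ?case by (simp add: y_def pos_divide_le_eq)
    qed
    then have "summable (\<lambda>k. g (r (Suc k)) x - g (r k) x)"
      by (rule summable_comparison_test_ev) (simp add: summable_geometric)
    then have "convergent (\<lambda>n. \<Sum>k<n. g (r (Suc k)) x - g (r k) x)" by (simp add: summable_iff_convergent)
    then have "convergent (\<lambda>n. (g (r n) x - g (r 0) x) + g (r 0) x)"
      by (intro convergent_add convergent_const) (simp add: sum_lessThan_telescope[of "\<lambda>n. g (r n) x"])
    then show ?case by simp
  qed
  define h where "h = (\<lambda>x. lim (\<lambda>k. g (r k) x))"
  have hm: "h \<in> borel_measurable lebesgue" unfolding h_def by (rule borel_measurable_lim_metric) simp
  have lim: "AE x in lebesgue. (\<lambda>k. g (r k) x) \<longlonglongrightarrow> h x"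
    using conv by eventually_elim (simp add: h_def convergent_LIMSEQ_iff)
  \<comment> \<open>Fatou's lemma along the subsequence, with m fixed, turns the Cauchy condition
    into convergence of the whole sequence.\<close>
  have main: "(\<lambda>x. g m x - h x) \<in> Lp_space p \<and> Lp_energy p (\<lambda>x. g m x - h x) \<le> e"
    if m: "\<And>n. n \<ge> M \<Longrightarrow> Lp_energy p (\<lambda>x. g m x - g n x) \<le> e" for m M e
  proof -
    have *: "\<forall>\<^sub>F k in sequentially. Lp_energy p (\<lambda>x. g m x - g (r k) x) \<le> e"
      using eventually_ge_at_top[of M] by eventually_elim (use m rk order_trans in blast)
    have "AE x in lebesgue. (\<lambda>k. g m x - g (r k) x) \<longlonglongrightarrow> g m x - h x"
      using lim by eventually_elim (intro tendsto_intros)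
    then show ?thesis
      using Lp_energy_le_limit[OF p, of "\<lambda>k x. g m x - g (r k) x" "\<lambda>x. g m x - h x" e] hm *
        Lp_spaceD(2)[OF Lp_space_diff[OF p g g]] by auto
  qed
  show ?thesis
  proof (rule that)
    obtain M where "\<forall>m\<ge>M. \<forall>n\<ge>M. Lp_energy p (\<lambda>x. g m x - g n x) < 1" using Cauchy[of 1] by auto
    then have "(\<lambda>x. g M x - h x) \<in> Lp_space p" using main[of M M 1] by (auto intro: less_imp_le)
    then show "h \<in> Lp_space p" using Lp_space_diff[OF p g[of M], of "\<lambda>x. g M x - h x"] by simp
    show "(\<lambda>n. Lp_energy p (\<lambda>x. g n x - h x)) \<longlonglongrightarrow> 0"
    proof (rule LIMSEQ_I)
      fix e :: real assume e: "e > 0"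
      then obtain M where "\<forall>m\<ge>M. \<forall>n\<ge>M. Lp_energy p (\<lambda>x. g m x - g n x) < e / 2" using Cauchy[of "e/2"] by auto
      then have le: "Lp_energy p (\<lambda>x. g m x - h x) \<le> e / 2" if "m \<ge> M" for m
        using main[of M m "e/2"] that by (auto intro: less_imp_le)
      have "Lp_energy p (\<lambda>x. g m x - h x) < e" if "m \<ge> M" for m
        using le[OF that] e by linarith
      then show "\<exists>no. \<forall>n\<ge>no. norm (Lp_energy p (\<lambda>x. g n x - h x) - 0) < e"
        by (intro exI[of _ M]) (auto simp: Lp_energy_nonneg)
    qed
  qed
qed

section \<open>The duality pairing and convexity of the energy\<close>

lemma integrable_dual_pairing:
  assumes "p > 1" "g \<in> Lp_space p" "h \<in> Lp_space p"
  shows "integrable lebesgue (\<lambda>x. dual_vector p (g x) \<bullet> h x)"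
proof (rule Bochner_Integration.integrable_bound)
  note [measurable] = Lp_spaceD(1)[OF assms(2)] Lp_spaceD(1)[OF assms(3)] borel_measurable_continuous_onI[OF continuous_on_dual_vector[OF assms(1)]]
  show "integrable lebesgue (\<lambda>x. norm (g x) powr p + norm (h x) powr p)"
    using assms by (auto simp: Lp_space_def)
  show "(\<lambda>x. dual_vector p (g x) \<bullet> h x) \<in> borel_measurable lebesgue" by measurable
  have "norm (dual_vector p a \<bullet> b) \<le> norm (norm a powr p + norm b powr p)" for a b :: 'b
  proof -
    have "norm (dual_vector p a \<bullet> b) \<le> norm a powr (p - 1) * norm b"
      using Cauchy_Schwarz_ineq2[of "dual_vector p a" b] by (simp add: norm_dual_vector)
    also have "\<dots> \<le> norm a powr p + norm b powr p"
      using powr_mult_le[OF assms(1), of "norm a" "norm b" 1] by simp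
    finally show ?thesis by simp
  qed
  then show "AE x in lebesgue. norm (dual_vector p (g x) \<bullet> h x) \<le> norm (norm (g x) powr p + norm (h x) powr p)" by simp
qed

text \<open>Takes the place of Hoelder's inequality: e makes the first term small uniformly over
  bounded g, and then the second one tends to zero with the energy of h.\<close>

lemma dual_pairing_le:
  assumes "p > 1" "g \<in> Lp_space p" "h \<in> Lp_space p" "e > 0"
  shows "\<bar>LINT x|lebesgue. dual_vector p (g x) \<bullet> h x\<bar> \<le> e * Lp_energy p g + e powr (1 - p) * Lp_energy p h"
proof -
  have "\<bar>LINT x|lebesgue. dual_vector p (g x) \<bullet> h x\<bar> \<le> (LINT x|lebesgue. \<bar>dual_vector p (g x) \<bullet> h x\<bar>)"
    using integral_norm_bound[of lebesgue "\<lambda>x. dual_vector p (g x) \<bullet> h x"] by simp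
  also have "\<dots> \<le> (LINT x|lebesgue. e * norm (g x) powr p + e powr (1 - p) * norm (h x) powr p)"
  proof (rule integral_mono)
    show "integrable lebesgue (\<lambda>x. \<bar>dual_vector p (g x) \<bullet> h x\<bar>)"
      using integrable_dual_pairing[OF assms(1-3)] by (rule integrable_abs)
    show "integrable lebesgue (\<lambda>x. e * norm (g x) powr p + e powr (1 - p) * norm (h x) powr p)"
      using Lp_spaceD(2)[OF assms(2)] Lp_spaceD(2)[OF assms(3)] by simp
    fix x
    have "\<bar>dual_vector p (g x) \<bullet> h x\<bar> \<le> norm (g x) powr (p - 1) * norm (h x)"
      using Cauchy_Schwarz_ineq2[of "dual_vector p (g x)" "h x"] by (simp add: norm_dual_vector)
    also have "\<dots> \<le> e * norm (g x) powr p + e powr (1 - p) * norm (h x) powr p"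
      using assms by (intro powr_mult_le) auto
    finally show "\<bar>dual_vector p (g x) \<bullet> h x\<bar> \<le> e * norm (g x) powr p + e powr (1 - p) * norm (h x) powr p" .
  qed
  also have "\<dots> = e * Lp_energy p g + e powr (1 - p) * Lp_energy p h"
    using Lp_spaceD(2)[OF assms(2)] Lp_spaceD(2)[OF assms(3)] by (simp add: Lp_energy_def)
  finally show ?thesis .
qed

lemma dual_pairing_tendsto_0:
  assumes "p > 1" "\<And>n. g n \<in> Lp_space p" "\<And>n. Lp_energy p (g n) \<le> B"
    "\<And>n. h n \<in> Lp_space p" "(\<lambda>n. Lp_energy p (h n)) \<longlonglongrightarrow> 0"
  shows "(\<lambda>n. LINT x|lebesgue. dual_vector p (g n x) \<bullet> h n x) \<longlonglongrightarrow> 0"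
proof (rule LIMSEQ_I)
  fix e :: real assume e: "e > 0"
  define G where "G = B + 1"
  have G: "G > 0" using Lp_energy_nonneg[of p "g 0"] assms(3)[of 0] by (simp add: G_def)
  define d where "d = e / (2 * G)"
  have d: "d > 0" using e G by (simp add: d_def)
  have "(\<lambda>n. d powr (1 - p) * Lp_energy p (h n)) \<longlonglongrightarrow> d powr (1 - p) * 0"
    by (intro tendsto_intros assms)
  then obtain N where N: "\<And>n. n \<ge> N \<Longrightarrow> d powr (1 - p) * Lp_energy p (h n) < e / 2"
    using order_tendstoD(2)[of _ 0 sequentially "e/2"] e unfolding eventually_sequentially by auto
  have dG: "d * G = e / 2" using G by (simp add: d_def)
  have "norm ((LINT x|lebesgue. dual_vector p (g n x) \<bullet> h n x) - 0) < e" if "n \<ge> N" for n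
  proof -
    have "d * Lp_energy p (g n) \<le> d * G" using assms(3)[of n] d by (intro mult_left_mono) (auto simp: G_def)
    then show ?thesis using N[OF that] dual_pairing_le[OF assms(1,2,4) d, of n n] dG by simp
  qed
  then show "\<exists>no. \<forall>n\<ge>no. norm ((LINT x|lebesgue. dual_vector p (g n x) \<bullet> h n x) - 0) < e" by blast
qed

lemma Lp_energy_tangent:
  assumes "p > 1" "g \<in> Lp_space p" "h \<in> Lp_space p"
  shows "Lp_energy p g + p * (LINT x|lebesgue. dual_vector p (g x) \<bullet> (h x - g x)) \<le> Lp_energy p h"
proof -
  have p0: "p > 0" using assms by simp
  note i = integrable_dual_pairing[OF assms(1,2) Lp_space_diff[OF p0 assms(3,2)]]
  have "Lp_energy p g + p * (LINT x|lebesgue. dual_vector p (g x) \<bullet> (h x - g x))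
      = (LINT x|lebesgue. norm (g x) powr p + p * (dual_vector p (g x) \<bullet> (h x - g x)))"
    using i Lp_spaceD(2)[OF assms(2)] by (simp add: Lp_energy_def)
  also have "\<dots> \<le> Lp_energy p h"
    unfolding Lp_energy_def using i Lp_spaceD(2)[OF assms(2)] Lp_spaceD(2)[OF assms(3)]
    by (intro integral_mono norm_powr_tangent assms) auto
  finally show ?thesis .
qed

lemma Lp_energy_uniformly_convex:
  fixes p e :: real
  assumes "p > 1" "e > 0"
  obtains C where "C \<ge> 0" "\<And>g h :: 'a::euclidean_space \<Rightarrow> 'b::euclidean_space. g \<in> Lp_space p \<Longrightarrow> h \<in> Lp_space p \<Longrightarrow>
    Lp_energy p (\<lambda>x. g x - h x) \<le> e * (Lp_energy p g + Lp_energy p h)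
      + C * ((Lp_energy p g + Lp_energy p h) / 2 - Lp_energy p (\<lambda>x. (1/2) *\<^sub>R (g x + h x)))"
proof -
  obtain C where C: "C \<ge> 0" "\<And>a b :: 'b. norm (a - b) powr p \<le> e * (norm a powr p + norm b powr p)
      + C * ((norm a powr p + norm b powr p) / 2 - norm ((1/2) *\<^sub>R (a + b)) powr p)"
    using norm_powr_uniformly_convex[OF assms] by blast
  show ?thesis
  proof (rule that[OF C(1)])
    fix g h :: "'a \<Rightarrow> 'b" assume gh: "g \<in> Lp_space p" "h \<in> Lp_space p"
    have p0: "p > 0" using assms by simp
    note i = Lp_spaceD(2)[OF gh(1)] Lp_spaceD(2)[OF gh(2)] Lp_spaceD(2)[OF Lp_space_diff[OF p0 gh]]
      Lp_spaceD(2)[OF Lp_space_cmult[OF Lp_space_add[OF p0 gh], of "1/2"]]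
    have "Lp_energy p (\<lambda>x. g x - h x) \<le> (LINT x|lebesgue. e * (norm (g x) powr p + norm (h x) powr p)
      + C * ((norm (g x) powr p + norm (h x) powr p) / 2 - norm ((1/2) *\<^sub>R (g x + h x)) powr p))"
      unfolding Lp_energy_def using i by (intro integral_mono C(2)) (auto simp del: norm_scaleR)
    also have "\<dots> = e * (Lp_energy p g + Lp_energy p h)
      + C * ((Lp_energy p g + Lp_energy p h) / 2 - Lp_energy p (\<lambda>x. (1/2) *\<^sub>R (g x + h x)))"
      unfolding Lp_energy_def using i by (simp del: norm_scaleR)
    finally show "Lp_energy p (\<lambda>x. g x - h x) \<le> e * (Lp_energy p g + Lp_energy p h)
      + C * ((Lp_energy p g + Lp_energy p h) / 2 - Lp_energy p (\<lambda>x. (1/2) *\<^sub>R (g x + h x)))" .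
  qed
qed

section \<open>Sobolev functions as limits of test functions\<close>

text \<open>An element of W_0^{1,p} given by its continuous representative and its gradient. The
  limit in u is required at every point, so u vanishes everywhere outside \<Omega>, and no
  integrability of u is demanded because the gradient controls it when p exceeds the dimension.
  Carrying g along avoids choosing a weak gradient.\<close>

definition sobolev_pair :: "real \<Rightarrow> 'a::euclidean_space set \<Rightarrow> ('a \<Rightarrow> real) \<Rightarrow> ('a \<Rightarrow> 'a) \<Rightarrow> bool" where
  "sobolev_pair p \<Omega> u g \<longleftrightarrow> g \<in> Lp_space p \<and>
     (\<exists>\<phi>. (\<forall>n. \<phi> n \<in> test_functions \<Omega>) \<and> (\<forall>x. (\<lambda>n. \<phi> n x) \<longlonglongrightarrow> u x) \<and>
        (\<lambda>n. Lp_energy p (\<lambda>x. grad (\<phi> n) x - g x)) \<longlonglongrightarrow> 0)"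

lemma grad_test_function_Lp:
  assumes "\<phi> \<in> test_functions \<Omega>" "p > 0" shows "grad \<phi> \<in> Lp_space p"
proof -
  obtain K where K: "smooth \<phi>" "compact K" "\<And>x. x \<notin> K \<Longrightarrow> grad \<phi> x = 0"
    using test_functions_obtain[OF assms(1)] by metis
  have "continuous_on UNIV (\<lambda>x. norm (grad \<phi> x) powr p)"
    using assms(2) K(1) by (intro continuous_on_powr' continuous_intros continuous_on_grad) auto
  then have "integrable lebesgue (\<lambda>x. norm (grad \<phi> x) powr p)"
    using K by (intro integrable_compact_support(2)[of _ K]) auto
  moreover have "integrable lebesgue (grad \<phi>)"
    using K by (intro integrable_compact_support(2)[of _ K] continuous_on_grad) auto
  ultimately show ?thesis by (auto simp: Lp_space_def)
qed

lemma sobolev_pairE: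
  assumes "sobolev_pair p \<Omega> u g"
  obtains \<phi> where "g \<in> Lp_space p" "\<And>n. \<phi> n \<in> test_functions \<Omega>" "\<And>x. (\<lambda>n. \<phi> n x) \<longlonglongrightarrow> u x"
    "(\<lambda>n. Lp_energy p (\<lambda>x. grad (\<phi> n) x - g x)) \<longlonglongrightarrow> 0"
  using assms unfolding sobolev_pair_def by blast

lemma sobolev_pair_Lp: "sobolev_pair p \<Omega> u g \<Longrightarrow> g \<in> Lp_space p"
  by (simp add: sobolev_pair_def)

lemma sobolev_pair_test_function:
  assumes "\<phi> \<in> test_functions \<Omega>" "p > 0" shows "sobolev_pair p \<Omega> \<phi> (grad \<phi>)"
  unfolding sobolev_pair_def
  by (intro conjI grad_test_function_Lp[OF assms] exI[of _ "\<lambda>n. \<phi>"]) (simp_all add: assms(1) Lp_energy_zero)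

lemma sobolev_pair_mono: "\<Omega> \<subseteq> \<Omega>' \<Longrightarrow> sobolev_pair p \<Omega> u g \<Longrightarrow> sobolev_pair p \<Omega>' u g"
  unfolding sobolev_pair_def using test_functions_mono by blast

lemma sobolev_pair_outside: "sobolev_pair p \<Omega> u g \<Longrightarrow> x \<notin> \<Omega> \<Longrightarrow> u x = 0"
proof -
  assume "sobolev_pair p \<Omega> u g" and x: "x \<notin> \<Omega>"
  then obtain \<phi> where "\<And>n. \<phi> n \<in> test_functions \<Omega>" and lim: "(\<lambda>n. \<phi> n x) \<longlonglongrightarrow> u x"
    unfolding sobolev_pair_def by blast
  then have "\<phi> n x = 0" for n using test_functions_outside(1) x by blast
  with lim show "u x = 0" by (simp add: LIMSEQ_const_iff)
qed

lemma sobolev_pair_cmult: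
  assumes "sobolev_pair p \<Omega> u g"
  shows "sobolev_pair p \<Omega> (\<lambda>x. c * u x) (\<lambda>x. c *\<^sub>R g x)"
proof -
  obtain \<phi> where \<phi>: "g \<in> Lp_space p" "\<And>n. \<phi> n \<in> test_functions \<Omega>" "\<And>x. (\<lambda>n. \<phi> n x) \<longlonglongrightarrow> u x"
    "(\<lambda>n. Lp_energy p (\<lambda>x. grad (\<phi> n) x - g x)) \<longlonglongrightarrow> 0"
    using sobolev_pairE[OF assms] by blast
  have "(\<lambda>n. \<bar>c\<bar> powr p * Lp_energy p (\<lambda>x. grad (\<phi> n) x - g x)) \<longlonglongrightarrow> \<bar>c\<bar> powr p * 0"
    by (intro tendsto_intros \<phi>)
  moreover have "Lp_energy p (\<lambda>x. grad (\<lambda>x. c * \<phi> n x) x - c *\<^sub>R g x) = \<bar>c\<bar> powr p * Lp_energy p (\<lambda>x. grad (\<phi> n) x - g x)" for n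
    using Lp_energy_cmult[of p c "\<lambda>x. grad (\<phi> n) x - g x"] test_functions_smooth[OF \<phi>(2)]
    by (simp add: grad_cmult scaleR_diff_right)
  ultimately show ?thesis
    unfolding sobolev_pair_def using \<phi>
    by (intro conjI Lp_space_cmult exI[of _ "\<lambda>n x. c * \<phi> n x"] allI test_functions_cmult tendsto_intros) auto
qed

lemma sobolev_pair_add:
  assumes "p > 0" "sobolev_pair p \<Omega> u g" "sobolev_pair p \<Omega> v h"
  shows "sobolev_pair p \<Omega> (\<lambda>x. u x + v x) (\<lambda>x. g x + h x)"
proof -
  obtain \<phi> where \<phi>: "g \<in> Lp_space p" "\<And>n. \<phi> n \<in> test_functions \<Omega>" "\<And>x. (\<lambda>n. \<phi> n x) \<longlonglongrightarrow> u x"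
    "(\<lambda>n. Lp_energy p (\<lambda>x. grad (\<phi> n) x - g x)) \<longlonglongrightarrow> 0"
    using sobolev_pairE[OF assms(2)] by blast
  obtain \<psi> where \<psi>: "h \<in> Lp_space p" "\<And>n. \<psi> n \<in> test_functions \<Omega>" "\<And>x. (\<lambda>n. \<psi> n x) \<longlonglongrightarrow> v x"
    "(\<lambda>n. Lp_energy p (\<lambda>x. grad (\<psi> n) x - h x)) \<longlonglongrightarrow> 0"
    using sobolev_pairE[OF assms(3)] by blast
  have "(\<lambda>n. Lp_energy p (\<lambda>x. grad (\<lambda>x. \<phi> n x + \<psi> n x) x - (g x + h x))) \<longlonglongrightarrow> 0"
  proof (rule real_tendsto_sandwich)
    show "\<forall>\<^sub>F n in sequentially. 0 \<le> Lp_energy p (\<lambda>x. grad (\<lambda>x. \<phi> n x + \<psi> n x) x - (g x + h x))"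
      by (simp add: Lp_energy_nonneg)
    show "\<forall>\<^sub>F n in sequentially. Lp_energy p (\<lambda>x. grad (\<lambda>x. \<phi> n x + \<psi> n x) x - (g x + h x))
        \<le> 2 powr p * (Lp_energy p (\<lambda>x. grad (\<phi> n) x - g x) + Lp_energy p (\<lambda>x. grad (\<psi> n) x - h x))"
    proof (rule always_eventually, rule allI)
      fix n
      have "grad (\<lambda>x. \<phi> n x + \<psi> n x) x - (g x + h x) = (grad (\<phi> n) x - g x) + (grad (\<psi> n) x - h x)" for x
        using test_functions_smooth[OF \<phi>(2)] test_functions_smooth[OF \<psi>(2)] by (simp add: grad_add)
      then show "Lp_energy p (\<lambda>x. grad (\<lambda>x. \<phi> n x + \<psi> n x) x - (g x + h x))
        \<le> 2 powr p * (Lp_energy p (\<lambda>x. grad (\<phi> n) x - g x) + Lp_energy p (\<lambda>x. grad (\<psi> n) x - h x))"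
        using Lp_energy_add_le[OF assms(1) Lp_space_diff[OF assms(1) grad_test_function_Lp[OF \<phi>(2) assms(1)] \<phi>(1)]
            Lp_space_diff[OF assms(1) grad_test_function_Lp[OF \<psi>(2) assms(1)] \<psi>(1)], of n n] by presburger
    qed
    have "(\<lambda>n. 2 powr p * (Lp_energy p (\<lambda>x. grad (\<phi> n) x - g x) + Lp_energy p (\<lambda>x. grad (\<psi> n) x - h x))) \<longlonglongrightarrow> 2 powr p * (0 + 0)"
      by (intro tendsto_intros \<phi> \<psi>)
    then show "(\<lambda>n. 2 powr p * (Lp_energy p (\<lambda>x. grad (\<phi> n) x - g x) + Lp_energy p (\<lambda>x. grad (\<psi> n) x - h x))) \<longlonglongrightarrow> 0" by simp
  qed simp
  then show ?thesis
    unfolding sobolev_pair_def using \<phi> \<psi> assms(1)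
    by (intro conjI Lp_space_add exI[of _ "\<lambda>n x. \<phi> n x + \<psi> n x"] allI test_functions_add tendsto_intros) auto
qed

lemma sobolev_pair_diff:
  assumes "p > 0" "sobolev_pair p \<Omega> u g" "sobolev_pair p \<Omega> v h"
  shows "sobolev_pair p \<Omega> (\<lambda>x. u x - v x) (\<lambda>x. g x - h x)"
  using sobolev_pair_add[OF assms(1,2) sobolev_pair_cmult[OF assms(3), of "-1"]] by simp

lemma sobolev_pair_zero: "p > 0 \<Longrightarrow> sobolev_pair p \<Omega> (\<lambda>x. 0) (\<lambda>x. 0)"
  using sobolev_pair_test_function[OF test_functions_zero, of p \<Omega>] by (simp add: grad_zero[abs_def])

text \<open>Gradients of the approximating test functions vanish outside \<Omega>, so the energy of
  g there is at most that of the gradient error, which tends to 0.\<close>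

lemma sobolev_pair_gradient_outside:
  assumes "p > 0" "\<Omega> \<in> sets lebesgue" "sobolev_pair p \<Omega> u g"
  shows "AE x in lebesgue. x \<notin> \<Omega> \<longrightarrow> g x = 0"
proof -
  obtain \<phi> where \<phi>: "g \<in> Lp_space p" "\<And>n. \<phi> n \<in> test_functions \<Omega>"
    "(\<lambda>n. Lp_energy p (\<lambda>x. grad (\<phi> n) x - g x)) \<longlonglongrightarrow> 0"
    using sobolev_pairE[OF assms(3)] by metis
  define s where "s = (\<lambda>x. indicator (- \<Omega>) x *\<^sub>R (norm (g x) powr p))"
  have c: "- \<Omega> \<in> sets lebesgue" using assms(2) by (metis Compl_in_sets_lebesgue)
  have si: "integrable lebesgue s"
    unfolding s_def using Lp_spaceD(2)[OF \<phi>(1)] c by (intro integrable_mult_indicator)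
  have "integral\<^sup>L lebesgue s \<le> Lp_energy p (\<lambda>x. grad (\<phi> n) x - g x)" for n
    unfolding Lp_energy_def
    using Lp_spaceD(2)[OF Lp_space_diff[OF assms(1) grad_test_function_Lp[OF \<phi>(2) assms(1)] \<phi>(1)]]
      test_functions_outside(2)[OF \<phi>(2)]
    by (intro integral_mono si) (auto simp: s_def indicator_def)
  then have "integral\<^sup>L lebesgue s \<le> 0"
    using LIMSEQ_le_const[OF \<phi>(3)] by blast
  moreover have "integral\<^sup>L lebesgue s \<ge> 0" by (simp add: s_def)
  ultimately have "integral\<^sup>L lebesgue s = 0" by simp
  then have "AE x in lebesgue. s x = 0"
    using integral_nonneg_eq_0_iff_AE[OF si] by (auto simp: s_def)
  then show ?thesis by eventually_elim (auto simp: s_def)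
qed

section \<open>Hoelder and sup bounds for Sobolev functions\<close>

locale sobolev_domain =
  fixes D :: "'a::euclidean_space set" and p :: real
  assumes open_D: "open D" and finite_D: "emeasure lebesgue D < \<infinity>"
    and p_gt_dim: "p > real DIM('a)"
begin

lemma p_gt_1: "p > 1" and p_pos: "p > 0"
  using p_gt_dim DIM_positive[where 'a='a] by linarith+

definition holder_exponent :: real where "holder_exponent = 1 - real DIM('a) / p"

definition morrey_constant :: real where "morrey_constant = 2 * real DIM('a) / (1 - real DIM('a) / p)"

lemma holder_exponent_pos: "holder_exponent > 0"
  using p_gt_dim p_pos by (simp add: holder_exponent_def)

lemma morrey_constant_pos: "morrey_constant > 0"
  using holder_exponent_pos by (simp add: morrey_constant_def holder_exponent_def)

lemma test_function_holder:
  fixes \<Omega> :: "'a set"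
  assumes "\<phi> \<in> test_functions \<Omega>" "M > 0" "Lp_energy p (grad \<phi>) \<le> M"
  shows "\<bar>\<phi> x - \<phi> y\<bar> \<le> morrey_constant * norm (x - y) powr holder_exponent * M powr (1 / p)"
proof -
  obtain K where "smooth \<phi>" "compact K" "\<And>x. x \<notin> K \<Longrightarrow> \<phi> x = 0"
    using test_functions_obtain[OF assms(1)] by metis
  then show ?thesis
    unfolding morrey_constant_def holder_exponent_def
    using Morrey_inequality[of \<phi> K p M x y] p_gt_dim p_gt_1 assms by (simp add: Lp_energy_def)
qed

text \<open>The factor 2 powr p is the price for passing from test functions to their limits without
  Minkowski's inequality.\<close>

lemma sobolev_pair_holder:
  fixes \<Omega> :: "'a set"
  assumes "sobolev_pair p \<Omega> u g" "2 powr p * Lp_energy p g < M"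
  shows "\<bar>u x - u y\<bar> \<le> morrey_constant * norm (x - y) powr holder_exponent * M powr (1 / p)"
proof -
  obtain \<phi> where \<phi>: "g \<in> Lp_space p" "\<And>n. \<phi> n \<in> test_functions \<Omega>" "\<And>x. (\<lambda>n. \<phi> n x) \<longlonglongrightarrow> u x"
    "(\<lambda>n. Lp_energy p (\<lambda>x. grad (\<phi> n) x - g x)) \<longlonglongrightarrow> 0"
    using sobolev_pairE[OF assms(1)] by blast
  have "0 \<le> 2 powr p * Lp_energy p g" by (simp add: Lp_energy_nonneg)
  then have M: "M > 0" using assms(2) by linarith
  have "(\<lambda>n. 2 powr p * (Lp_energy p (\<lambda>x. grad (\<phi> n) x - g x) + Lp_energy p g)) \<longlonglongrightarrow> 2 powr p * (0 + Lp_energy p g)"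
    by (intro tendsto_intros \<phi>)
  then have "\<forall>\<^sub>F n in sequentially. 2 powr p * (Lp_energy p (\<lambda>x. grad (\<phi> n) x - g x) + Lp_energy p g) < M"
    using assms(2) by (intro order_tendstoD) auto
  then have ev: "\<forall>\<^sub>F n in sequentially. \<bar>\<phi> n x - \<phi> n y\<bar> \<le> morrey_constant * norm (x - y) powr holder_exponent * M powr (1 / p)"
  proof eventually_elim
    case (elim n)
    then have "Lp_energy p (grad (\<phi> n)) \<le> M"
      using Lp_energy_add_le[OF p_pos Lp_space_diff[OF p_pos grad_test_function_Lp[OF \<phi>(2) p_pos] \<phi>(1)] \<phi>(1), of n] by simp
    then show ?case using test_function_holder[OF \<phi>(2) M] by blast
  qed
  have "(\<lambda>n. \<bar>\<phi> n x - \<phi> n y\<bar>) \<longlonglongrightarrow> \<bar>u x - u y\<bar>" by (intro tendsto_intros \<phi>)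
  then show ?thesis using ev by (rule tendsto_upperbound) simp
qed

definition complement_radius :: real where
  "complement_radius = (SOME R. R > 0 \<and> (\<forall>x. \<exists>y. y \<notin> D \<and> norm (x - y) \<le> R))"

lemma complement_radius:
  "complement_radius > 0" "\<exists>y. y \<notin> D \<and> norm (x - y) \<le> complement_radius"
proof -
  obtain R where "R > 0" "\<And>x. \<exists>y. y \<notin> D \<and> norm (x - y) \<le> R"
    using ex_radius_meets_complement[of D] open_D finite_D by (auto simp: borel_open)
  then have "\<exists>R. R > 0 \<and> (\<forall>x. \<exists>y. y \<notin> D \<and> norm (x - y) \<le> R)" by blast
  from someI_ex[OF this] show "complement_radius > 0" "\<exists>y. y \<notin> D \<and> norm (x - y) \<le> complement_radius"
    unfolding complement_radius_def by blast+
qed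

definition sup_constant :: real where
  "sup_constant = morrey_constant * complement_radius powr holder_exponent"

lemma sup_constant_pos: "sup_constant > 0"
  using morrey_constant_pos complement_radius by (simp add: sup_constant_def)

text \<open>The value at x is compared with the value 0 at a point outside D within the fixed
  radius, which turns the Hoelder bound into a sup bound.\<close>

lemma sobolev_pair_bounded:
  assumes "sobolev_pair p D u g" "2 powr p * Lp_energy p g < M"
  shows "\<bar>u x\<bar> \<le> sup_constant * M powr (1 / p)"
proof -
  obtain y where y: "y \<notin> D" "norm (x - y) \<le> complement_radius" using complement_radius(2) by blast
  have "\<bar>u x\<bar> \<le> morrey_constant * norm (x - y) powr holder_exponent * M powr (1 / p)"
    using sobolev_pair_holder[OF assms, of x y] sobolev_pair_outside[OF assms(1) y(1)] by simp
  also have "\<dots> \<le> morrey_constant * complement_radius powr holder_exponent * M powr (1 / p)"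
    using y morrey_constant_pos holder_exponent_pos
    by (intro mult_right_mono mult_left_mono powr_mono2) auto
  finally show ?thesis by (simp add: sup_constant_def)
qed

lemma holder_modulus:
  assumes "e > 0" "M \<ge> 0"
  obtains \<delta> where "\<delta> > 0" "\<And>x y :: 'a. norm (x - y) < \<delta> \<Longrightarrow> morrey_constant * norm (x - y) powr holder_exponent * M powr (1 / p) < e"
proof -
  \<comment> \<open>The added 1 keeps c positive when M = 0.\<close>
  define c where "c = morrey_constant * M powr (1 / p) + 1"
  have c: "c > 0" using morrey_constant_pos by (simp add: c_def add_nonneg_pos)
  show ?thesis
  proof (rule that)
    show "(e / c) powr (1 / holder_exponent) > 0" using assms c by simp
    fix x y :: 'a assume "norm (x - y) < (e / c) powr (1 / holder_exponent)"
    then have "norm (x - y) powr holder_exponent < ((e / c) powr (1 / holder_exponent)) powr holder_exponent"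
      using holder_exponent_pos by (intro powr_less_mono2) auto
    also have "\<dots> = e / c" using holder_exponent_pos assms c by (simp add: powr_powr)
    finally have "norm (x - y) powr holder_exponent * c < e" using c by (simp add: pos_less_divide_eq)
    moreover have "norm (x - y) powr holder_exponent * (morrey_constant * M powr (1 / p)) \<le> norm (x - y) powr holder_exponent * c"
      by (intro mult_left_mono) (auto simp: c_def)
    ultimately show "morrey_constant * norm (x - y) powr holder_exponent * M powr (1 / p) < e"
      by (simp add: mult_ac)
  qed
qed

lemma sobolev_pair_continuous:
  fixes \<Omega> :: "'a set"
  assumes "sobolev_pair p \<Omega> u g" shows "continuous_on UNIV u"
  unfolding continuous_on_iff
proof (intro ballI allI impI)
  fix x :: 'a and e :: real assume e: "e > 0"
  define M where "M = 2 powr p * Lp_energy p g + 1"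
  have M: "M \<ge> 0" "2 powr p * Lp_energy p g < M" by (simp_all add: M_def Lp_energy_nonneg add_nonneg_nonneg)
  obtain \<delta> where \<delta>: "\<delta> > 0" "\<And>x y :: 'a. norm (x - y) < \<delta> \<Longrightarrow> morrey_constant * norm (x - y) powr holder_exponent * M powr (1 / p) < e"
    using holder_modulus[OF e M(1)] by blast
  show "\<exists>d>0. \<forall>x'\<in>UNIV. dist x' x < d \<longrightarrow> dist (u x') (u x) < e"
    using \<delta>(1) le_less_trans[OF sobolev_pair_holder[OF assms M(2)] \<delta>(2)]
    by (intro exI[of _ \<delta>]) (auto simp: dist_norm)
qed

lemma sobolev_pair_measurable:
  fixes \<Omega> :: "'a set"
  assumes "sobolev_pair p \<Omega> u g" shows "u \<in> borel_measurable lebesgue"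
  using sobolev_pair_continuous[OF assms] by (simp add: borel_measurable_continuous_onI measurable_completion)

lemma sobolev_pair_tendsto_0:
  assumes "\<And>n. sobolev_pair p D (u n) (g n)" "(\<lambda>n. Lp_energy p (g n)) \<longlonglongrightarrow> 0" "e > 0"
  shows "\<forall>\<^sub>F n in sequentially. \<forall>x. \<bar>u n x\<bar> < e"
proof -
  \<comment> \<open>Chosen so that the sup bound equals e / 2.\<close>
  define M where "M = (e / (2 * sup_constant)) powr p"
  have M: "M > 0" using assms(3) sup_constant_pos by (simp add: M_def)
  have MS: "sup_constant * M powr (1 / p) = e / 2"
    using assms(3) sup_constant_pos p_pos by (simp add: M_def powr_powr)
  have "(\<lambda>n. 2 powr p * Lp_energy p (g n)) \<longlonglongrightarrow> 2 powr p * 0" by (intro tendsto_intros assms)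
  then have "\<forall>\<^sub>F n in sequentially. 2 powr p * Lp_energy p (g n) < M"
    using M by (intro order_tendstoD) auto
  then show ?thesis
  proof eventually_elim
    case (elim n)
    have "\<bar>u n x\<bar> \<le> e / 2" for x using sobolev_pair_bounded[OF assms(1) elim] MS by simp
    moreover have "e / 2 < e" using assms(3) by simp
    ultimately show ?case by (meson le_less_trans)
  qed
qed

text \<open>The gradients converge by completeness of L^p and the values pointwise by the sup bound
  for differences. To exhibit the limit as a pair over \<Omega>, test functions close to the n-th
  gradient are picked; the sup bound gives them the same pointwise limit.\<close>

lemma sobolev_pair_complete:
  assumes \<Omega>: "\<Omega> \<subseteq> D" and ug: "\<And>n. sobolev_pair p \<Omega> (u n) (g n)"
    and Cauchy: "\<And>e. e > 0 \<Longrightarrow> \<exists>N. \<forall>m\<ge>N. \<forall>n\<ge>N. Lp_energy p (\<lambda>x. g m x - g n x) < e"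
  obtains v h where "sobolev_pair p \<Omega> v h" "(\<lambda>n. Lp_energy p (\<lambda>x. g n x - h x)) \<longlonglongrightarrow> 0" "\<And>x. (\<lambda>n. u n x) \<longlonglongrightarrow> v x"
proof -
  have gL: "g n \<in> Lp_space p" for n using ug sobolev_pair_Lp by blast
  obtain h where h: "h \<in> Lp_space p" "(\<lambda>n. Lp_energy p (\<lambda>x. g n x - h x)) \<longlonglongrightarrow> 0"
    using Lp_complete[OF p_pos gL Cauchy] by blast
  have "Cauchy (\<lambda>n. u n x)" for x
  proof (rule metric_CauchyI)
    fix e :: real assume e: "e > 0"
    define M where "M = (e / (2 * sup_constant)) powr p"
    have M: "M > 0" using e sup_constant_pos by (simp add: M_def)
    have MS: "sup_constant * M powr (1 / p) = e / 2"
      using e sup_constant_pos p_pos by (simp add: M_def powr_powr)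
    obtain N where N: "\<And>m n. m \<ge> N \<Longrightarrow> n \<ge> N \<Longrightarrow> Lp_energy p (\<lambda>x. g m x - g n x) < M / 2 powr p"
      using Cauchy[of "M / 2 powr p"] M by auto
    have "dist (u m x) (u n x) < e" if "m \<ge> N" "n \<ge> N" for m n
    proof -
      have "\<bar>u m x - u n x\<bar> \<le> sup_constant * M powr (1 / p)"
        using N[OF that] sobolev_pair_mono[OF \<Omega> sobolev_pair_diff[OF p_pos ug ug]]
        by (intro sobolev_pair_bounded) (auto simp: pos_less_divide_eq mult.commute)
      then show ?thesis unfolding MS using e by (simp add: dist_real_def)
    qed
    then show "\<exists>N. \<forall>m\<ge>N. \<forall>n\<ge>N. dist (u m x) (u n x) < e" by blast
  qed
  then obtain v where v: "\<And>x. (\<lambda>n. u n x) \<longlonglongrightarrow> v x"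
    unfolding Cauchy_convergent_iff convergent_def by metis
  have "\<exists>\<phi>. \<phi> \<in> test_functions \<Omega> \<and> Lp_energy p (\<lambda>x. grad \<phi> x - g n x) < inverse (real (Suc n))" for n
  proof -
    obtain \<phi> where \<phi>: "\<And>k. \<phi> k \<in> test_functions \<Omega>" "(\<lambda>k. Lp_energy p (\<lambda>x. grad (\<phi> k) x - g n x)) \<longlonglongrightarrow> 0"
      using sobolev_pairE[OF ug[of n]] by metis
    have "\<forall>\<^sub>F k in sequentially. Lp_energy p (\<lambda>x. grad (\<phi> k) x - g n x) < inverse (real (Suc n))"
      using \<phi>(2) by (rule order_tendstoD) simp
    then show ?thesis using \<phi>(1) eventually_happens'[OF sequentially_bot] by blast
  qed
  then obtain \<phi> where \<phi>: "\<And>n. \<phi> n \<in> test_functions \<Omega>" "\<And>n. Lp_energy p (\<lambda>x. grad (\<phi> n) x - g n x) < inverse (real (Suc n))"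
    by metis
  have \<phi>g: "(\<lambda>n. Lp_energy p (\<lambda>x. grad (\<phi> n) x - g n x)) \<longlonglongrightarrow> 0"
    using \<phi>(2) by (intro real_tendsto_sandwich[OF _ _ tendsto_const LIMSEQ_inverse_real_of_nat] always_eventually)
      (auto simp: Lp_energy_nonneg intro: less_imp_le)
  have pd: "sobolev_pair p D (\<lambda>x. \<phi> n x - u n x) (\<lambda>x. grad (\<phi> n) x - g n x)" for n
    by (rule sobolev_pair_mono[OF \<Omega> sobolev_pair_diff[OF p_pos sobolev_pair_test_function[OF \<phi>(1) p_pos] ug]])
  have "(\<lambda>n. \<phi> n x - u n x) \<longlonglongrightarrow> 0" for x
  proof (rule LIMSEQ_I)
    fix e :: real assume "e > 0"
    from sobolev_pair_tendsto_0[OF pd \<phi>g this]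
    show "\<exists>no. \<forall>n\<ge>no. norm (\<phi> n x - u n x - 0) < e" unfolding eventually_sequentially by auto
  qed
  then have "(\<lambda>n. (\<phi> n x - u n x) + u n x) \<longlonglongrightarrow> 0 + v x" for x by (intro tendsto_add v)
  then have \<phi>v: "(\<lambda>n. \<phi> n x) \<longlonglongrightarrow> v x" for x by simp
  have "(\<lambda>n. Lp_energy p (\<lambda>x. grad (\<phi> n) x - h x)) \<longlonglongrightarrow> 0"
  proof (rule real_tendsto_sandwich[OF _ _ tendsto_const])
    show "\<forall>\<^sub>F n in sequentially. Lp_energy p (\<lambda>x. grad (\<phi> n) x - h x)
        \<le> 2 powr p * (Lp_energy p (\<lambda>x. grad (\<phi> n) x - g n x) + Lp_energy p (\<lambda>x. g n x - h x))"
      using Lp_energy_triangle[OF p_pos grad_test_function_Lp[OF \<phi>(1) p_pos] gL h(1)] by simp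
    have "(\<lambda>n. 2 powr p * (Lp_energy p (\<lambda>x. grad (\<phi> n) x - g n x) + Lp_energy p (\<lambda>x. g n x - h x))) \<longlonglongrightarrow> 2 powr p * (0 + 0)"
      by (intro tendsto_intros \<phi>g h)
    then show "(\<lambda>n. 2 powr p * (Lp_energy p (\<lambda>x. grad (\<phi> n) x - g n x) + Lp_energy p (\<lambda>x. g n x - h x))) \<longlonglongrightarrow> 0" by simp
  qed (simp add: Lp_energy_nonneg)
  then have "sobolev_pair p \<Omega> v h"
    unfolding sobolev_pair_def using h(1) \<phi>(1) \<phi>v by blast
  then show ?thesis using that h(2) v by blast
qed

end

section \<open>Comparison with the Sobolev space\<close>

lemma borel_measurable_lebesgue_on_AE:
  fixes f g :: "'a::euclidean_space \<Rightarrow> 'b::euclidean_space"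
  assumes S: "S \<in> sets lebesgue" and f: "f \<in> borel_measurable (lebesgue_on S)" and eq: "AE x in lebesgue_on S. f x = g x"
  shows "g \<in> borel_measurable (lebesgue_on S)"
proof -
  have "(\<lambda>x. if x \<in> S then f x else 0) \<in> borel_measurable lebesgue"
    using f S by (simp add: borel_measurable_if)
  moreover have "AE x in lebesgue. x \<in> S \<longrightarrow> f x = g x"
    using eq S by (simp add: AE_restrict_space_iff)
  then have "AE x in lebesgue. (if x \<in> S then f x else 0) = (if x \<in> S then g x else 0)"
    by eventually_elim auto
  ultimately have "(\<lambda>x. if x \<in> S then g x else 0) \<in> borel_measurable lebesgue"
    by (rule borel_measurable_AE)
  then show ?thesis using S by (simp add: borel_measurable_if)
qed

lemma integral_lebesgue_on_cong_AE:
  fixes f g :: "'a::euclidean_space \<Rightarrow> 'b::euclidean_space"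
  assumes S: "S \<in> sets lebesgue" and f: "f \<in> borel_measurable (lebesgue_on S)" and eq: "AE x in lebesgue_on S. f x = g x"
  shows "integral\<^sup>L (lebesgue_on S) f = integral\<^sup>L (lebesgue_on S) g"
    "integrable (lebesgue_on S) f = integrable (lebesgue_on S) g"
  using integral_cong_AE[OF f borel_measurable_lebesgue_on_AE[OF assms] eq]
    integrable_cong_AE[OF f borel_measurable_lebesgue_on_AE[OF assms] eq] .

lemma integral_lebesgue_on_eq:
  fixes f :: "'a::euclidean_space \<Rightarrow> real"
  assumes S: "S \<in> sets lebesgue" and f: "f \<in> borel_measurable lebesgue" and 0: "AE x in lebesgue. x \<notin> S \<longrightarrow> f x = 0"
  shows "integral\<^sup>L (lebesgue_on S) f = integral\<^sup>L lebesgue f"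
proof -
  have "integral\<^sup>L (lebesgue_on S) f = integral\<^sup>L lebesgue (\<lambda>x. if x \<in> S then f x else 0)"
    using S by (simp add: Lebesgue_Measure.integral_restrict_UNIV)
  also have "\<dots> = integral\<^sup>L lebesgue f"
  proof (rule integral_cong_AE)
    show "AE x in lebesgue. (if x \<in> S then f x else 0) = f x" using 0 by eventually_elim auto
    show "(\<lambda>x. if x \<in> S then f x else 0) \<in> borel_measurable lebesgue"
      using f S by (simp add: borel_measurable_if measurable_restrict_space1)
  qed (rule f)
  finally show ?thesis .
qed

lemma Lp_zero_outside_iff:
  assumes S: "S \<in> sets lebesgue" and f: "\<And>x. x \<notin> S \<Longrightarrow> f x = 0"
  shows "f \<in> Lp p S \<longleftrightarrow> f \<in> Lp_space p" "Lp_norm p S f = Lp_energy p f powr (1 / p)"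
proof -
  have "(\<lambda>x. if x \<in> S then f x else 0) = f" using f by auto
  then have "f \<in> borel_measurable (lebesgue_on S) \<longleftrightarrow> f \<in> borel_measurable lebesgue"
    using borel_measurable_if[OF S, of f] by simp
  then show "f \<in> Lp p S \<longleftrightarrow> f \<in> Lp_space p"
    using lebesgue_on_zero_outside(2)[OF S, of "\<lambda>x. norm (f x) powr p"] f by (simp add: Lp_def Lp_space_def)
  show "Lp_norm p S f = Lp_energy p f powr (1 / p)"
    using lebesgue_on_zero_outside(1)[OF S, of "\<lambda>x. norm (f x) powr p"] f by (simp add: Lp_norm_def Lp_energy_def)
qed

lemma Lp_space_imp_Lp:
  assumes S: "S \<in> sets lebesgue" and f: "f \<in> Lp_space p" and p: "p > 0"
  shows "f \<in> Lp p S" "Lp_norm p S f \<le> Lp_energy p f powr (1 / p)"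
proof -
  have i: "integrable lebesgue (\<lambda>x. indicat_real S x *\<^sub>R norm (f x) powr p)"
    using Lp_spaceD[OF f] S by (intro integrable_mult_indicator)
  then show "f \<in> Lp p S"
    using Lp_spaceD[OF f] S by (simp add: Lp_def integrable_restrict_space measurable_restrict_space1)
  have "(LINT x|lebesgue_on S. norm (f x) powr p) = (LINT x|lebesgue. indicat_real S x *\<^sub>R norm (f x) powr p)"
    using S by (subst integral_restrict_space) auto
  also have "\<dots> \<le> Lp_energy p f"
    unfolding Lp_energy_def using i Lp_spaceD[OF f] by (intro integral_mono) (auto simp: indicator_def)
  finally show "Lp_norm p S f \<le> Lp_energy p f powr (1 / p)"
    unfolding Lp_norm_def using p by (intro powr_mono2) auto
qed

lemma Lp_energy_eq_0D:
  assumes "f \<in> Lp_space p" "Lp_energy p f = 0" shows "AE x in lebesgue. f x = 0"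
proof -
  have "AE x in lebesgue. norm (f x) powr p = 0"
    using assms integral_nonneg_eq_0_iff_AE[OF Lp_spaceD(2)[OF assms(1)]] by (simp add: Lp_energy_def)
  then show ?thesis by eventually_elim simp
qed

lemma Lp_energy_cong_AE:
  assumes "f \<in> borel_measurable lebesgue" "AE x in lebesgue. f x = g x"
  shows "Lp_energy p f = Lp_energy p g"
proof -
  note [measurable] = assms(1) borel_measurable_AE[OF assms]
  have "AE x in lebesgue. norm (f x) powr p = norm (g x) powr p" using assms(2) by eventually_elim simp
  then show ?thesis unfolding Lp_energy_def by (intro integral_cong_AE) auto
qed

lemma Lp_space_locally_integrable:
  assumes g: "g \<in> Lp_space p" and p: "p \<ge> 1" shows "g locally_integrable_on \<Omega>"
  unfolding locally_integrable_on_def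
proof (intro allI impI)
  fix K :: "'a set" assume "compact K \<and> K \<subseteq> \<Omega>"
  then have K: "K \<in> lmeasurable" by (simp add: lmeasurable_compact)
  then have Ks: "K \<in> sets lebesgue" by (simp add: fmeasurableD)
  show "integrable (lebesgue_on K) g"
  proof (rule Bochner_Integration.integrable_bound)
    have "integrable (lebesgue_on K) (\<lambda>x. norm (g x) powr p)" using Lp_space_imp_Lp(1)[OF Ks g] p by (simp add: Lp_def)
    moreover have "integrable (lebesgue_on K) (\<lambda>x. 1::real)" using K integrable_on_const lmeasurable_iff_integrable_on
      by (simp add: Ks integrable_restrict_space fmeasurable_def integrable_indicator_iff)
    ultimately show "integrable (lebesgue_on K) (\<lambda>x. 1 + norm (g x) powr p)" by simp
    show "g \<in> borel_measurable (lebesgue_on K)" using Lp_spaceD(1)[OF g] by (rule measurable_restrict_space1)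
    have "r \<le> 1 + r powr p" if "r \<ge> 0" for r :: real
    proof (cases "r \<le> 1")
      case False
      then have "r powr 1 \<le> r powr p" using p by (intro powr_mono) auto
      then show ?thesis using False by simp
    qed (simp add: add_increasing2)
    then show "AE x in lebesgue_on K. norm (g x) \<le> norm (1 + norm (g x) powr p)" by (intro AE_I2) simp
  qed
qed

lemma continuous_locally_integrable:
  fixes u :: "'a::euclidean_space \<Rightarrow> real"
  assumes "continuous_on UNIV u" shows "u locally_integrable_on \<Omega>"
  unfolding locally_integrable_on_def
proof (intro allI impI)
  fix K :: "'a set" assume K: "compact K \<and> K \<subseteq> \<Omega>"
  then have "integrable lborel (\<lambda>x. indicat_real K x *\<^sub>R u x)"
    using assms by (intro borel_integrable_compact) (auto intro: continuous_on_subset)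
  then have "integrable lebesgue (\<lambda>x. indicat_real K x *\<^sub>R u x)"
    using integrable_completion borel_measurable_integrable by blast
  then show "integrable (lebesgue_on K) u" using K by (simp add: integrable_restrict_space fmeasurableD lmeasurable_compact)
qed

lemma locally_integrable_on_cong_AE:
  fixes u v :: "'a::euclidean_space \<Rightarrow> real"
  assumes "u locally_integrable_on \<Omega>" "AE x in lebesgue. u x = v x" shows "v locally_integrable_on \<Omega>"
  unfolding locally_integrable_on_def
proof (intro allI impI)
  fix K :: "'a set" assume K: "compact K \<and> K \<subseteq> \<Omega>"
  then have Ks: "K \<in> sets lebesgue" by (simp add: fmeasurableD lmeasurable_compact)
  have "AE x in lebesgue_on K. u x = v x"
    using assms(2) Ks by (simp add: AE_restrict_space_iff) (auto elim: eventually_mono)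
  then show "integrable (lebesgue_on K) v"
    using assms(1) K integral_lebesgue_on_cong_AE(2)[OF Ks, of u v] by (auto simp: locally_integrable_on_def)
qed

text \<open>The duality map is inverted pointwise: k has modulus |\<psi>|^(1/(p-1)) and the sign of
  \<psi>. Testing a gradient against \<psi> thereby becomes a dual pairing, whose convergence is
  under control.\<close>

lemma test_function_eq_dual_vector:
  assumes p: "p > 1" and \<psi>: "\<psi> \<in> test_functions \<Omega>" and i: "i \<in> Basis"
  obtains k where "k \<in> Lp_space p" "\<And>x. dual_vector p (k x) = \<psi> x *\<^sub>R i"
proof -
  obtain K where K: "smooth \<psi>" "compact K" "\<And>x. x \<notin> K \<Longrightarrow> \<psi> x = 0" using test_functions_obtain[OF \<psi>] by metis
  have c: "continuous_on UNIV \<psi>" using K(1) by (rule smooth_continuous)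
  have m: "\<psi> \<in> borel_measurable lebesgue" using c by (simp add: borel_measurable_continuous_onI measurable_completion)
  define k where "k = (\<lambda>x. (sgn (\<psi> x) * \<bar>\<psi> x\<bar> powr (1 / (p - 1))) *\<^sub>R i)"
  have nk: "norm (k x) = \<bar>\<psi> x\<bar> powr (1 / (p - 1))" for x
    using i by (cases "\<psi> x = 0") (auto simp: k_def abs_mult)
  have "integrable lebesgue (\<lambda>x. \<bar>\<psi> x\<bar> powr (p / (p - 1)))"
    using p K by (intro integrable_compact_support(2)[of _ K] continuous_on_powr' continuous_intros c) auto
  then have "k \<in> Lp_space p"
    using m unfolding Lp_space_def by (auto simp: nk powr_powr) (simp add: k_def)
  moreover have "dual_vector p (k x) = \<psi> x *\<^sub>R i" for x
  proof (cases "\<psi> x = 0")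
    case False
    have "(\<bar>\<psi> x\<bar> powr (1 / (p - 1))) powr (p - 2) * \<bar>\<psi> x\<bar> powr (1 / (p - 1)) = \<bar>\<psi> x\<bar> powr (((p - 2) + 1) / (p - 1))"
      by (simp add: powr_powr powr_add[symmetric] add_divide_distrib[symmetric])
    also have "\<dots> = \<bar>\<psi> x\<bar>" using p False by simp
    finally show ?thesis by (simp add: dual_vector_def nk) (simp add: k_def mult.left_commute sgn_mult_abs)
  qed (simp add: k_def dual_vector_def)
  ultimately show ?thesis using that by blast
qed

context sobolev_domain
begin

lemma D_sets: "D \<in> sets lebesgue" using open_D by (simp add: borel_open)

text \<open>The formula for the approximating test functions passes to the limit: on the left by
  their uniform convergence, on the right by the dual pairing with k.\<close>

lemma sobolev_pair_integration_by_parts: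
  assumes u: "sobolev_pair p D u g" and \<psi>: "\<psi> \<in> test_functions \<Omega>" and i: "i \<in> Basis"
  shows "(LINT x|lebesgue. u x * frechet_derivative \<psi> (at x) i) = - (LINT x|lebesgue. (g x \<bullet> i) * \<psi> x)"
proof -
  obtain \<phi> where \<phi>: "g \<in> Lp_space p" "\<And>n. \<phi> n \<in> test_functions D" "\<And>x. (\<lambda>n. \<phi> n x) \<longlonglongrightarrow> u x"
    "(\<lambda>n. Lp_energy p (\<lambda>x. grad (\<phi> n) x - g x)) \<longlonglongrightarrow> 0"
    using sobolev_pairE[OF u] by blast
  obtain K where K: "smooth \<psi>" "compact K" "\<And>x. x \<notin> K \<Longrightarrow> \<psi> x = 0" "\<And>x. x \<notin> K \<Longrightarrow> grad \<psi> x = 0"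
    using test_functions_obtain[OF \<psi>] by metis
  let ?d = "\<lambda>x. frechet_derivative \<psi> (at x) i"
  have d0: "x \<notin> K \<Longrightarrow> ?d x = 0" for x using K(4) i by (simp add: grad_inner[symmetric])
  have dc: "continuous_on UNIV ?d" using smooth_continuous[OF smooth_partial[OF K(1) i]] .
  have uc: "continuous_on UNIV u" by (rule sobolev_pair_continuous[OF u])
  have \<phi>c: "continuous_on UNIV (\<phi> n)" for n by (rule smooth_continuous[OF test_functions_smooth[OF \<phi>(2)]])
  have iu: "integrable lebesgue (\<lambda>x. u x * ?d x)"
    using K d0 by (intro integrable_compact_support(2)[of _ K] continuous_intros uc dc) auto
  have i\<phi>: "integrable lebesgue (\<lambda>x. \<phi> n x * ?d x)" for n
    using K d0 by (intro integrable_compact_support(2)[of _ K] continuous_intros \<phi>c dc) auto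
  have id: "integrable lebesgue (\<lambda>x. \<bar>?d x\<bar>)"
    using K d0 by (intro integrable_compact_support(2)[of _ K] continuous_intros dc) auto
  have pd: "sobolev_pair p D (\<lambda>x. \<phi> n x - u x) (\<lambda>x. grad (\<phi> n) x - g x)" for n
    by (rule sobolev_pair_diff[OF p_pos sobolev_pair_test_function[OF \<phi>(2) p_pos] u])
  have 1: "(\<lambda>n. LINT x|lebesgue. \<phi> n x * ?d x) \<longlonglongrightarrow> (LINT x|lebesgue. u x * ?d x)"
  proof (rule LIMSEQ_I)
    fix e :: real assume e: "e > 0"
    define c where "c = (LINT x|lebesgue. \<bar>?d x\<bar>) + 1"
    have c: "c > 0" by (simp add: c_def add_nonneg_pos)
    have "e / c > 0" using e c by simp
    from sobolev_pair_tendsto_0[OF pd \<phi>(4) this]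
    obtain N where N: "\<And>n x. n \<ge> N \<Longrightarrow> \<bar>\<phi> n x - u x\<bar> < e / c" unfolding eventually_sequentially by blast
    have "norm ((LINT x|lebesgue. \<phi> n x * ?d x) - (LINT x|lebesgue. u x * ?d x)) < e" if n: "n \<ge> N" for n
    proof -
      have "norm ((LINT x|lebesgue. \<phi> n x * ?d x) - (LINT x|lebesgue. u x * ?d x)) = norm (LINT x|lebesgue. (\<phi> n x - u x) * ?d x)"
        using iu i\<phi> by (simp add: left_diff_distrib)
      also have "\<dots> \<le> (LINT x|lebesgue. norm ((\<phi> n x - u x) * ?d x))"
        by (rule integral_norm_bound)
      also have "\<dots> \<le> (LINT x|lebesgue. (e / c) * \<bar>?d x\<bar>)"
      proof (rule integral_mono)
        have "integrable lebesgue (\<lambda>x. (\<phi> n x - u x) * ?d x)"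
          using K d0 by (intro integrable_compact_support(2)[of _ K] continuous_intros \<phi>c uc dc) auto
        then show "integrable lebesgue (\<lambda>x. norm ((\<phi> n x - u x) * ?d x))" by (rule integrable_norm)
        show "integrable lebesgue (\<lambda>x. (e / c) * \<bar>?d x\<bar>)" using id by (rule integrable_mult_right)
        fix x
        show "norm ((\<phi> n x - u x) * ?d x) \<le> (e / c) * \<bar>?d x\<bar>"
          unfolding real_norm_def abs_mult using N[OF n, of x] by (intro mult_right_mono) auto
      qed
      also have "\<dots> = e * ((LINT x|lebesgue. \<bar>?d x\<bar>) / c)" by simp
      also have "\<dots> < e * 1" using e c by (intro mult_strict_left_mono) (auto simp: c_def)
      finally show ?thesis by simp
    qed
    then show "\<exists>no. \<forall>n\<ge>no. norm ((LINT x|lebesgue. \<phi> n x * ?d x) - (LINT x|lebesgue. u x * ?d x)) < e" by blast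
  qed
  obtain k where k: "k \<in> Lp_space p" "\<And>x. dual_vector p (k x) = \<psi> x *\<^sub>R i"
    using test_function_eq_dual_vector[OF p_gt_1 \<psi> i] by blast
  have kg: "dual_vector p (k x) \<bullet> h = (h \<bullet> i) * \<psi> x" for x h by (simp add: k inner_commute)
  have gL: "grad (\<phi> n) \<in> Lp_space p" for n by (rule grad_test_function_Lp[OF \<phi>(2) p_pos])
  have "(\<lambda>n. LINT x|lebesgue. dual_vector p (k x) \<bullet> (grad (\<phi> n) x - g x)) \<longlonglongrightarrow> 0"
    by (rule dual_pairing_tendsto_0[OF p_gt_1 k(1) order_refl Lp_space_diff[OF p_pos gL \<phi>(1)] \<phi>(4)])
  moreover have "(LINT x|lebesgue. dual_vector p (k x) \<bullet> (grad (\<phi> n) x - g x))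
      = (LINT x|lebesgue. (grad (\<phi> n) x \<bullet> i) * \<psi> x) - (LINT x|lebesgue. (g x \<bullet> i) * \<psi> x)" for n
    using integrable_dual_pairing[OF p_gt_1 k(1) gL, of n] integrable_dual_pairing[OF p_gt_1 k(1) \<phi>(1)]
    by (simp add: kg inner_diff_left left_diff_distrib)
  ultimately have "(\<lambda>n. (LINT x|lebesgue. (grad (\<phi> n) x \<bullet> i) * \<psi> x) - (LINT x|lebesgue. (g x \<bullet> i) * \<psi> x)) \<longlonglongrightarrow> 0" by simp
  then have "(\<lambda>n. LINT x|lebesgue. (grad (\<phi> n) x \<bullet> i) * \<psi> x) \<longlonglongrightarrow> (LINT x|lebesgue. (g x \<bullet> i) * \<psi> x)"
    by (rule LIM_zero_cancel)
  then have "(\<lambda>n. - (LINT x|lebesgue. (grad (\<phi> n) x \<bullet> i) * \<psi> x)) \<longlonglongrightarrow> - (LINT x|lebesgue. (g x \<bullet> i) * \<psi> x)"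
    by (rule tendsto_minus)
  then show ?thesis
    using 1 unfolding integration_by_parts[OF test_functions_smooth[OF \<phi>(2)] \<psi> i] by (rule LIMSEQ_unique[rotated])
qed

text \<open>Members of \<open>W1p_0\<close> are determined only up to null sets, whereas u is the
  continuous representative; hence the separate v.\<close>

lemma sobolev_pair_has_weak_gradient:
  assumes \<Omega>: "open \<Omega>" "\<Omega> \<subseteq> D" and u: "sobolev_pair p \<Omega> u g" and v: "AE x in lebesgue. u x = v x"
  shows "has_weak_gradient \<Omega> v g"
  unfolding has_weak_gradient_def
proof (intro conjI ballI)
  have \<Omega>s: "\<Omega> \<in> sets lebesgue" using \<Omega> by (simp add: borel_open)
  have uD: "sobolev_pair p D u g" by (rule sobolev_pair_mono[OF \<Omega>(2) u])
  have uc: "continuous_on UNIV u" by (rule sobolev_pair_continuous[OF u])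
  show "v locally_integrable_on \<Omega>"
    by (rule locally_integrable_on_cong_AE[OF continuous_locally_integrable[OF uc] v])
  show "g locally_integrable_on \<Omega>"
    using p_gt_1 by (intro Lp_space_locally_integrable[OF sobolev_pair_Lp[OF u]]) simp
  fix \<psi> :: "'a \<Rightarrow> real" and i :: 'a assume \<psi>: "\<psi> \<in> test_functions \<Omega>" and i: "i \<in> Basis"
  have d0: "x \<notin> \<Omega> \<Longrightarrow> frechet_derivative \<psi> (at x) i = 0" for x
    using test_functions_outside(2)[OF \<psi>] i by (simp add: grad_inner[symmetric])
  have dc: "continuous_on UNIV (\<lambda>x. u x * frechet_derivative \<psi> (at x) i)"
    using test_functions_smooth[OF \<psi>] i by (intro continuous_intros uc smooth_continuous smooth_partial)
  have "(LINT x|lebesgue_on \<Omega>. v x * frechet_derivative \<psi> (at x) i) = (LINT x|lebesgue. v x * frechet_derivative \<psi> (at x) i)"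
    using d0 by (intro lebesgue_on_zero_outside[OF \<Omega>s]) simp
  also have "\<dots> = (LINT x|lebesgue. u x * frechet_derivative \<psi> (at x) i)"
  proof (rule integral_cong_AE[symmetric])
    show m: "(\<lambda>x. u x * frechet_derivative \<psi> (at x) i) \<in> borel_measurable lebesgue"
      using dc by (simp add: borel_measurable_continuous_onI measurable_completion)
    show ae: "AE x in lebesgue. u x * frechet_derivative \<psi> (at x) i = v x * frechet_derivative \<psi> (at x) i"
      using v by eventually_elim simp
    show "(\<lambda>x. v x * frechet_derivative \<psi> (at x) i) \<in> borel_measurable lebesgue"
      by (rule borel_measurable_AE[OF m ae])
  qed
  also have "\<dots> = - (LINT x|lebesgue. (g x \<bullet> i) * \<psi> x)"
    by (rule sobolev_pair_integration_by_parts[OF uD \<psi> i])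
  also have "(LINT x|lebesgue. (g x \<bullet> i) * \<psi> x) = (LINT x|lebesgue_on \<Omega>. (g x \<bullet> i) * \<psi> x)"
    using test_functions_outside(1)[OF \<psi>] by (intro lebesgue_on_zero_outside(1)[OF \<Omega>s, symmetric]) simp
  finally show "(LINT x|lebesgue_on \<Omega>. v x * frechet_derivative \<psi> (at x) i) = - (LINT x|lebesgue_on \<Omega>. (g x \<bullet> i) * \<psi> x)" .
qed

end

context sobolev_domain
begin

text \<open>The first summand bounds the L^p norm of the function through its sup bound and the
  finite measure of D; the 1 accounts for the gradient.\<close>

definition W1p_constant :: real where
  "W1p_constant = sup_constant * measure lebesgue D powr (1 / p) + 1"

lemma W1p_constant_pos: "W1p_constant > 0"
  using sup_constant_pos by (simp add: W1p_constant_def add_nonneg_pos)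

lemma subset_D_finite:
  assumes "open \<Omega>" "\<Omega> \<subseteq> D"
  shows "\<Omega> \<in> lmeasurable" "measure lebesgue \<Omega> \<le> measure lebesgue D"
proof -
  have D: "D \<in> lmeasurable" using D_sets finite_D by (simp add: fmeasurable_def)
  then show "\<Omega> \<in> lmeasurable" using assms by (intro fmeasurableI2[OF D]) (auto simp: borel_open)
  then show "measure lebesgue \<Omega> \<le> measure lebesgue D" using D assms(2) by (intro measure_mono_fmeasurable) auto
qed

lemma sobolev_pair_W1p:
  assumes \<Omega>: "open \<Omega>" "\<Omega> \<subseteq> D" and u: "sobolev_pair p \<Omega> u g" and v: "AE x in lebesgue. u x = v x"
    and v0: "\<And>x. x \<notin> \<Omega> \<Longrightarrow> v x = 0"
  shows "v \<in> W1p p \<Omega>" "2 powr p * Lp_energy p g < M \<Longrightarrow> W1p_norm p \<Omega> v \<le> W1p_constant * M powr (1 / p)"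
proof -
  have \<Omega>s: "\<Omega> \<in> sets lebesgue" using \<Omega> by (simp add: borel_open)
  have uD: "sobolev_pair p D u g" by (rule sobolev_pair_mono[OF \<Omega>(2) u])
  have gL: "g \<in> Lp_space p" by (rule sobolev_pair_Lp[OF u])
  have um: "u \<in> borel_measurable lebesgue" by (rule sobolev_pair_measurable[OF u])
  have vm: "v \<in> borel_measurable lebesgue" by (rule borel_measurable_AE[OF um v])
  have fin: "integrable lebesgue (\<lambda>x. indicat_real \<Omega> x * c)" for c
    using subset_D_finite(1)[OF \<Omega>] by (intro integrable_mult_left integrable_real_indicator) (auto simp: fmeasurable_def)
  have vb: "AE x in lebesgue. norm (norm (v x) powr p) \<le> indicat_real \<Omega> x * (sup_constant * M powr (1 / p)) powr p"
    if M: "2 powr p * Lp_energy p g < M" for M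
    using v
  proof eventually_elim
    case (elim x)
    then have "\<bar>v x\<bar> \<le> sup_constant * M powr (1 / p)" using sobolev_pair_bounded[OF uD M, of x] by simp
    then have "\<bar>v x\<bar> powr p \<le> (sup_constant * M powr (1 / p)) powr p" using p_pos by (intro powr_mono2) auto
    then show ?case using v0 by (auto simp: indicator_def)
  qed
  have vi: "integrable lebesgue (\<lambda>x. norm (v x) powr p)"
  proof (rule Bochner_Integration.integrable_bound[OF fin])
    show "(\<lambda>x. norm (v x) powr p) \<in> borel_measurable lebesgue" using vm by measurable
    define M where "M = 2 powr p * Lp_energy p g + 1"
    show "AE x in lebesgue. norm (norm (v x) powr p) \<le> norm (indicat_real \<Omega> x * (sup_constant * M powr (1 / p)) powr p)"
      using vb[of M] by (auto simp: M_def elim!: eventually_mono)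
  qed
  then have vL: "v \<in> Lp_space p" using vm by (simp add: Lp_space_def)
  have wg: "has_weak_gradient \<Omega> v g" by (rule sobolev_pair_has_weak_gradient[OF \<Omega> u v])
  show "v \<in> W1p p \<Omega>"
    using Lp_zero_outside_iff(1)[OF \<Omega>s v0] vL Lp_space_imp_Lp(1)[OF \<Omega>s gL p_pos] wg by (auto simp: W1p_def)
  assume M: "2 powr p * Lp_energy p g < M"
  have "0 \<le> 2 powr p * Lp_energy p g" by (simp add: Lp_energy_nonneg)
  then have M0: "M > 0" using M by linarith
  have "Lp_energy p v \<le> (LINT x|lebesgue. indicat_real \<Omega> x * (sup_constant * M powr (1 / p)) powr p)"
    unfolding Lp_energy_def using vb[OF M] by (intro integral_mono_AE vi fin) auto
  also have "\<dots> = measure lebesgue \<Omega> * (sup_constant * M powr (1 / p)) powr p"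
    using \<Omega>s by simp
  also have "\<dots> \<le> measure lebesgue D * (sup_constant * M powr (1 / p)) powr p"
    using subset_D_finite(2)[OF \<Omega>] by (intro mult_right_mono) auto
  finally have "Lp_energy p v powr (1 / p) \<le> (measure lebesgue D * (sup_constant * M powr (1 / p)) powr p) powr (1 / p)"
    using p_pos by (intro powr_mono2) (auto simp: Lp_energy_nonneg)
  also have "\<dots> = measure lebesgue D powr (1 / p) * (sup_constant * M powr (1 / p))"
    using sup_constant_pos p_pos M0 by (simp add: powr_mult powr_powr)
  finally have 1: "Lp_norm p \<Omega> v \<le> measure lebesgue D powr (1 / p) * (sup_constant * M powr (1 / p))"
    using Lp_zero_outside_iff(2)[OF \<Omega>s v0] by simp
  have wgm: "g \<in> borel_measurable (lebesgue_on \<Omega>)" using Lp_spaceD(1)[OF gL] by (rule measurable_restrict_space1)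
  have ae: "AE x in lebesgue_on \<Omega>. g x = weak_gradient \<Omega> v x"
    using weak_gradient_eq[OF \<Omega>(1) wg] by eventually_elim simp
  have "Lp_norm p \<Omega> (weak_gradient \<Omega> v) = Lp_norm p \<Omega> g"
  proof -
    have "AE x in lebesgue_on \<Omega>. norm (g x) powr p = norm (weak_gradient \<Omega> v x) powr p"
      using ae by eventually_elim simp
    moreover have "(\<lambda>x. norm (g x) powr p) \<in> borel_measurable (lebesgue_on \<Omega>)" using wgm by measurable
    ultimately show ?thesis using integral_lebesgue_on_cong_AE(1)[OF \<Omega>s, of "\<lambda>x. norm (g x) powr p"] by (simp only: Lp_norm_def)
  qed
  also have "\<dots> \<le> Lp_energy p g powr (1 / p)" by (rule Lp_space_imp_Lp(2)[OF \<Omega>s gL p_pos])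
  also have "\<dots> \<le> M powr (1 / p)"
  proof (rule powr_mono2)
    have "1 * Lp_energy p g \<le> 2 powr p * Lp_energy p g"
      using p_pos by (intro mult_right_mono) (auto simp: Lp_energy_nonneg ge_one_powr_ge_zero)
    then show "Lp_energy p g \<le> M" using M by simp
  qed (use p_pos in \<open>auto simp: Lp_energy_nonneg\<close>)
  finally show "W1p_norm p \<Omega> v \<le> W1p_constant * M powr (1 / p)"
    using 1 unfolding W1p_norm_def W1p_constant_def by (simp add: algebra_simps)
qed

lemma sobolev_pair_W1p_0:
  assumes \<Omega>: "open \<Omega>" "\<Omega> \<subseteq> D" and u: "sobolev_pair p \<Omega> u g" and v: "AE x in lebesgue. u x = v x"
    and v0: "\<And>x. x \<notin> \<Omega> \<Longrightarrow> v x = 0"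
  shows "v \<in> W1p_0 p \<Omega>"
proof -
  obtain \<phi> where \<phi>: "g \<in> Lp_space p" "\<And>n. \<phi> n \<in> test_functions \<Omega>"
    "(\<lambda>n. Lp_energy p (\<lambda>x. grad (\<phi> n) x - g x)) \<longlonglongrightarrow> 0"
    using sobolev_pairE[OF u] by metis
  \<comment> \<open>The norm estimate asks for a number strictly above 2^p times the energy; the
    vanishing extra term provides it.\<close>
  define M where "M = (\<lambda>n. 2 powr p * Lp_energy p (\<lambda>x. grad (\<phi> n) x - g x) + inverse (real (Suc n)))"
  have "(\<lambda>n. W1p_norm p \<Omega> (\<lambda>x. \<phi> n x - v x)) \<longlonglongrightarrow> 0"
  proof (rule real_tendsto_sandwich[OF _ _ tendsto_const])
    show "\<forall>\<^sub>F n in sequentially. 0 \<le> W1p_norm p \<Omega> (\<lambda>x. \<phi> n x - v x)"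
      by (simp add: W1p_norm_def Lp_norm_def)
    have "W1p_norm p \<Omega> (\<lambda>x. \<phi> n x - v x) \<le> W1p_constant * M n powr (1 / p)" for n
    proof (rule sobolev_pair_W1p(2)[OF \<Omega> sobolev_pair_diff[OF p_pos sobolev_pair_test_function[OF \<phi>(2) p_pos] u]])
      show "AE x in lebesgue. \<phi> n x - u x = \<phi> n x - v x" using v by eventually_elim simp
      show "\<phi> n x - v x = 0" if "x \<notin> \<Omega>" for x using that v0 test_functions_outside(1)[OF \<phi>(2)] by simp
    qed (simp add: M_def)
    then show "\<forall>\<^sub>F n in sequentially. W1p_norm p \<Omega> (\<lambda>x. \<phi> n x - v x) \<le> W1p_constant * M n powr (1 / p)" by simp
    have M: "M \<longlonglongrightarrow> 2 powr p * 0 + 0" unfolding M_def by (intro tendsto_intros \<phi> LIMSEQ_inverse_real_of_nat)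
    have "(\<lambda>n. M n powr (1 / p)) \<longlonglongrightarrow> 0 powr (1 / p)"
      using M p_pos by (intro tendsto_powr' tendsto_const) (auto simp: M_def Lp_energy_nonneg intro!: always_eventually add_nonneg_nonneg)
    then have "(\<lambda>n. W1p_constant * M n powr (1 / p)) \<longlonglongrightarrow> W1p_constant * 0" by (intro tendsto_intros) simp
    then show "(\<lambda>n. W1p_constant * M n powr (1 / p)) \<longlonglongrightarrow> 0" by simp
  qed
  then show ?thesis
    using sobolev_pair_W1p(1)[OF assms] v0 \<phi>(2) unfolding W1p_0_def by blast
qed

text \<open>Norm convergence splits into convergence of values and of gradients. The gradients alone
  produce, by completeness, a pair with a continuous u; since the values also converge to v in L^p,
  Fatou's lemma gives u = v almost everywhere.\<close>

lemma W1p_0_sobolev_pair: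
  assumes \<Omega>: "open \<Omega>" "\<Omega> \<subseteq> D" and v: "v \<in> W1p_0 p \<Omega>"
  obtains u g where "sobolev_pair p \<Omega> u g" "AE x in lebesgue. u x = v x" "\<And>x. x \<notin> \<Omega> \<Longrightarrow> v x = 0"
proof -
  have \<Omega>s: "\<Omega> \<in> sets lebesgue" using \<Omega> by (simp add: borel_open)
  obtain \<phi> G where v0: "\<And>x. x \<notin> \<Omega> \<Longrightarrow> v x = 0" and \<phi>: "\<And>n. \<phi> n \<in> test_functions \<Omega>"
    and lim: "(\<lambda>n. W1p_norm p \<Omega> (\<lambda>x. \<phi> n x - v x)) \<longlonglongrightarrow> 0"
    and G: "G \<in> Lp p \<Omega>" "has_weak_gradient \<Omega> v G" and vL: "v \<in> Lp p \<Omega>"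
    using v unfolding W1p_0_def W1p_def by blast
  define g where "g = (\<lambda>x. if x \<in> \<Omega> then G x else 0)"
  have g0: "x \<notin> \<Omega> \<Longrightarrow> g x = 0" for x by (simp add: g_def)
  have gm: "g \<in> borel_measurable lebesgue" unfolding g_def using G(1) \<Omega>s by (simp add: borel_measurable_if Lp_def)
  have gi: "integrable lebesgue (\<lambda>x. norm (g x) powr p)"
  proof -
    have "(\<lambda>x. norm (g x) powr p) = (\<lambda>x. if x \<in> \<Omega> then norm (G x) powr p else 0)" by (auto simp: g_def)
    then show ?thesis using G(1) \<Omega>s by (simp add: Lebesgue_Measure.integrable_restrict_UNIV Lp_def)
  qed
  have gL: "g \<in> Lp_space p" using gm gi by (simp add: Lp_space_def)
  have \<phi>L: "grad (\<phi> n) \<in> Lp_space p" for n by (rule grad_test_function_Lp[OF \<phi> p_pos])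
  have vLs: "v \<in> Lp_space p" using vL Lp_zero_outside_iff(1)[OF \<Omega>s v0] by simp
  have \<phi>0L: "\<phi> n \<in> Lp_space p" for n
    using sobolev_pair_W1p(1)[OF \<Omega> sobolev_pair_test_function[OF \<phi> p_pos], of n "\<phi> n"] test_functions_outside(1)[OF \<phi>]
      Lp_zero_outside_iff(1)[OF \<Omega>s, of "\<phi> n"] by (auto simp: W1p_def)
  have d0: "x \<notin> \<Omega> \<Longrightarrow> \<phi> n x - v x = 0" "x \<notin> \<Omega> \<Longrightarrow> grad (\<phi> n) x - g x = 0" for n x
    using test_functions_outside[OF \<phi>] v0 g0 by simp_all
  have norm_eq: "W1p_norm p \<Omega> (\<lambda>x. \<phi> n x - v x)
      = Lp_energy p (\<lambda>x. \<phi> n x - v x) powr (1 / p) + Lp_energy p (\<lambda>x. grad (\<phi> n) x - g x) powr (1 / p)" for n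
  proof -
    have "has_weak_gradient \<Omega> (\<lambda>x. \<phi> n x - v x) (\<lambda>x. grad (\<phi> n) x - G x)"
      by (rule has_weak_gradient_diff[OF \<Omega>(1) has_weak_gradient_test_function[OF \<Omega>(1) \<phi>] G(2)])
    from weak_gradient_eq[OF \<Omega>(1) this]
    have ae: "AE x in lebesgue_on \<Omega>. norm (grad (\<phi> n) x - g x) powr p = norm (weak_gradient \<Omega> (\<lambda>x. \<phi> n x - v x) x) powr p"
      using AE_space by eventually_elim (simp add: g_def)
    have m: "(\<lambda>x. norm (grad (\<phi> n) x - g x) powr p) \<in> borel_measurable (lebesgue_on \<Omega>)"
    proof (rule measurable_restrict_space1)
      note [measurable] = Lp_spaceD(1)[OF \<phi>L] gm
      show "(\<lambda>x. norm (grad (\<phi> n) x - g x) powr p) \<in> borel_measurable lebesgue" by measurable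
    qed
    have "Lp_norm p \<Omega> (weak_gradient \<Omega> (\<lambda>x. \<phi> n x - v x)) = Lp_norm p \<Omega> (\<lambda>x. grad (\<phi> n) x - g x)"
      unfolding Lp_norm_def integral_lebesgue_on_cong_AE(1)[OF \<Omega>s m ae] ..
    then show ?thesis
      unfolding W1p_norm_def using Lp_zero_outside_iff(2)[OF \<Omega>s d0(1)] Lp_zero_outside_iff(2)[OF \<Omega>s d0(2)] by simp
  qed
  have sq: "(\<lambda>n. a n powr (1 / p)) \<longlonglongrightarrow> 0 \<Longrightarrow> a \<longlonglongrightarrow> 0" if "\<And>n. a n \<ge> 0" for a :: "nat \<Rightarrow> real"
  proof -
    assume "(\<lambda>n. a n powr (1 / p)) \<longlonglongrightarrow> 0"
    then have "(\<lambda>n. (a n powr (1 / p)) powr p) \<longlonglongrightarrow> 0 powr p"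
      using p_pos by (intro tendsto_powr' tendsto_const) auto
    then show "a \<longlonglongrightarrow> 0" using p_pos that by (simp add: powr_powr)
  qed
  have "(\<lambda>n. Lp_energy p (\<lambda>x. \<phi> n x - v x) powr (1 / p)) \<longlonglongrightarrow> 0"
    by (rule real_tendsto_sandwich[OF _ _ tendsto_const lim]) (auto simp: norm_eq)
  then have lim1: "(\<lambda>n. Lp_energy p (\<lambda>x. \<phi> n x - v x)) \<longlonglongrightarrow> 0" by (rule sq[OF Lp_energy_nonneg])
  have "(\<lambda>n. Lp_energy p (\<lambda>x. grad (\<phi> n) x - g x) powr (1 / p)) \<longlonglongrightarrow> 0"
    by (rule real_tendsto_sandwich[OF _ _ tendsto_const lim]) (auto simp: norm_eq)
  then have lim2: "(\<lambda>n. Lp_energy p (\<lambda>x. grad (\<phi> n) x - g x)) \<longlonglongrightarrow> 0" by (rule sq[OF Lp_energy_nonneg])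
  have "\<exists>N. \<forall>m\<ge>N. \<forall>n\<ge>N. Lp_energy p (\<lambda>x. grad (\<phi> m) x - grad (\<phi> n) x) < e" if "e > 0" for e
    by (rule Lp_energy_tendsto_imp_Cauchy[where g = "\<lambda>n. grad (\<phi> n)", OF p_pos \<phi>L gL lim2 that])
  then obtain u h where uh: "sobolev_pair p \<Omega> u h" "(\<lambda>n. Lp_energy p (\<lambda>x. grad (\<phi> n) x - h x)) \<longlonglongrightarrow> 0"
    "\<And>x. (\<lambda>n. \<phi> n x) \<longlonglongrightarrow> u x"
    using sobolev_pair_complete[where u = \<phi> and g = "\<lambda>n. grad (\<phi> n)", OF \<Omega>(2) sobolev_pair_test_function[OF \<phi> p_pos]] by blast
  note u = uh(1,3)
  have um: "u \<in> borel_measurable lebesgue" by (rule sobolev_pair_measurable[OF u(1)])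
  have uv: "(\<lambda>x. u x - v x) \<in> Lp_space p \<and> Lp_energy p (\<lambda>x. u x - v x) \<le> e" if "e > 0" for e
  proof -
    have 1: "AE x in lebesgue. (\<lambda>n. \<phi> n x - v x) \<longlonglongrightarrow> u x - v x" by (intro AE_I2 tendsto_intros u)
    have 2: "\<forall>\<^sub>F n in sequentially. Lp_energy p (\<lambda>x. \<phi> n x - v x) \<le> e"
      using order_tendstoD(2)[OF lim1 that] by eventually_elim simp
    note 3 = Lp_spaceD[OF Lp_space_diff[OF p_pos \<phi>0L vLs]]
    have 4: "(\<lambda>x. u x - v x) \<in> borel_measurable lebesgue" using um Lp_spaceD(1)[OF vLs] by simp
    show ?thesis using Lp_energy_le_limit[OF p_pos 3(1) 1 4 3(2) 2] by blast
  qed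
  have "Lp_energy p (\<lambda>x. u x - v x) \<le> 0 + e" if "e > 0" for e
    using conjunct2[OF uv[OF that]] by simp
  then have "Lp_energy p (\<lambda>x. u x - v x) \<le> 0" by (rule field_le_epsilon)
  then have "Lp_energy p (\<lambda>x. u x - v x) = 0" using Lp_energy_nonneg[of p "\<lambda>x. u x - v x"] by linarith
  then have "AE x in lebesgue. u x - v x = 0" by (rule Lp_energy_eq_0D[OF conjunct1[OF uv[OF zero_less_one]]])
  then have "AE x in lebesgue. u x = v x" by eventually_elim simp
  then show ?thesis using that u(1) v0 by blast
qed

lemma sobolev_pair_weak_gradient:
  assumes \<Omega>: "open \<Omega>" "\<Omega> \<subseteq> D" and u: "sobolev_pair p \<Omega> u g" and v: "AE x in lebesgue. u x = v x"
  shows "AE x in lebesgue_on \<Omega>. weak_gradient \<Omega> v x = g x"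
  by (rule weak_gradient_eq[OF \<Omega>(1) sobolev_pair_has_weak_gradient[OF assms]])

end

section \<open>Truncation near zero\<close>

lemma Lp_energy_dominated_tendsto_0:
  fixes f :: "nat \<Rightarrow> 'a::euclidean_space \<Rightarrow> 'b::euclidean_space"
  assumes p: "p > 0" and g: "g \<in> Lp_space p" and f: "\<And>n. f n \<in> borel_measurable lebesgue"
    and le: "\<And>n x. norm (f n x) \<le> c * norm (g x)" and c: "c \<ge> 0" and lim: "\<And>x. (\<lambda>n. f n x) \<longlonglongrightarrow> 0"
  shows "\<And>n. f n \<in> Lp_space p" "(\<lambda>n. Lp_energy p (f n)) \<longlonglongrightarrow> 0"
proof -
  note [measurable] = f
  have b: "norm (f n x) powr p \<le> c powr p * norm (g x) powr p" for n x
    using p le[of n x] c powr_mono2[of p "norm (f n x)" "c * norm (g x)"] by (simp add: powr_mult)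
  have i: "integrable lebesgue (\<lambda>x. c powr p * norm (g x) powr p)" using Lp_spaceD(2)[OF g] by simp
  have "integrable lebesgue (\<lambda>x. norm (f n x) powr p)" for n
    by (rule Bochner_Integration.integrable_bound[OF i]) (use b in \<open>auto intro!: AE_I2\<close>)
  then show "f n \<in> Lp_space p" for n by (simp add: Lp_space_def)
  have "(\<lambda>n. LINT x|lebesgue. norm (f n x) powr p) \<longlonglongrightarrow> (LINT (x::'a)|lebesgue. norm (0::'b) powr p)"
  proof (rule integral_dominated_convergence)
    show "integrable lebesgue (\<lambda>x. c powr p * norm (g x) powr p)" by (rule i)
    show "AE x in lebesgue. (\<lambda>n. norm (f n x) powr p) \<longlonglongrightarrow> norm (0::'b) powr p"
      using p by (intro AE_I2 tendsto_powr' tendsto_norm lim tendsto_const) auto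
  qed (use b in auto)
  then show "(\<lambda>n. Lp_energy p (f n)) \<longlonglongrightarrow> 0" by (simp add: Lp_energy_def)
qed

context sobolev_domain
begin

text \<open>The test functions \<phi> n converge to u uniformly, so eventually |\<phi> n| reaches
  \<delta> only where u \<noteq> 0. Since T vanishes on [-\<delta>, \<delta>], T composed with
  \<phi> n has compact support in {u \<noteq> 0}.\<close>

lemma sobolev_pair_truncation:
  assumes u: "sobolev_pair p D u g"
    and T: "smooth T" "\<And>s. (T has_real_derivative T' s) (at s)" "continuous_on UNIV T'"
      "\<And>s. \<bar>s\<bar> \<le> \<delta> \<Longrightarrow> T s = 0" "\<And>s. \<bar>T' s\<bar> \<le> C" and \<delta>: "\<delta> > 0"
  shows "sobolev_pair p {x. u x \<noteq> 0} (\<lambda>x. T (u x)) (\<lambda>x. T' (u x) *\<^sub>R g x)"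
proof -
  obtain \<phi> where \<phi>: "g \<in> Lp_space p" "\<And>n. \<phi> n \<in> test_functions D" "\<And>x. (\<lambda>n. \<phi> n x) \<longlonglongrightarrow> u x"
    "(\<lambda>n. Lp_energy p (\<lambda>x. grad (\<phi> n) x - g x)) \<longlonglongrightarrow> 0"
    using sobolev_pairE[OF u] by blast
  have C: "C \<ge> 0" using T(5)[of 0] by linarith
  have pd: "sobolev_pair p D (\<lambda>x. \<phi> n x - u x) (\<lambda>x. grad (\<phi> n) x - g x)" for n
    by (rule sobolev_pair_diff[OF p_pos sobolev_pair_test_function[OF \<phi>(2) p_pos] u])
  obtain n0 where n0: "\<And>n x. n \<ge> n0 \<Longrightarrow> \<bar>\<phi> n x - u x\<bar> < \<delta>"
    using sobolev_pair_tendsto_0[OF pd \<phi>(4) \<delta>] unfolding eventually_sequentially by blast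
  define \<psi> where "\<psi> = (\<lambda>n x. T (\<phi> (n + n0) x))"
  have \<phi>s: "smooth (\<phi> n)" for n using test_functions_smooth[OF \<phi>(2)] .
  have \<psi>: "\<psi> n \<in> test_functions {x. u x \<noteq> 0}" for n
  proof -
    obtain K where K: "compact K" "\<And>x. x \<notin> K \<Longrightarrow> \<phi> (n + n0) x = 0"
      using test_functions_obtain[OF \<phi>(2)[of "n + n0"]] by metis
    define L where "L = {x. \<delta> \<le> \<bar>\<phi> (n + n0) x\<bar>}"
    have "closed L" unfolding L_def
      by (intro closed_Collect_le continuous_intros smooth_continuous \<phi>s)
    then have "compact (K \<inter> L)" using K(1) by (rule compact_Int_closed[rotated])
    moreover have "K \<inter> L \<subseteq> {x. u x \<noteq> 0}"
    proof
      fix x assume "x \<in> K \<inter> L"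
      then have "\<delta> \<le> \<bar>\<phi> (n + n0) x\<bar>" by (simp add: L_def)
      with n0[of "n + n0" x] show "x \<in> {x. u x \<noteq> 0}" by auto
    qed
    moreover have "\<psi> n x = 0" if "x \<notin> K \<inter> L" for x
    proof -
      have "\<bar>\<phi> (n + n0) x\<bar> \<le> \<delta>" using that K(2)[of x] \<delta> by (cases "x \<in> K") (auto simp: L_def)
      then show ?thesis by (simp add: \<psi>_def T(4))
    qed
    ultimately show ?thesis
      unfolding test_functions_iff using smooth_compose[OF T(1) \<phi>s] by (auto simp: \<psi>_def)
  qed
  have T'c: "(\<lambda>n. T' (\<phi> (n + n0) x)) \<longlonglongrightarrow> T' (u x)" for x
    using T(3) by (intro isCont_tendsto_compose[of "u x" T'] LIMSEQ_ignore_initial_segment \<phi>(3))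
      (simp add: continuous_on_eq_continuous_at)
  have \<psi>T: "(\<lambda>n. \<psi> n x) \<longlonglongrightarrow> T (u x)" for x
    unfolding \<psi>_def by (intro isCont_tendsto_compose[of "u x" T] LIMSEQ_ignore_initial_segment \<phi>(3) DERIV_isCont[OF T(2)])
  have g\<psi>: "grad (\<psi> n) x = T' (\<phi> (n + n0) x) *\<^sub>R grad (\<phi> (n + n0)) x" for n x
    unfolding \<psi>_def by (rule grad_compose[OF T(2) \<phi>s])
  have T'm: "T' \<in> borel_measurable borel" using T(3) by (rule borel_measurable_continuous_onI)
  have \<phi>m: "\<phi> n \<in> borel_measurable lebesgue" for n
    using smooth_continuous[OF \<phi>s] by (simp add: borel_measurable_continuous_onI measurable_completion)
  have um: "u \<in> borel_measurable lebesgue" by (rule sobolev_pair_measurable[OF u])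
  note [measurable] = T'm \<phi>m um Lp_spaceD(1)[OF \<phi>(1)]
  have T'u: "(\<lambda>x. T' (u x)) \<in> borel_measurable lebesgue" "(\<lambda>x. T' (\<phi> n x)) \<in> borel_measurable lebesgue" for n
    using measurable_compose[OF um T'm] measurable_compose[OF \<phi>m T'm] .
  have T'g: "(\<lambda>x. T' (u x) *\<^sub>R g x) \<in> Lp_space p"
  proof -
    have "integrable lebesgue (\<lambda>x. norm (T' (u x) *\<^sub>R g x) powr p)"
    proof (rule Bochner_Integration.integrable_bound)
      show "integrable lebesgue (\<lambda>x. C powr p * norm (g x) powr p)" using Lp_spaceD(2)[OF \<phi>(1)] by simp
      show "(\<lambda>x. norm (T' (u x) *\<^sub>R g x) powr p) \<in> borel_measurable lebesgue" using T'u by measurable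
      show "AE x in lebesgue. norm (norm (T' (u x) *\<^sub>R g x) powr p) \<le> norm (C powr p * norm (g x) powr p)"
        using T(5) p_pos by (intro AE_I2) (auto simp: powr_mult intro!: mult_right_mono powr_mono2)
    qed
    then show ?thesis using T'u by (simp add: Lp_space_def)
  qed
  \<comment> \<open>Splitting of the gradient error: A is controlled by the bound on T', B by
    dominated convergence, because T' is continuous and the \<phi> n converge to u
    pointwise.\<close>
  define A where "A = (\<lambda>n x. T' (\<phi> (n + n0) x) *\<^sub>R (grad (\<phi> (n + n0)) x - g x))"
  define B where "B = (\<lambda>n x. (T' (\<phi> (n + n0) x) - T' (u x)) *\<^sub>R g x)"
  have B: "B n \<in> Lp_space p" "(\<lambda>n. Lp_energy p (B n)) \<longlonglongrightarrow> 0" for n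
  proof -
    have 1: "B n \<in> borel_measurable lebesgue" for n unfolding B_def using T'u by measurable
    have 2: "norm (B n x) \<le> (2 * C) * norm (g x)" for n x
      using T(5)[of "\<phi> (n + n0) x"] T(5)[of "u x"] unfolding B_def norm_scaleR by (intro mult_right_mono) auto
    have "(\<lambda>n. B n x) \<longlonglongrightarrow> (T' (u x) - T' (u x)) *\<^sub>R g x" for x unfolding B_def by (intro tendsto_intros T'c)
    then have 3: "(\<lambda>n. B n x) \<longlonglongrightarrow> 0" for x by simp
    show "B n \<in> Lp_space p" "(\<lambda>n. Lp_energy p (B n)) \<longlonglongrightarrow> 0"
      using Lp_energy_dominated_tendsto_0[OF p_pos \<phi>(1) 1 2 _ 3] C by auto
  qed
  have gd: "(\<lambda>x. grad (\<phi> n) x - g x) \<in> Lp_space p" for n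
    by (rule Lp_space_diff[OF p_pos grad_test_function_Lp[OF \<phi>(2) p_pos] \<phi>(1)])
  have Am: "A n \<in> borel_measurable lebesgue" for n
    unfolding A_def using T'u Lp_spaceD(1)[OF gd] by (intro borel_measurable_scaleR)
  have Ab: "norm (A n x) powr p \<le> C powr p * norm (grad (\<phi> (n + n0)) x - g x) powr p" for n x
    using T(5) p_pos by (auto simp: A_def powr_mult intro!: mult_right_mono powr_mono2)
  have Ai: "integrable lebesgue (\<lambda>x. norm (A n x) powr p)" for n
  proof (rule Bochner_Integration.integrable_bound)
    show "integrable lebesgue (\<lambda>x. C powr p * norm (grad (\<phi> (n + n0)) x - g x) powr p)"
      using Lp_spaceD(2)[OF gd] by simp
    show "(\<lambda>x. norm (A n x) powr p) \<in> borel_measurable lebesgue" using Am by measurable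
  qed (use Ab in auto)
  have AL: "A n \<in> Lp_space p" for n using Am Ai by (simp add: Lp_space_def)
  have Ae: "Lp_energy p (A n) \<le> C powr p * Lp_energy p (\<lambda>x. grad (\<phi> (n + n0)) x - g x)" for n
    using integral_mono[OF Ai integrable_mult_right[OF Lp_spaceD(2)[OF gd]] Ab] by (simp add: Lp_energy_def)
  have "(\<lambda>n. Lp_energy p (\<lambda>x. grad (\<psi> n) x - T' (u x) *\<^sub>R g x)) \<longlonglongrightarrow> 0"
  proof (rule real_tendsto_sandwich[OF _ _ tendsto_const])
    show "\<forall>\<^sub>F n in sequentially. 0 \<le> Lp_energy p (\<lambda>x. grad (\<psi> n) x - T' (u x) *\<^sub>R g x)" by (simp add: Lp_energy_nonneg)
    show "\<forall>\<^sub>F n in sequentially. Lp_energy p (\<lambda>x. grad (\<psi> n) x - T' (u x) *\<^sub>R g x)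
      \<le> 2 powr p * (C powr p * Lp_energy p (\<lambda>x. grad (\<phi> (n + n0)) x - g x) + Lp_energy p (B n))"
    proof (rule always_eventually, rule allI)
      fix n
      have "grad (\<psi> n) x - T' (u x) *\<^sub>R g x = A n x + B n x" for x
        by (simp add: g\<psi> A_def B_def algebra_simps)
      then have "Lp_energy p (\<lambda>x. grad (\<psi> n) x - T' (u x) *\<^sub>R g x) \<le> 2 powr p * (Lp_energy p (A n) + Lp_energy p (B n))"
        using Lp_energy_add_le[OF p_pos AL B(1), of n n] by simp
      also have "\<dots> \<le> 2 powr p * (C powr p * Lp_energy p (\<lambda>x. grad (\<phi> (n + n0)) x - g x) + Lp_energy p (B n))"
        using Ae[of n] by (intro mult_left_mono add_right_mono) auto
      finally show "Lp_energy p (\<lambda>x. grad (\<psi> n) x - T' (u x) *\<^sub>R g x)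
        \<le> 2 powr p * (C powr p * Lp_energy p (\<lambda>x. grad (\<phi> (n + n0)) x - g x) + Lp_energy p (B n))" .
    qed
    have "(\<lambda>n. 2 powr p * (C powr p * Lp_energy p (\<lambda>x. grad (\<phi> (n + n0)) x - g x) + Lp_energy p (B n))) \<longlonglongrightarrow> 2 powr p * (C powr p * 0 + 0)"
      by (intro tendsto_intros B(2) LIMSEQ_ignore_initial_segment[OF \<phi>(4)])
    then show "(\<lambda>n. 2 powr p * (C powr p * Lp_energy p (\<lambda>x. grad (\<phi> (n + n0)) x - g x) + Lp_energy p (B n))) \<longlonglongrightarrow> 0" by simp
  qed
  then show ?thesis unfolding sobolev_pair_def using T'g \<psi> \<psi>T by blast
qed

text \<open>The truncations T(N u)/N converge to u, and their gradients converge to g on {u \<noteq>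
  0} and to 0 elsewhere. Cutting g off can only lower the energy, hence the inequality.\<close>

lemma sobolev_pair_nonzero_set:
  assumes u: "sobolev_pair p D u g"
  obtains h where "sobolev_pair p {x. u x \<noteq> 0} u h" "Lp_energy p h \<le> Lp_energy p g"
proof -
  obtain T T' :: "real \<Rightarrow> real" and C where T: "smooth T" "\<And>s. (T has_real_derivative T' s) (at s)"
    "continuous_on UNIV T'" "\<And>s. \<bar>s\<bar> \<le> 1 \<Longrightarrow> T s = 0" "\<And>s. \<bar>T' s\<bar> \<le> C"
    "(T' \<longlongrightarrow> 1) at_infinity" "((\<lambda>s. T s / s) \<longlongrightarrow> 1) at_infinity"
    using ex_smooth_truncation by blast
  have C: "C \<ge> 0" using T(5)[of 0] by linarith
  \<comment> \<open>T vanishes near 0, so the gradients of all truncations vanish where u =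
    0.\<close>
  have T'0: "T' 0 = 0"
  proof -
    have "((\<lambda>s. 0) has_real_derivative T' 0) (at 0)"
      by (rule has_field_derivative_transform_within_open[OF T(2)[of 0], of "{-1<..<1}"]) (auto intro!: T(4))
    from DERIV_unique[OF this DERIV_const] show ?thesis .
  qed
  define N where "N = (\<lambda>k. real (Suc k))"
  have N: "N k > 0" for k by (simp add: N_def)
  have Ninf: "filterlim (\<lambda>k. N k * s) at_infinity sequentially" if "s \<noteq> 0" for s
  proof -
    have "filterlim N at_infinity sequentially"
      unfolding N_def
      by (intro filterlim_at_top_imp_at_infinity filterlim_compose[OF filterlim_real_sequentially filterlim_Suc])
    from tendsto_mult_filterlim_at_infinity[OF tendsto_const that this]
    show ?thesis by (simp add: mult.commute)
  qed
  define v where "v = (\<lambda>k x. T (N k * u x) / N k)"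
  define G where "G = (\<lambda>k x. T' (N k * u x) *\<^sub>R g x)"
  define g' where "g' = (\<lambda>x. if u x \<noteq> 0 then g x else 0)"
  have gL: "g \<in> Lp_space p" by (rule sobolev_pair_Lp[OF u])
  have vG: "sobolev_pair p {x. u x \<noteq> 0} (v k) (G k)" for k
  proof -
    have "sobolev_pair p {x. u x \<noteq> 0} (\<lambda>x. inverse (N k) * T (N k * u x)) (\<lambda>x. T' (N k * u x) *\<^sub>R g x)"
    proof (rule sobolev_pair_truncation[OF u, where T = "\<lambda>s. inverse (N k) * T (N k * s)" and T' = "\<lambda>s. T' (N k * s)" and \<delta> = "inverse (N k)" and C = C])
      show "smooth (\<lambda>s. inverse (N k) * T (N k * s))"
        by (intro smooth_mult smooth_const smooth_compose[OF T(1)] smooth_ident)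
      show "((\<lambda>s. inverse (N k) * T (N k * s)) has_real_derivative T' (N k * s)) (at s)" for s
        using N[of k] by (auto intro!: derivative_eq_intros DERIV_chain'[OF _ T(2)])
      show "continuous_on UNIV (\<lambda>s. T' (N k * s))"
        by (intro continuous_on_compose2[OF T(3)] continuous_intros) auto
      show "inverse (N k) * T (N k * s) = 0" if "\<bar>s\<bar> \<le> inverse (N k)" for s
      proof -
        have "N k * \<bar>s\<bar> \<le> N k * inverse (N k)" using that N[of k] by (intro mult_left_mono) auto
        then have "\<bar>N k * s\<bar> \<le> 1" using N[of k] by (simp add: abs_mult)
        then show ?thesis by (simp add: T(4))
      qed
    qed (use T(5) N in auto)
    then show ?thesis by (simp add: v_def G_def divide_inverse mult.commute)
  qed
  have GL: "G k \<in> Lp_space p" for k by (rule sobolev_pair_Lp[OF vG])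
  have um: "u \<in> borel_measurable lebesgue" by (rule sobolev_pair_measurable[OF u])
  have g'm: "g' \<in> borel_measurable lebesgue"
    unfolding g'_def using um Lp_spaceD(1)[OF gL] by measurable
  have Glim: "(\<lambda>k. G k x) \<longlonglongrightarrow> g' x" for x
  proof (cases "u x = 0")
    case True
    then show ?thesis by (simp add: G_def g'_def T'0)
  next
    case False
    have "(\<lambda>k. T' (N k * u x) *\<^sub>R g x) \<longlonglongrightarrow> 1 *\<^sub>R g x"
      by (intro tendsto_intros filterlim_compose[OF T(6) Ninf[OF False]])
    then show ?thesis using False by (simp add: G_def g'_def)
  qed
  have Gg': "(\<lambda>k. Lp_energy p (\<lambda>x. G k x - g' x)) \<longlonglongrightarrow> 0" "\<And>k. (\<lambda>x. G k x - g' x) \<in> Lp_space p"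
  proof -
    have 1: "(\<lambda>x. G k x - g' x) \<in> borel_measurable lebesgue" for k
      using Lp_spaceD(1)[OF GL] g'm by simp
    have 2: "norm (G k x - g' x) \<le> (C + 1) * norm (g x)" for k x
    proof -
      have "norm (G k x) \<le> C * norm (g x)" using T(5) by (auto simp: G_def intro!: mult_right_mono)
      moreover have "norm (g' x) \<le> norm (g x)" by (simp add: g'_def)
      ultimately show ?thesis using norm_triangle_ineq4[of "G k x" "g' x"] by (simp add: distrib_right)
    qed
    have 3: "(\<lambda>k. G k x - g' x) \<longlonglongrightarrow> 0" for x using Glim[of x] by (simp add: LIM_zero)
    show "(\<lambda>k. Lp_energy p (\<lambda>x. G k x - g' x)) \<longlonglongrightarrow> 0" "\<And>k. (\<lambda>x. G k x - g' x) \<in> Lp_space p"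
      using Lp_energy_dominated_tendsto_0[OF p_pos gL 1 2 _ 3] C by auto
  qed
  have g'L: "g' \<in> Lp_space p" using Lp_space_diff[OF p_pos GL Gg'(2), of 0 0] by simp
  have "\<exists>M. \<forall>m\<ge>M. \<forall>n\<ge>M. Lp_energy p (\<lambda>x. G m x - G n x) < e" if "e > 0" for e
    by (rule Lp_energy_tendsto_imp_Cauchy[OF p_pos GL g'L Gg'(1) that])
  moreover have "{x. u x \<noteq> 0} \<subseteq> D" using sobolev_pair_outside[OF u] by blast
  ultimately obtain w h where wh: "sobolev_pair p {x. u x \<noteq> 0} w h" "(\<lambda>n. Lp_energy p (\<lambda>x. G n x - h x)) \<longlonglongrightarrow> 0"
    "\<And>x. (\<lambda>n. v n x) \<longlonglongrightarrow> w x"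
    using sobolev_pair_complete[where u = v and g = G, OF _ vG] by blast
  have "(\<lambda>k. v k x) \<longlonglongrightarrow> u x" for x
  proof (cases "u x = 0")
    case True
    then show ?thesis by (simp add: v_def T(4))
  next
    case False
    have "(\<lambda>k. T (N k * u x) / (N k * u x) * u x) \<longlonglongrightarrow> 1 * u x"
      by (intro tendsto_intros filterlim_compose[OF T(7) Ninf[OF False]])
    then show ?thesis using False by (simp add: v_def)
  qed
  then have "w = u" using wh(3) LIMSEQ_unique by blast
  have hL: "h \<in> Lp_space p" by (rule sobolev_pair_Lp[OF wh(1)])
  \<comment> \<open>Both h and g' are limits of the G n in energy, hence equal almost
    everywhere.\<close>
  have "Lp_energy p (\<lambda>x. h x - g' x) \<le> 0"
  proof (rule LIMSEQ_le_const)
    show "(\<lambda>n. 2 powr p * (Lp_energy p (\<lambda>x. G n x - h x) + Lp_energy p (\<lambda>x. G n x - g' x))) \<longlonglongrightarrow> 0"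
      using tendsto_mult[OF tendsto_const[of "2 powr p"] tendsto_add[OF wh(2) Gg'(1)]] by simp
    show "\<exists>N. \<forall>n\<ge>N. Lp_energy p (\<lambda>x. h x - g' x) \<le> 2 powr p * (Lp_energy p (\<lambda>x. G n x - h x) + Lp_energy p (\<lambda>x. G n x - g' x))"
      using Lp_energy_triangle[OF p_pos hL GL g'L] unfolding Lp_energy_minus_commute[of p h "G _"] by blast
  qed
  then have "Lp_energy p (\<lambda>x. h x - g' x) = 0" using Lp_energy_nonneg[of p "\<lambda>x. h x - g' x"] by linarith
  then have "AE x in lebesgue. h x - g' x = 0" by (rule Lp_energy_eq_0D[OF Lp_space_diff[OF p_pos hL g'L]])
  then have "AE x in lebesgue. h x = g' x" by eventually_elim simp
  then have "Lp_energy p h = Lp_energy p g'" by (rule Lp_energy_cong_AE[OF Lp_spaceD(1)[OF hL]])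
  also have "\<dots> \<le> Lp_energy p g"
    unfolding Lp_energy_def using Lp_spaceD(2)[OF g'L] Lp_spaceD(2)[OF gL]
    by (intro integral_mono) (auto simp: g'_def)
  finally show ?thesis using that wh(1) \<open>w = u\<close> by blast
qed

end

section \<open>The Dirichlet problem\<close>

locale p_Laplace_problem = sobolev_domain D p for D :: "'a::euclidean_space set" and p +
  fixes f :: "('a \<Rightarrow> real) \<Rightarrow> real"
  assumes f_dual: "f \<in> W1p_0_dual p D"
begin

lemma sobolev_pair_in_W1p_0: "sobolev_pair p D u g \<Longrightarrow> u \<in> W1p_0 p D"
  by (rule sobolev_pair_W1p_0[OF open_D order_refl]) (auto dest: sobolev_pair_outside)

lemma f_add: "sobolev_pair p D u g \<Longrightarrow> sobolev_pair p D v h \<Longrightarrow> f (\<lambda>x. u x + v x) = f u + f v"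
  using f_dual sobolev_pair_in_W1p_0 unfolding W1p_0_dual_def by blast

lemma f_cmult: "sobolev_pair p D u g \<Longrightarrow> f (\<lambda>x. c * u x) = c * f u"
  using f_dual sobolev_pair_in_W1p_0 unfolding W1p_0_dual_def by blast

lemma f_diff: "sobolev_pair p D u g \<Longrightarrow> sobolev_pair p D v h \<Longrightarrow> f (\<lambda>x. u x - v x) = f u - f v"
  using f_add[OF _ sobolev_pair_cmult, of u g v h "-1"] f_cmult[of v h "-1"] by simp

definition f_constant :: real where
  "f_constant = (SOME C. C > 0 \<and> (\<forall>u\<in>W1p_0 p D. \<bar>f u\<bar> \<le> C * W1p_norm p D u)) * W1p_constant"

lemma f_constant_ex: "\<exists>C > 0. \<forall>u\<in>W1p_0 p D. \<bar>f u\<bar> \<le> C * W1p_norm p D u"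
proof -
  obtain C where C: "\<And>u. u \<in> W1p_0 p D \<Longrightarrow> \<bar>f u\<bar> \<le> C * W1p_norm p D u"
    using f_dual unfolding W1p_0_dual_def by blast
  have "\<bar>f u\<bar> \<le> (\<bar>C\<bar> + 1) * W1p_norm p D u" if "u \<in> W1p_0 p D" for u
  proof -
    have "W1p_norm p D u \<ge> 0" by (simp add: W1p_norm_def Lp_norm_def)
    then have "C * W1p_norm p D u \<le> (\<bar>C\<bar> + 1) * W1p_norm p D u" by (intro mult_right_mono) auto
    then show ?thesis using C[OF that] by linarith
  qed
  then show ?thesis by (intro exI[of _ "\<bar>C\<bar> + 1"]) auto
qed

lemma f_constant_pos: "f_constant > 0"
  unfolding f_constant_def using someI_ex[OF f_constant_ex[unfolded Bex_def]] W1p_constant_pos by simp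

lemma f_bound_AE:
  assumes "sobolev_pair p D u g" "AE x in lebesgue. u x = v x" "\<And>x. x \<notin> D \<Longrightarrow> v x = 0" "2 powr p * Lp_energy p g < M"
  shows "\<bar>f v\<bar> \<le> f_constant * M powr (1 / p)"
proof -
  define C where "C = (SOME C. C > 0 \<and> (\<forall>u\<in>W1p_0 p D. \<bar>f u\<bar> \<le> C * W1p_norm p D u))"
  have C: "C > 0" "\<And>u. u \<in> W1p_0 p D \<Longrightarrow> \<bar>f u\<bar> \<le> C * W1p_norm p D u"
    using someI_ex[OF f_constant_ex[unfolded Bex_def]] unfolding C_def by auto
  have "\<bar>f v\<bar> \<le> C * W1p_norm p D v"
    by (rule C(2)[OF sobolev_pair_W1p_0[OF open_D order_refl assms(1-3)]])
  also have "\<dots> \<le> C * (W1p_constant * M powr (1 / p))"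
    using C(1) by (intro mult_left_mono sobolev_pair_W1p(2)[OF open_D order_refl assms]) auto
  finally show ?thesis by (simp add: f_constant_def C_def mult.assoc)
qed

lemma f_bound: "sobolev_pair p D u g \<Longrightarrow> 2 powr p * Lp_energy p g < M \<Longrightarrow> \<bar>f u\<bar> \<le> f_constant * M powr (1 / p)"
  by (rule f_bound_AE) (auto dest: sobolev_pair_outside)

text \<open>Bounds are stated for numbers M strictly above a multiple of the energy, so zero energy
  makes every M > 0 available; M = (|a| / (2 K))^p then yields |a| \<le> |a| / 2.\<close>

lemma le_powr_imp_0:
  assumes "\<And>M. M > 0 \<Longrightarrow> \<bar>a\<bar> \<le> K * M powr (1 / p)" "K > 0" shows "a = (0::real)"
proof (rule ccontr)
  assume a: "a \<noteq> 0"
  have "\<bar>a\<bar> \<le> K * ((\<bar>a\<bar> / (2 * K)) powr p) powr (1 / p)" using a assms(2) by (intro assms(1)) auto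
  also have "\<dots> = \<bar>a\<bar> / 2" using a assms(2) p_pos by (simp add: powr_powr)
  finally show False using a by simp
qed

text \<open>f acts on functions, not on classes. The difference of two representatives represents
  the zero pair, whose energy 0 leaves no value but 0 for f.\<close>

lemma f_cong_AE:
  assumes u: "sobolev_pair p D u g" and v: "AE x in lebesgue. u x = v x" "\<And>x. x \<notin> D \<Longrightarrow> v x = 0"
  shows "f v = f u"
proof -
  have vW: "v \<in> W1p_0 p D" by (rule sobolev_pair_W1p_0[OF open_D order_refl u v])
  have uW: "(\<lambda>x. -1 * u x) \<in> W1p_0 p D" by (rule sobolev_pair_in_W1p_0[OF sobolev_pair_cmult[OF u]])
  define w where "w = (\<lambda>x. -1 * u x)"
  have "f (\<lambda>x. v x + w x) = f v + f w"
    using f_dual vW uW unfolding W1p_0_dual_def w_def[symmetric] by blast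
  then have "f v - f u = f (\<lambda>x. v x - u x)" using f_cmult[OF u, of "-1"] by (simp add: w_def)
  also have "\<dots> = 0"
  proof (rule le_powr_imp_0[OF _ f_constant_pos])
    fix M :: real assume M: "M > 0"
    show "\<bar>f (\<lambda>x. v x - u x)\<bar> \<le> f_constant * M powr (1 / p)"
    proof (rule f_bound_AE[OF sobolev_pair_zero[OF p_pos]])
      show "AE x in lebesgue. 0 = v x - u x" using v(1) by eventually_elim simp
    qed (use M v(2) sobolev_pair_outside[OF u] in \<open>auto simp: Lp_energy_zero\<close>)
  qed
  finally show ?thesis by simp
qed

lemma f_tendsto_0:
  assumes "\<And>n. sobolev_pair p D (u n) (g n)" "(\<lambda>n. Lp_energy p (g n)) \<longlonglongrightarrow> 0"
  shows "(\<lambda>n. f (u n)) \<longlonglongrightarrow> 0"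
proof (rule tendsto_rabs_zero_cancel, rule real_tendsto_sandwich[OF _ _ tendsto_const])
  define M where "M = (\<lambda>n. 2 powr p * Lp_energy p (g n) + inverse (real (Suc n)))"
  have "\<bar>f (u n)\<bar> \<le> f_constant * M n powr (1 / p)" for n
    by (rule f_bound[OF assms(1)]) (simp add: M_def)
  then show "\<forall>\<^sub>F n in sequentially. \<bar>f (u n)\<bar> \<le> f_constant * M n powr (1 / p)" by simp
  have M: "M \<longlonglongrightarrow> 2 powr p * 0 + 0" unfolding M_def by (intro tendsto_intros assms LIMSEQ_inverse_real_of_nat)
  have "(\<lambda>n. M n powr (1 / p)) \<longlonglongrightarrow> 0 powr (1 / p)"
    using M p_pos by (intro tendsto_powr' tendsto_const) (auto simp: M_def Lp_energy_nonneg intro!: always_eventually add_nonneg_nonneg)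
  then have "(\<lambda>n. f_constant * M n powr (1 / p)) \<longlonglongrightarrow> f_constant * 0" by (intro tendsto_intros) simp
  then show "(\<lambda>n. f_constant * M n powr (1 / p)) \<longlonglongrightarrow> 0" by simp
qed simp

section \<open>Coercivity, convexity and lower semicontinuity of the Dirichlet energy\<close>

definition dirichlet_energy :: "('a \<Rightarrow> real) \<Rightarrow> ('a \<Rightarrow> 'a) \<Rightarrow> real" where
  "dirichlet_energy u g = Lp_energy p g / p - f u"

text \<open>The variational form of the state equation. It speaks of pairs only and can be passed to
  limits by semicontinuity.\<close>

definition minimizing_pair :: "'a set \<Rightarrow> ('a \<Rightarrow> real) \<Rightarrow> ('a \<Rightarrow> 'a) \<Rightarrow> bool" where
  "minimizing_pair \<Omega> u g \<longleftrightarrow> sobolev_pair p \<Omega> u g \<and>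
     (\<forall>v h. sobolev_pair p \<Omega> v h \<longrightarrow> dirichlet_energy u g \<le> dirichlet_energy v h)"

lemma dirichlet_energy_coercive:
  obtains K where "\<And>u g. sobolev_pair p D u g \<Longrightarrow> Lp_energy p g / (2 * p) - K \<le> dirichlet_energy u g"
proof -
  define s where "s = f_constant powr (1 / (p - 1))"
  \<comment> \<open>Chosen so that Young's inequality absorbs f into 1/(2 p) of the energy, half of
    its coefficient in \<open>dirichlet_energy\<close>.\<close>
  define e where "e = (2 * p * 2 powr p) powr (1 / (p - 1))"
  have e: "e > 0" using p_pos by (simp add: e_def)
  have ep: "e powr (1 - p) = 1 / (2 * p * 2 powr p)"
  proof -
    have "e powr (p - 1) = 2 * p * 2 powr p" using p_gt_1 by (simp add: e_def powr_powr)
    then show ?thesis using powr_minus_divide[of e "p - 1"] by simp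
  qed
  have sp: "s powr (p - 1) = f_constant" using p_gt_1 f_constant_pos by (simp add: s_def powr_powr)
  show ?thesis
  proof (rule that[of "e * s powr p + e powr (1 - p)"])
    fix u g assume u: "sobolev_pair p D u g"
    define M where "M = 2 powr p * Lp_energy p g + 1"
    have M: "M > 0" using Lp_energy_nonneg[of p g] by (simp add: M_def add_nonneg_pos)
    have "\<bar>f u\<bar> \<le> s powr (p - 1) * M powr (1 / p)" unfolding sp by (rule f_bound[OF u]) (simp add: M_def)
    also have "\<dots> \<le> e * s powr p + e powr (1 - p) * (M powr (1 / p)) powr p"
      using p_gt_1 e by (intro powr_mult_le) (auto simp: s_def)
    also have "(M powr (1 / p)) powr p = M" using M p_pos by (simp add: powr_powr)
    also have "e powr (1 - p) * M = Lp_energy p g / (2 * p) + e powr (1 - p)"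
    proof -
      have "e powr (1 - p) * M = e powr (1 - p) * 2 powr p * Lp_energy p g + e powr (1 - p)"
        by (simp add: M_def distrib_left)
      also have "e powr (1 - p) * 2 powr p = 1 / (2 * p)" unfolding ep by simp
      finally show ?thesis by simp
    qed
    finally have "f u \<le> e * s powr p + (Lp_energy p g / (2 * p) + e powr (1 - p))" by linarith
    moreover have "Lp_energy p g / p = Lp_energy p g / (2 * p) + Lp_energy p g / (2 * p)"
      using p_pos by (simp add: field_simps)
    ultimately show "Lp_energy p g / (2 * p) - (e * s powr p + e powr (1 - p)) \<le> dirichlet_energy u g"
      unfolding dirichlet_energy_def by linarith
  qed
qed

lemma sobolev_pair_midpoint:
  assumes "sobolev_pair p \<Omega> u g" "sobolev_pair p \<Omega> v h"
  shows "sobolev_pair p \<Omega> (\<lambda>x. (1/2) * (u x + v x)) (\<lambda>x. (1/2) *\<^sub>R (g x + h x))"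
  by (rule sobolev_pair_cmult[OF sobolev_pair_add[OF p_pos assms]])

lemma dirichlet_energy_midpoint:
  assumes "sobolev_pair p D u g" "sobolev_pair p D v h"
  shows "dirichlet_energy (\<lambda>x. (1/2) * (u x + v x)) (\<lambda>x. (1/2) *\<^sub>R (g x + h x))
    = (dirichlet_energy u g + dirichlet_energy v h) / 2
      - ((Lp_energy p g + Lp_energy p h) / 2 - Lp_energy p (\<lambda>x. (1/2) *\<^sub>R (g x + h x))) / p"
proof -
  have fm: "f (\<lambda>x. (1/2) * (u x + v x)) = (1/2) * (f u + f v)"
    unfolding f_cmult[OF sobolev_pair_add[OF p_pos assms], of "1/2"] f_add[OF assms] ..
  show ?thesis unfolding dirichlet_energy_def fm using p_pos by (simp add: field_simps)
qed

lemma Lp_energy_midpoint_le: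
  assumes "g \<in> Lp_space p" "h \<in> Lp_space p"
  shows "Lp_energy p (\<lambda>x. (1/2) *\<^sub>R (g x + h x)) \<le> (Lp_energy p g + Lp_energy p h) / 2"
proof -
  have "Lp_energy p (\<lambda>x. (1/2) *\<^sub>R (g x + h x)) \<le> (LINT x|lebesgue. (norm (g x) powr p + norm (h x) powr p) / 2)"
    unfolding Lp_energy_def
    using Lp_spaceD(2)[OF Lp_space_cmult[OF Lp_space_add[OF p_pos assms], of "1/2"]] Lp_spaceD(2)[OF assms(1)] Lp_spaceD(2)[OF assms(2)]
    by (intro integral_mono norm_powr_midpoint_le p_gt_1) (auto simp del: norm_scaleR)
  then show ?thesis using Lp_spaceD(2)[OF assms(1)] Lp_spaceD(2)[OF assms(2)] by (simp add: Lp_energy_def)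
qed

lemma dirichlet_energy_midpoint_le:
  assumes "sobolev_pair p D u g" "sobolev_pair p D v h"
  shows "dirichlet_energy (\<lambda>x. (1/2) * (u x + v x)) (\<lambda>x. (1/2) *\<^sub>R (g x + h x))
    \<le> (dirichlet_energy u g + dirichlet_energy v h) / 2"
proof -
  have "((Lp_energy p g + Lp_energy p h) / 2 - Lp_energy p (\<lambda>x. (1/2) *\<^sub>R (g x + h x))) / p \<ge> 0"
    using Lp_energy_midpoint_le[OF assms[THEN sobolev_pair_Lp]] p_pos by simp
  then show ?thesis unfolding dirichlet_energy_midpoint[OF assms] by linarith
qed

text \<open>The tangent inequality at the limit h bounds the energies from below up to a pairing
  that tends to 0 under strong convergence, and f of the differences tends to 0 as well.\<close>

lemma dirichlet_energy_lsc:
  assumes u: "\<And>n. sobolev_pair p D (u n) (g n)" and v: "sobolev_pair p D v h"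
    and lim: "(\<lambda>n. Lp_energy p (\<lambda>x. g n x - h x)) \<longlonglongrightarrow> 0"
    and c: "\<And>n. dirichlet_energy (u n) (g n) \<le> c n" "c \<longlonglongrightarrow> c0"
  shows "dirichlet_energy v h \<le> c0"
proof -
  note gL = sobolev_pair_Lp[OF u] and hL = sobolev_pair_Lp[OF v]
  let ?A = "\<lambda>n. LINT x|lebesgue. dual_vector p (h x) \<bullet> (g n x - h x)"
  have A: "?A \<longlonglongrightarrow> 0" by (rule dual_pairing_tendsto_0[OF p_gt_1 hL order_refl Lp_space_diff[OF p_pos gL hL] lim])
  have B: "(\<lambda>n. f (\<lambda>x. u n x - v x)) \<longlonglongrightarrow> 0" by (rule f_tendsto_0[OF sobolev_pair_diff[OF p_pos u v] lim])
  have "dirichlet_energy v h \<le> c n - ?A n + f (\<lambda>x. u n x - v x)" for n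
  proof -
    have "(Lp_energy p h + p * ?A n) / p \<le> Lp_energy p (g n) / p"
      using Lp_energy_tangent[OF p_gt_1 hL gL, of n] p_pos by (simp add: divide_right_mono)
    then have "Lp_energy p h / p + ?A n \<le> Lp_energy p (g n) / p" using p_pos by (simp add: add_divide_distrib)
    then show ?thesis using c(1)[of n] f_diff[OF u v, of n] unfolding dirichlet_energy_def by linarith
  qed
  moreover have "(\<lambda>n. c n - ?A n + f (\<lambda>x. u n x - v x)) \<longlonglongrightarrow> c0 - 0 + 0" by (intro tendsto_intros c A B)
  ultimately have "dirichlet_energy v h \<le> c0 - 0 + 0" by (intro LIMSEQ_le_const) auto
  then show ?thesis by simp
qed

text \<open>This replaces weak compactness: elements of almost minimal energy form a Cauchy sequence by
  uniform convexity, since their midpoints stay in the sets.\<close>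

lemma nested_midpoint_convex:
  fixes P :: "nat \<Rightarrow> ('a \<Rightarrow> real) \<Rightarrow> ('a \<Rightarrow> 'a) \<Rightarrow> bool"
  assumes \<Omega>: "\<Omega> \<subseteq> D" and sob: "\<And>n u g. P n u g \<Longrightarrow> sobolev_pair p \<Omega> u g"
    and mono: "\<And>m n u g. n \<le> m \<Longrightarrow> P m u g \<Longrightarrow> P n u g"
    and mid: "\<And>n u g v h. P n u g \<Longrightarrow> P n v h \<Longrightarrow> P n (\<lambda>x. (1/2) * (u x + v x)) (\<lambda>x. (1/2) *\<^sub>R (g x + h x))"
    and bound: "\<And>n. \<exists>u g. P n u g \<and> Lp_energy p g \<le> B"
  obtains us gs v h where "\<And>n. P n (us n) (gs n)" "sobolev_pair p \<Omega> v h"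
    "(\<lambda>n. Lp_energy p (\<lambda>x. gs n x - h x)) \<longlonglongrightarrow> 0" "\<And>x. (\<lambda>n. us n x) \<longlonglongrightarrow> v x"
proof -
  define E where "E = (\<lambda>n. {Lp_energy p g | u g. P n u g})"
  \<comment> \<open>These infima increase with n, because the sets shrink, and are bounded by B;
    convergence to their limit L makes the midpoint deficits vanish.\<close>
  define d where "d = (\<lambda>n. Inf (E n))"
  have Ene: "E n \<noteq> {}" for n using bound[of n] by (auto simp: E_def)
  have Ebd: "bdd_below (E n)" for n by (rule bdd_belowI[of _ 0]) (auto simp: E_def Lp_energy_nonneg)
  have d_le: "d n \<le> Lp_energy p g" if "P n u g" for n u g
    unfolding d_def by (rule cInf_lower[OF _ Ebd]) (use that in \<open>auto simp: E_def\<close>)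
  have dB: "d n \<le> B" for n using bound[of n] d_le by (meson order_trans)
  have dmono: "d n \<le> d m" if "n \<le> m" for n m
    unfolding d_def by (rule cInf_superset_mono[OF Ene Ebd]) (use mono[OF that] in \<open>auto simp: E_def\<close>)
  have "\<exists>u g. P n u g \<and> Lp_energy p g < d n + inverse (real (Suc n))" for n
  proof -
    have "Inf (E n) < d n + inverse (real (Suc n))" by (simp add: d_def)
    then obtain e where "e \<in> E n" "e < d n + inverse (real (Suc n))" using cInf_lessD[OF Ene] by blast
    then show ?thesis by (auto simp: E_def)
  qed
  then obtain us gs where P: "\<And>n. P n (us n) (gs n)" and en: "\<And>n. Lp_energy p (gs n) < d n + inverse (real (Suc n))"
    by metis
  have inv1: "inverse (real (Suc n)) \<le> 1" for n by (simp add: inverse_le_1_iff)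
  have enB: "Lp_energy p (gs n) \<le> B + 1" for n using en[of n] dB[of n] inv1[of n] by linarith
  have B0: "B + 1 \<ge> 0" using enB[of 0] Lp_energy_nonneg[of p "gs 0"] by linarith
  have "convergent d"
  proof (rule Bseq_monoseq_convergent)
    have "\<bar>d n\<bar> \<le> max \<bar>d 0\<bar> \<bar>B\<bar>" for n using dmono[of 0 n] dB[of n] by linarith
    then show "Bseq d" by (intro BseqI'[of _ "max \<bar>d 0\<bar> \<bar>B\<bar>"]) simp
    show "monoseq d" using dmono by (intro incseq_imp_monoseq) (auto simp: incseq_def)
  qed
  then obtain L where L: "d \<longlonglongrightarrow> L" by (auto simp: convergent_def)
  have dL: "d n \<le> L" for n using dmono by (intro incseq_le[OF _ L]) (auto simp: incseq_def)
  have gL: "gs n \<in> Lp_space p" for n by (rule sobolev_pair_Lp[OF sob[OF P]])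
  have Cauchy: "\<exists>N. \<forall>m\<ge>N. \<forall>n\<ge>N. Lp_energy p (\<lambda>x. gs m x - gs n x) < e" if e: "e > 0" for e
  proof -
    \<comment> \<open>The two energies sum to at most 2 (B + 2), so the first term of the convexity
      estimate contributes at most e / 2.\<close>
    define e1 where "e1 = e / (4 * (B + 2))"
    have e1: "e1 > 0" using e B0 by (simp add: e1_def)
    obtain C where C: "C \<ge> 0" "\<And>g h :: 'a \<Rightarrow> 'a. g \<in> Lp_space p \<Longrightarrow> h \<in> Lp_space p \<Longrightarrow>
      Lp_energy p (\<lambda>x. g x - h x) \<le> e1 * (Lp_energy p g + Lp_energy p h)
      + C * ((Lp_energy p g + Lp_energy p h) / 2 - Lp_energy p (\<lambda>x. (1/2) *\<^sub>R (g x + h x)))"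
      using Lp_energy_uniformly_convex[OF p_gt_1 e1] by blast
    have "(\<lambda>N. C * (L - d N + inverse (real (Suc N)))) \<longlonglongrightarrow> C * (L - L + 0)"
      by (intro tendsto_intros L LIMSEQ_inverse_real_of_nat)
    then have "\<forall>\<^sub>F N in sequentially. C * (L - d N + inverse (real (Suc N))) < e / 2"
      using e by (intro order_tendstoD(2)) auto
    then obtain N where N: "C * (L - d N + inverse (real (Suc N))) < e / 2"
      using eventually_happens'[OF sequentially_bot] by blast
    have *: "Lp_energy p (\<lambda>x. gs m x - gs n x) < e" if mn: "n \<ge> N" "m \<ge> n" for m n
    proof -
      \<comment> \<open>The later element still lies in P n, hence so does the midpoint, whose
        energy is therefore at least d n.\<close>
      have "P n (us m) (gs m)" by (rule mono[OF mn(2) P])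
      then have "d n \<le> Lp_energy p (\<lambda>x. (1/2) *\<^sub>R (gs m x + gs n x))" by (intro d_le[OF mid[OF _ P]])
      moreover have "inverse (real (Suc m)) \<le> inverse (real (Suc N))" "inverse (real (Suc n)) \<le> inverse (real (Suc N))"
        using mn by (auto intro!: le_imp_inverse_le)
      ultimately have "(Lp_energy p (gs m) + Lp_energy p (gs n)) / 2 - Lp_energy p (\<lambda>x. (1/2) *\<^sub>R (gs m x + gs n x))
          \<le> L - d N + inverse (real (Suc N))"
        using en[of m] en[of n] dL[of m] dL[of n] dmono[OF mn(1)] by argo
      then have "C * ((Lp_energy p (gs m) + Lp_energy p (gs n)) / 2 - Lp_energy p (\<lambda>x. (1/2) *\<^sub>R (gs m x + gs n x)))
          \<le> C * (L - d N + inverse (real (Suc N)))" using C(1) by (rule mult_left_mono)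
      moreover have "e1 * (Lp_energy p (gs m) + Lp_energy p (gs n)) \<le> e1 * (2 * (B + 2))"
        using enB[of m] enB[of n] e1 by (intro mult_left_mono) auto
      moreover have "e1 * (2 * (B + 2)) = e / 2" using B0 by (simp add: e1_def field_simps)
      ultimately show ?thesis using C(2)[OF gL gL, of m n] N by linarith
    qed
    show ?thesis
    proof (intro exI allI impI)
      fix m n assume "m \<ge> N" "n \<ge> N"
      then show "Lp_energy p (\<lambda>x. gs m x - gs n x) < e"
        using *[of n m] *[of m n] Lp_energy_minus_commute[of p "gs m" "gs n"] by (cases "n \<le> m") auto
    qed
  qed
  obtain v h where "sobolev_pair p \<Omega> v h" "(\<lambda>n. Lp_energy p (\<lambda>x. gs n x - h x)) \<longlonglongrightarrow> 0" "\<And>x. (\<lambda>n. us n x) \<longlonglongrightarrow> v x"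
    using sobolev_pair_complete[where u = us and g = gs, OF \<Omega> sob[OF P] Cauchy] by blast
  then show ?thesis using that P by blast
qed

text \<open>The direct method: sublevel sets of the Dirichlet energy just above its infimum are
  decreasing and midpoint convex, and coercivity bounds the gradients in them.\<close>

lemma ex_minimizing_pair:
  assumes \<Omega>: "\<Omega> \<subseteq> D" obtains u g where "minimizing_pair \<Omega> u g"
proof -
  obtain K where K: "\<And>u g. sobolev_pair p D u g \<Longrightarrow> Lp_energy p g / (2 * p) - K \<le> dirichlet_energy u g"
    using dirichlet_energy_coercive by blast
  define X where "X = {dirichlet_energy u g | u g. sobolev_pair p \<Omega> u g}"
  define I where "I = Inf X"
  have Xne: "X \<noteq> {}" using sobolev_pair_zero[OF p_pos] by (auto simp: X_def)
  have Xb: "bdd_below X"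
  proof (rule bdd_belowI[of _ "- K"])
    fix y assume "y \<in> X"
    then obtain u g where u: "sobolev_pair p \<Omega> u g" and y: "y = dirichlet_energy u g" by (auto simp: X_def)
    have "Lp_energy p g / (2 * p) \<ge> 0" using p_pos by (simp add: Lp_energy_nonneg)
    then show "- K \<le> y" using K[OF sobolev_pair_mono[OF \<Omega> u]] y by linarith
  qed
  have I_le: "I \<le> dirichlet_energy u g" if "sobolev_pair p \<Omega> u g" for u g
    unfolding I_def by (rule cInf_lower[OF _ Xb]) (use that in \<open>auto simp: X_def\<close>)
  define P where "P = (\<lambda>n u g. sobolev_pair p \<Omega> u g \<and> dirichlet_energy u g \<le> I + inverse (real (Suc n)))"
  have "\<exists>us gs v h. (\<forall>n. P n (us n) (gs n)) \<and> sobolev_pair p \<Omega> v h \<and> (\<lambda>n. Lp_energy p (\<lambda>x. gs n x - h x)) \<longlonglongrightarrow> 0"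
  proof (rule nested_midpoint_convex[OF \<Omega>, of P "2 * p * (I + 1 + K)"])
    show "sobolev_pair p \<Omega> u g" if "P n u g" for n u g using that by (simp add: P_def)
    show "P n u g" if "n \<le> m" "P m u g" for m n u g
    proof -
      have "inverse (real (Suc m)) \<le> inverse (real (Suc n))" using that by (auto intro!: le_imp_inverse_le)
      then show ?thesis using that unfolding P_def by linarith
    qed
    show "P n (\<lambda>x. (1/2) * (u x + v x)) (\<lambda>x. (1/2) *\<^sub>R (g x + h x))" if "P n u g" "P n v h" for n u g v h
    proof -
      have 1: "sobolev_pair p \<Omega> u g" "sobolev_pair p \<Omega> v h" using that by (auto simp: P_def)
      show ?thesis
        using dirichlet_energy_midpoint_le[OF 1[THEN sobolev_pair_mono[OF \<Omega>]]] that sobolev_pair_midpoint[OF 1]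
        unfolding P_def by argo
    qed
    show "\<exists>u g. P n u g \<and> Lp_energy p g \<le> 2 * p * (I + 1 + K)" for n
    proof -
      have "Inf X < I + inverse (real (Suc n))" by (simp add: I_def)
      then obtain y where "y \<in> X" "y < I + inverse (real (Suc n))" using cInf_lessD[OF Xne] by blast
      then obtain u g where u: "sobolev_pair p \<Omega> u g" "dirichlet_energy u g < I + inverse (real (Suc n))" by (auto simp: X_def)
      moreover have "inverse (real (Suc n)) \<le> 1" by (simp add: inverse_le_1_iff)
      ultimately have "Lp_energy p g / (2 * p) \<le> I + 1 + K"
        using K[OF sobolev_pair_mono[OF \<Omega> u(1)]] by linarith
      then have "Lp_energy p g \<le> 2 * p * (I + 1 + K)" using p_pos by (simp add: pos_divide_le_eq mult.commute)
      then show ?thesis using u unfolding P_def by (metis less_imp_le)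
    qed
  qed blast
  then obtain us gs v h where P: "\<And>n. P n (us n) (gs n)" and v: "sobolev_pair p \<Omega> v h"
    and lim: "(\<lambda>n. Lp_energy p (\<lambda>x. gs n x - h x)) \<longlonglongrightarrow> 0" by blast
  have "dirichlet_energy v h \<le> I + 0"
  proof (rule dirichlet_energy_lsc[OF _ sobolev_pair_mono[OF \<Omega> v] lim])
    show "sobolev_pair p D (us n) (gs n)" for n using P[of n] sobolev_pair_mono[OF \<Omega>] by (auto simp: P_def)
    show "dirichlet_energy (us n) (gs n) \<le> I + inverse (real (Suc n))" for n using P[of n] by (simp add: P_def)
    show "(\<lambda>n. I + inverse (real (Suc n))) \<longlonglongrightarrow> I + 0" by (intro tendsto_intros LIMSEQ_inverse_real_of_nat)
  qed
  then have "minimizing_pair \<Omega> v h"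
    unfolding minimizing_pair_def using v I_le by force
  then show ?thesis by (rule that)
qed

section \<open>Uniqueness and the Euler-Lagrange equation\<close>

text \<open>For two minimizers the midpoint deficit cannot be positive, so uniform convexity makes
  the gradients agree almost everywhere; the sup bound then gives equality of the functions at every
  point.\<close>

lemma minimizing_pair_unique:
  assumes \<Omega>: "\<Omega> \<subseteq> D" and u: "minimizing_pair \<Omega> u g" and v: "minimizing_pair \<Omega> v h"
  shows "u = v"
proof -
  have uZ: "sobolev_pair p \<Omega> u g" and vZ: "sobolev_pair p \<Omega> v h" using u v by (auto simp: minimizing_pair_def)
  note uD = sobolev_pair_mono[OF \<Omega> uZ] and vD = sobolev_pair_mono[OF \<Omega> vZ]
  note gL = sobolev_pair_Lp[OF uZ] and hL = sobolev_pair_Lp[OF vZ]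
  let ?def = "(Lp_energy p g + Lp_energy p h) / 2 - Lp_energy p (\<lambda>x. (1/2) *\<^sub>R (g x + h x))"
  have "dirichlet_energy u g \<le> dirichlet_energy (\<lambda>x. (1/2) * (u x + v x)) (\<lambda>x. (1/2) *\<^sub>R (g x + h x))"
    "dirichlet_energy u g \<le> dirichlet_energy v h" "dirichlet_energy v h \<le> dirichlet_energy u g"
    using u v sobolev_pair_midpoint[OF uZ vZ] unfolding minimizing_pair_def by blast+
  moreover define X where "X = ?def / p"
  ultimately have "X \<le> 0" unfolding dirichlet_energy_midpoint[OF uD vD] X_def[symmetric] by argo
  then have "?def / p \<le> 0" by (simp only: X_def)
  then have def0: "?def \<le> 0" using p_pos by (simp add: divide_le_0_iff)
  have e0: "Lp_energy p (\<lambda>x. g x - h x) \<le> 0 + e" if e: "e > 0" for e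
  proof -
    define S where "S = Lp_energy p g + Lp_energy p h + 1"
    have S: "S > 0" using Lp_energy_nonneg[of p g] Lp_energy_nonneg[of p h] by (simp add: S_def)
    then have eS: "e / S > 0" using e by simp
    obtain C where C: "C \<ge> 0" "\<And>g h :: 'a \<Rightarrow> 'a. g \<in> Lp_space p \<Longrightarrow> h \<in> Lp_space p \<Longrightarrow>
      Lp_energy p (\<lambda>x. g x - h x) \<le> (e / S) * (Lp_energy p g + Lp_energy p h)
      + C * ((Lp_energy p g + Lp_energy p h) / 2 - Lp_energy p (\<lambda>x. (1/2) *\<^sub>R (g x + h x)))"
      using Lp_energy_uniformly_convex[OF p_gt_1 eS] by blast
    have "C * ?def \<le> 0" using C(1) def0 by (rule mult_nonneg_nonpos)
    moreover have "(e / S) * (Lp_energy p g + Lp_energy p h) \<le> (e / S) * S"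
      using e S by (intro mult_left_mono) (auto simp: S_def)
    moreover have "(e / S) * S = e" using S by simp
    ultimately show ?thesis using C(2)[OF gL hL] by linarith
  qed
  have "Lp_energy p (\<lambda>x. g x - h x) \<le> 0" by (rule field_le_epsilon[OF e0])
  then have 0: "Lp_energy p (\<lambda>x. g x - h x) = 0" using Lp_energy_nonneg[of p "\<lambda>x. g x - h x"] by linarith
  have "u x - v x = 0" for x
  proof (rule le_powr_imp_0[OF _ sup_constant_pos])
    fix M :: real assume "M > 0"
    then show "\<bar>u x - v x\<bar> \<le> sup_constant * M powr (1 / p)"
      using sobolev_pair_bounded[OF sobolev_pair_diff[OF p_pos uD vD], of M x] 0 by simp
  qed
  then show ?thesis by (auto simp: fun_eq_iff)
qed

text \<open>Sufficiency by convexity: the equation evaluates the linear term in the tangent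
  inequality at g.\<close>

lemma euler_lagrange_imp_minimizing_pair:
  assumes \<Omega>: "\<Omega> \<subseteq> D" and u: "sobolev_pair p \<Omega> u g"
    and el: "\<And>v h. sobolev_pair p \<Omega> v h \<Longrightarrow> (LINT x|lebesgue. dual_vector p (g x) \<bullet> h x) = f v"
  shows "minimizing_pair \<Omega> u g"
  unfolding minimizing_pair_def
proof (intro conjI allI impI u)
  fix v h assume v: "sobolev_pair p \<Omega> v h"
  note gL = sobolev_pair_Lp[OF u] and hL = sobolev_pair_Lp[OF v]
  have "(LINT x|lebesgue. dual_vector p (g x) \<bullet> (h x - g x)) = f (\<lambda>x. v x - u x)"
    by (rule el[OF sobolev_pair_diff[OF p_pos v u]])
  also have "\<dots> = f v - f u" by (rule f_diff[OF sobolev_pair_mono[OF \<Omega> v] sobolev_pair_mono[OF \<Omega> u]])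
  finally have "Lp_energy p g + p * (f v - f u) \<le> Lp_energy p h" using Lp_energy_tangent[OF p_gt_1 gL hL] by simp
  then have "(Lp_energy p g + p * (f v - f u)) / p \<le> Lp_energy p h / p" using p_pos by (simp add: divide_right_mono)
  then show "dirichlet_energy u g \<le> dirichlet_energy v h"
    using p_pos by (simp add: dirichlet_energy_def add_divide_distrib)
qed

text \<open>The energy is not differentiated at g; instead the tangent inequality is applied at the
  perturbed gradient g + t h. Together with minimality it bounds f v by the pairing at that
  gradient, and continuity of \<open>dual_vector\<close> lets t tend to 0.\<close>

lemma minimizing_pair_imp_euler_lagrange:
  assumes \<Omega>: "\<Omega> \<subseteq> D" and u: "minimizing_pair \<Omega> u g" and v: "sobolev_pair p \<Omega> v h"
  shows "(LINT x|lebesgue. dual_vector p (g x) \<bullet> h x) = f v"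
proof -
  have uZ: "sobolev_pair p \<Omega> u g" using u by (simp add: minimizing_pair_def)
  have le: "f v \<le> (LINT x|lebesgue. dual_vector p (g x) \<bullet> h x)" if v: "sobolev_pair p \<Omega> v h" for v h
  proof -
    note gL = sobolev_pair_Lp[OF uZ] and hL = sobolev_pair_Lp[OF v]
    define G where "G = (\<lambda>n x. g x + inverse (real (Suc n)) *\<^sub>R h x)"
    have GL: "G n \<in> Lp_space p" for n unfolding G_def by (rule Lp_space_add[OF p_pos gL Lp_space_cmult[OF hL]])
    have fle: "f v \<le> (LINT x|lebesgue. dual_vector p (G n x) \<bullet> h x)" for n
    proof -
      define t where "t = inverse (real (Suc n))"
      have t: "t > 0" by (simp add: t_def)
      have Z: "sobolev_pair p \<Omega> (\<lambda>x. u x + t * v x) (G n)"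
        unfolding G_def t_def[symmetric] by (rule sobolev_pair_add[OF p_pos uZ sobolev_pair_cmult[OF v]])
      have "f (\<lambda>x. u x + t * v x) = f u + t * f v"
        using f_add[OF sobolev_pair_mono[OF \<Omega> uZ] sobolev_pair_mono[OF \<Omega> sobolev_pair_cmult[OF v, of t]]]
          f_cmult[OF sobolev_pair_mono[OF \<Omega> v], of t] by simp
      then have 1: "Lp_energy p g / p + t * f v \<le> Lp_energy p (G n) / p"
        using u Z unfolding minimizing_pair_def dirichlet_energy_def by fastforce
      have "(LINT x|lebesgue. dual_vector p (G n x) \<bullet> (g x - G n x)) = (LINT x|lebesgue. - t * (dual_vector p (G n x) \<bullet> h x))"
        by (simp add: G_def t_def)
      also have "\<dots> = - t * (LINT x|lebesgue. dual_vector p (G n x) \<bullet> h x)" by simp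
      finally have "Lp_energy p (G n) + p * (- t * (LINT x|lebesgue. dual_vector p (G n x) \<bullet> h x)) \<le> Lp_energy p g"
        using Lp_energy_tangent[OF p_gt_1 GL gL, of n] by simp
      then have "(Lp_energy p (G n) + p * (- t * (LINT x|lebesgue. dual_vector p (G n x) \<bullet> h x))) / p \<le> Lp_energy p g / p"
        using p_pos by (simp add: divide_right_mono)
      then have "Lp_energy p (G n) / p - t * (LINT x|lebesgue. dual_vector p (G n x) \<bullet> h x) \<le> Lp_energy p g / p"
        using p_pos by (simp add: diff_divide_distrib)
      then have "t * f v \<le> t * (LINT x|lebesgue. dual_vector p (G n x) \<bullet> h x)" using 1 by linarith
      then show ?thesis using t by simp
    qed
    have "(\<lambda>n. LINT x|lebesgue. dual_vector p (G n x) \<bullet> h x) \<longlonglongrightarrow> (LINT x|lebesgue. dual_vector p (g x) \<bullet> h x)"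
    proof (rule integral_dominated_convergence)
      show "(\<lambda>x. dual_vector p (g x) \<bullet> h x) \<in> borel_measurable lebesgue"
        by (rule borel_measurable_integrable[OF integrable_dual_pairing[OF p_gt_1 gL hL]])
      show "(\<lambda>x. dual_vector p (G n x) \<bullet> h x) \<in> borel_measurable lebesgue" for n
        by (rule borel_measurable_integrable[OF integrable_dual_pairing[OF p_gt_1 GL hL]])
      show "integrable lebesgue (\<lambda>x. 2 powr p * (norm (g x) powr p + norm (h x) powr p) + norm (h x) powr p)"
        using Lp_spaceD(2)[OF gL] Lp_spaceD(2)[OF hL] by simp
      show "AE x in lebesgue. (\<lambda>n. dual_vector p (G n x) \<bullet> h x) \<longlonglongrightarrow> dual_vector p (g x) \<bullet> h x"
      proof (rule AE_I2)
        fix x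
        have "(\<lambda>n. G n x) \<longlonglongrightarrow> g x + 0 *\<^sub>R h x" unfolding G_def by (intro tendsto_intros LIMSEQ_inverse_real_of_nat)
        then have "(\<lambda>n. G n x) \<longlonglongrightarrow> g x" by simp
        moreover have "isCont (dual_vector p) (g x)"
          using continuous_on_dual_vector[OF p_gt_1, where 'a = 'a] by (simp add: continuous_on_eq_continuous_at)
        ultimately have "(\<lambda>n. dual_vector p (G n x)) \<longlonglongrightarrow> dual_vector p (g x)" by (rule isCont_tendsto_compose[rotated])
        then show "(\<lambda>n. dual_vector p (G n x) \<bullet> h x) \<longlonglongrightarrow> dual_vector p (g x) \<bullet> h x" by (intro tendsto_intros)
      qed
      show "AE x in lebesgue. norm (dual_vector p (G n x) \<bullet> h x)
          \<le> 2 powr p * (norm (g x) powr p + norm (h x) powr p) + norm (h x) powr p" for n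
      proof (rule AE_I2)
        fix x
        have "norm (dual_vector p (G n x) \<bullet> h x) \<le> norm (G n x) powr (p - 1) * norm (h x)"
          using Cauchy_Schwarz_ineq2[of "dual_vector p (G n x)" "h x"] by (simp add: norm_dual_vector)
        also have "\<dots> \<le> norm (G n x) powr p + norm (h x) powr p"
          using powr_mult_le[OF p_gt_1, of "norm (G n x)" "norm (h x)" 1] by simp
        also have "norm (G n x) powr p \<le> 2 powr p * (norm (g x) powr p + norm (inverse (real (Suc n)) *\<^sub>R h x) powr p)"
          unfolding G_def by (rule norm_add_powr_le[OF p_pos])
        also have "norm (inverse (real (Suc n)) *\<^sub>R h x) powr p \<le> norm (h x) powr p"
        proof (rule powr_mono2)
          have "inverse (real (Suc n)) * norm (h x) \<le> 1 * norm (h x)" by (intro mult_right_mono) (auto simp: inverse_le_1_iff)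
          then show "norm (inverse (real (Suc n)) *\<^sub>R h x) \<le> norm (h x)" by (simp del: of_nat_Suc)
        qed (use p_pos in auto)
        finally show "norm (dual_vector p (G n x) \<bullet> h x)
          \<le> 2 powr p * (norm (g x) powr p + norm (h x) powr p) + norm (h x) powr p" by simp
      qed
    qed
    then show ?thesis using fle by (intro LIMSEQ_le_const) auto
  qed
  \<comment> \<open>Testing with -v gives the reverse inequality.\<close>
  have "f (\<lambda>x. -1 * v x) \<le> (LINT x|lebesgue. dual_vector p (g x) \<bullet> (-1 *\<^sub>R h x))"
    by (rule le[OF sobolev_pair_cmult[OF v]])
  then have "- f v \<le> - (LINT x|lebesgue. dual_vector p (g x) \<bullet> h x)"
    using f_cmult[OF sobolev_pair_mono[OF \<Omega> v], of "-1"] by simp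
  then show ?thesis using le[OF v] by simp
qed

lemma p_Laplace_integral_eq:
  assumes \<Omega>: "open \<Omega>" "\<Omega> \<subseteq> D" and u: "sobolev_pair p \<Omega> u g" "AE x in lebesgue. u x = u' x"
    and v: "sobolev_pair p \<Omega> v h" "AE x in lebesgue. v x = v' x"
  shows "(LINT x|lebesgue_on \<Omega>. norm (weak_gradient \<Omega> u' x) powr (p - 2) * (weak_gradient \<Omega> u' x \<bullet> weak_gradient \<Omega> v' x))
    = (LINT x|lebesgue. dual_vector p (g x) \<bullet> h x)"
proof -
  have \<Omega>s: "\<Omega> \<in> sets lebesgue" using \<Omega> by (simp add: borel_open)
  note i = integrable_dual_pairing[OF p_gt_1 sobolev_pair_Lp[OF u(1)] sobolev_pair_Lp[OF v(1)]]
  have "AE x in lebesgue_on \<Omega>. dual_vector p (g x) \<bullet> h x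
      = norm (weak_gradient \<Omega> u' x) powr (p - 2) * (weak_gradient \<Omega> u' x \<bullet> weak_gradient \<Omega> v' x)"
    using sobolev_pair_weak_gradient[OF \<Omega> u] sobolev_pair_weak_gradient[OF \<Omega> v]
    by eventually_elim (simp add: dual_vector_def)
  from integral_lebesgue_on_cong_AE(1)[OF \<Omega>s measurable_restrict_space1[OF borel_measurable_integrable[OF i]] this]
  have "(LINT x|lebesgue_on \<Omega>. norm (weak_gradient \<Omega> u' x) powr (p - 2) * (weak_gradient \<Omega> u' x \<bullet> weak_gradient \<Omega> v' x))
    = (LINT x|lebesgue_on \<Omega>. dual_vector p (g x) \<bullet> h x)" by simp
  also have "\<dots> = (LINT x|lebesgue. dual_vector p (g x) \<bullet> h x)"
  proof (rule integral_lebesgue_on_eq[OF \<Omega>s borel_measurable_integrable[OF i]])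
    show "AE x in lebesgue. x \<notin> \<Omega> \<longrightarrow> dual_vector p (g x) \<bullet> h x = 0"
      using sobolev_pair_gradient_outside[OF p_pos \<Omega>s v(1)] by eventually_elim simp
  qed
  finally show ?thesis .
qed

text \<open>\<open>state_function\<close> is a choice, so first some weak solution must exist,
  namely the minimizer. The chosen function is then itself a weak solution and hence, by convexity,
  belongs to a minimizing pair.\<close>

lemma state_function_minimizing_pair:
  assumes \<Omega>: "open \<Omega>" "\<Omega> \<subseteq> D"
  obtains u g where "minimizing_pair \<Omega> u g" "AE x in lebesgue. u x = state_function p f \<Omega> x"
proof -
  obtain u0 g0 where u0: "minimizing_pair \<Omega> u0 g0" using ex_minimizing_pair[OF \<Omega>(2)] by blast
  have u0Z: "sobolev_pair p \<Omega> u0 g0" using u0 by (simp add: minimizing_pair_def)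
  have "p_Laplace_weak_solution p f \<Omega> u0"
    unfolding p_Laplace_weak_solution_def
  proof (intro conjI ballI)
    show "u0 \<in> W1p_0 p \<Omega>"
      by (rule sobolev_pair_W1p_0[OF \<Omega> u0Z]) (auto dest: sobolev_pair_outside[OF u0Z])
    fix v' assume "v' \<in> W1p_0 p \<Omega>"
    then obtain v h where v: "sobolev_pair p \<Omega> v h" "AE x in lebesgue. v x = v' x" "\<And>x. x \<notin> \<Omega> \<Longrightarrow> v' x = 0"
      using W1p_0_sobolev_pair[OF \<Omega>] by blast
    have "(LINT x|lebesgue_on \<Omega>. norm (weak_gradient \<Omega> u0 x) powr (p - 2) * (weak_gradient \<Omega> u0 x \<bullet> weak_gradient \<Omega> v' x))
      = (LINT x|lebesgue. dual_vector p (g0 x) \<bullet> h x)"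
      by (rule p_Laplace_integral_eq[OF \<Omega> u0Z _ v(1,2)]) simp
    also have "\<dots> = f v" by (rule minimizing_pair_imp_euler_lagrange[OF \<Omega>(2) u0 v(1)])
    also have "\<dots> = f v'" using v(3) \<Omega>(2) by (intro f_cong_AE[OF sobolev_pair_mono[OF \<Omega>(2) v(1)] v(2), symmetric]) auto
    finally show "(LINT x|lebesgue_on \<Omega>. norm (weak_gradient \<Omega> u0 x) powr (p - 2) * (weak_gradient \<Omega> u0 x \<bullet> weak_gradient \<Omega> v' x)) = f v'" .
  qed
  then have sol: "p_Laplace_weak_solution p f \<Omega> (state_function p f \<Omega>)"
    unfolding state_function_def by (rule someI[where P = "p_Laplace_weak_solution p f \<Omega>"])
  then have "state_function p f \<Omega> \<in> W1p_0 p \<Omega>" by (simp add: p_Laplace_weak_solution_def)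
  then obtain u g where u: "sobolev_pair p \<Omega> u g" "AE x in lebesgue. u x = state_function p f \<Omega> x"
    using W1p_0_sobolev_pair[OF \<Omega>] by blast
  have "minimizing_pair \<Omega> u g"
  proof (rule euler_lagrange_imp_minimizing_pair[OF \<Omega>(2) u(1)])
    fix v h assume v: "sobolev_pair p \<Omega> v h"
    have "v \<in> W1p_0 p \<Omega>" by (rule sobolev_pair_W1p_0[OF \<Omega> v]) (auto dest: sobolev_pair_outside[OF v])
    then have "(LINT x|lebesgue_on \<Omega>. norm (weak_gradient \<Omega> (state_function p f \<Omega>) x) powr (p - 2) *
        (weak_gradient \<Omega> (state_function p f \<Omega>) x \<bullet> weak_gradient \<Omega> v x)) = f v"
      using sol unfolding p_Laplace_weak_solution_def by blast
    moreover have "(LINT x|lebesgue_on \<Omega>. norm (weak_gradient \<Omega> (state_function p f \<Omega>) x) powr (p - 2) *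
        (weak_gradient \<Omega> (state_function p f \<Omega>) x \<bullet> weak_gradient \<Omega> v x)) = (LINT x|lebesgue. dual_vector p (g x) \<bullet> h x)"
      by (rule p_Laplace_integral_eq[OF \<Omega> u v]) simp
    ultimately show "(LINT x|lebesgue. dual_vector p (g x) \<bullet> h x) = f v" by simp
  qed
  then show ?thesis using that u(2) by blast
qed

end

section \<open>Compactness and existence of an optimal set\<close>

text \<open>The tangent inequality at g n, read towards h, gives the upper bound; its linear term is
  the vanishing correction a n.\<close>

lemma Lp_energy_upper_limit:
  assumes p: "p > 1" and g: "\<And>n. g n \<in> Lp_space p" and h: "h \<in> Lp_space p"
    and lim: "(\<lambda>n. Lp_energy p (\<lambda>x. g n x - h x)) \<longlonglongrightarrow> 0"
  obtains a where "a \<longlonglongrightarrow> 0" "\<And>n. Lp_energy p (g n) \<le> Lp_energy p h + a n"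
proof -
  have p0: "p > 0" using p by simp
  obtain B where B: "\<And>n. norm (Lp_energy p (\<lambda>x. g n x - h x)) \<le> B"
    using convergent_imp_Bseq[OF convergentI[OF lim]] unfolding Bseq_def by blast
  have gB: "Lp_energy p (g n) \<le> 2 powr p * (B + Lp_energy p h)" for n
  proof -
    have "Lp_energy p (g n) \<le> 2 powr p * (Lp_energy p (\<lambda>x. g n x - h x) + Lp_energy p h)"
      using Lp_energy_add_le[OF p0 Lp_space_diff[OF p0 g h] h, of n] by simp
    also have "\<dots> \<le> 2 powr p * (B + Lp_energy p h)"
      using B[of n] by (intro mult_left_mono add_right_mono) auto
    finally show ?thesis .
  qed
  have lim': "(\<lambda>n. Lp_energy p (\<lambda>x. h x - g n x)) \<longlonglongrightarrow> 0"
    using lim by (simp add: Lp_energy_minus_commute[of p h])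
  define a where "a = (\<lambda>n. - p * (LINT x|lebesgue. dual_vector p (g n x) \<bullet> (h x - g n x)))"
  have "a \<longlonglongrightarrow> - p * 0" unfolding a_def
    by (intro tendsto_intros dual_pairing_tendsto_0[OF p g gB Lp_space_diff[OF p0 h g] lim'])
  moreover have "Lp_energy p (g n) \<le> Lp_energy p h + a n" for n
    using Lp_energy_tangent[OF p g h, of n] by (simp add: a_def)
  ultimately show ?thesis using that[of a] by simp
qed

text \<open>Dyadic convex combinations of the members with index at least n, in the role that convex
  combinations have in Mazur's lemma. Upper bounds of convex functionals and closeness to a
  pointwise limit pass to them by induction.\<close>

inductive midpoint_hull :: "(nat \<Rightarrow> 'a \<Rightarrow> real) \<Rightarrow> (nat \<Rightarrow> 'a \<Rightarrow> 'b::real_vector) \<Rightarrow> nat \<Rightarrow> ('a \<Rightarrow> real) \<Rightarrow> ('a \<Rightarrow> 'b) \<Rightarrow> bool"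
  for us gs n where
    base: "n \<le> k \<Longrightarrow> midpoint_hull us gs n (us k) (gs k)"
  | midpoint: "midpoint_hull us gs n u g \<Longrightarrow> midpoint_hull us gs n v h \<Longrightarrow>
      midpoint_hull us gs n (\<lambda>x. (1/2) * (u x + v x)) (\<lambda>x. (1/2) *\<^sub>R (g x + h x))"

lemma midpoint_hull_mono:
  assumes "midpoint_hull us gs m u g" "n \<le> m" shows "midpoint_hull us gs n u g"
  using assms(1)
proof induction
  case (base k)
  then show ?case using assms(2) by (intro midpoint_hull.base) simp
next
  case (midpoint u g v h)
  show ?case by (rule midpoint_hull.midpoint[OF midpoint.IH])
qed

context sobolev_domain
begin

text \<open>An Arzela-Ascoli argument: a diagonal subsequence converges on a countable dense set,
  and the common Hoelder modulus extends this to all points and, by finite covers, to uniform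
  convergence on compact sets.\<close>

lemma sobolev_pair_compactness:
  fixes \<Omega> :: "nat \<Rightarrow> 'a set"
  assumes \<Omega>: "\<And>n. \<Omega> n \<subseteq> D" and u: "\<And>n. sobolev_pair p (\<Omega> n) (us n) (gs n)" and B: "\<And>n. Lp_energy p (gs n) \<le> B"
  obtains r u where "strict_mono r" "\<And>x. (\<lambda>n. us (r n) x) \<longlonglongrightarrow> u x"
    "\<And>K e. compact K \<Longrightarrow> e > 0 \<Longrightarrow> \<forall>\<^sub>F n in sequentially. \<forall>x\<in>K. \<bar>us (r n) x - u x\<bar> < e"
proof -
  define M where "M = 2 powr p * B + 1"
  have M: "2 powr p * Lp_energy p (gs n) < M" for n
  proof -
    have "2 powr p * Lp_energy p (gs n) \<le> 2 powr p * B" by (intro mult_left_mono B) simp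
    then show ?thesis unfolding M_def by linarith
  qed
  have "0 \<le> 2 powr p * Lp_energy p (gs 0)" by (simp add: Lp_energy_nonneg)
  then have M0: "M \<ge> 0" using M[of 0] by linarith
  have uD: "sobolev_pair p D (us n) (gs n)" for n by (rule sobolev_pair_mono[OF \<Omega> u])
  obtain Q :: "'a set" where Q: "countable Q" "\<And>X. open X \<Longrightarrow> X \<noteq> {} \<Longrightarrow> \<exists>d\<in>Q. d \<in> X"
    using countable_dense_setE by blast
  have "norm (us n x) \<le> sup_constant * M powr (1 / p)" for n x
    using sobolev_pair_bounded[OF uD M] by simp
  then obtain r where r: "strict_mono r" "\<And>x. x \<in> Q \<Longrightarrow> \<exists>l. (\<lambda>n. us (r n) x) \<longlonglongrightarrow> l"
    using function_convergent_subsequence[OF Q(1), of us "sup_constant * M powr (1 / p)"] by metis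
  have mod: "\<exists>\<delta>>0. \<forall>n x y. norm (x - y) < \<delta> \<longrightarrow> \<bar>us n x - us n y\<bar> < e" if e: "e > 0" for e
  proof -
    obtain \<delta> where \<delta>: "\<delta> > 0" "\<And>x y :: 'a. norm (x - y) < \<delta> \<Longrightarrow> morrey_constant * norm (x - y) powr holder_exponent * M powr (1 / p) < e"
      using holder_modulus[OF e M0] by blast
    then show ?thesis using sobolev_pair_holder[OF u M] by (meson le_less_trans)
  qed
  have "Cauchy (\<lambda>n. us (r n) x)" for x
  proof (rule metric_CauchyI)
    fix e :: real assume e: "e > 0"
    then obtain \<delta> where \<delta>: "\<delta> > 0" "\<And>n x y. norm (x - y) < \<delta> \<Longrightarrow> \<bar>us n x - us n y\<bar> < e / 3"
      using mod[of "e / 3"] by auto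
    obtain q where q: "q \<in> Q" "q \<in> ball x \<delta>" using Q(2)[of "ball x \<delta>"] \<delta>(1) by auto
    then have "norm (x - q) < \<delta>" by (simp add: dist_norm)
    then have xq: "\<bar>us n x - us n q\<bar> < e / 3" for n by (rule \<delta>(2))
    have "Cauchy (\<lambda>n. us (r n) q)" using r(2)[OF q(1)] LIMSEQ_imp_Cauchy by blast
    then obtain N where N: "\<And>m n. m \<ge> N \<Longrightarrow> n \<ge> N \<Longrightarrow> dist (us (r m) q) (us (r n) q) < e / 3"
      using e metric_CauchyD[of "\<lambda>n. us (r n) q" "e / 3"] by auto
    have "dist (us (r m) x) (us (r n) x) < e" if "m \<ge> N" "n \<ge> N" for m n
      using N[OF that] xq[of "r m"] xq[of "r n"] unfolding dist_real_def by linarith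
    then show "\<exists>N. \<forall>m\<ge>N. \<forall>n\<ge>N. dist (us (r m) x) (us (r n) x) < e" by blast
  qed
  then obtain u where lim: "\<And>x. (\<lambda>n. us (r n) x) \<longlonglongrightarrow> u x"
    unfolding Cauchy_convergent_iff convergent_def by metis
  show ?thesis
  proof (rule that[OF r(1) lim])
    fix K :: "'a set" and e :: real assume K: "compact K" and e: "e > 0"
    then obtain \<delta> where \<delta>: "\<delta> > 0" "\<And>n x y. norm (x - y) < \<delta> \<Longrightarrow> \<bar>us n x - us n y\<bar> < e / 4"
      using mod[of "e / 4"] by auto
    obtain F where F: "finite F" "K \<subseteq> (\<Union>x\<in>F. ball x \<delta>)"
      using compact_imp_seq_compact[OF K] seq_compact_imp_totally_bounded \<delta>(1) by metis
    have "\<forall>\<^sub>F n in sequentially. \<bar>us (r n) c - u c\<bar> < e / 4" for c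
      using tendstoD[OF lim, of "e / 4" c] e by (simp add: dist_real_def)
    then have "\<forall>\<^sub>F n in sequentially. \<forall>c\<in>F. \<bar>us (r n) c - u c\<bar> < e / 4"
      using F(1) by (simp add: eventually_ball_finite)
    then show "\<forall>\<^sub>F n in sequentially. \<forall>x\<in>K. \<bar>us (r n) x - u x\<bar> < e"
    proof eventually_elim
      case (elim n)
      show ?case
      proof
        fix x assume "x \<in> K"
        then obtain c where c: "c \<in> F" "norm (x - c) < \<delta>" using F(2) by (auto simp: dist_norm norm_minus_commute)
        have "(\<lambda>k. \<bar>us (r k) x - us (r k) c\<bar>) \<longlonglongrightarrow> \<bar>u x - u c\<bar>" by (intro tendsto_intros lim)
        then have "\<bar>u x - u c\<bar> \<le> e / 4"
          using \<delta>(2)[OF c(2)] by (intro LIMSEQ_le_const2) (auto intro: less_imp_le)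
        moreover have "\<bar>us (r n) x - us (r n) c\<bar> < e / 4" by (rule \<delta>(2)[OF c(2)])
        moreover have "\<bar>us (r n) c - u c\<bar> < e / 4" using elim c(1) by blast
        ultimately show "\<bar>us (r n) x - u x\<bar> < e" using e by linarith
      qed
    qed
  qed
qed

end

context p_Laplace_problem
begin

lemma dirichlet_energy_zero: "dirichlet_energy (\<lambda>x. 0) (\<lambda>x. 0) = 0"
  using f_cmult[OF sobolev_pair_zero[OF p_pos], of 0] by (simp add: dirichlet_energy_def Lp_energy_zero)

text \<open>The zero function is admissible for every \<Omega>, so minimizers have Dirichlet energy
  at most 0; coercivity on D makes the resulting bound uniform.\<close>

lemma minimizing_pair_energy_bounded:
  obtains B where "\<And>\<Omega> u g. \<Omega> \<subseteq> D \<Longrightarrow> minimizing_pair \<Omega> u g \<Longrightarrow> Lp_energy p g \<le> B"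
proof -
  obtain K where K: "\<And>u g. sobolev_pair p D u g \<Longrightarrow> Lp_energy p g / (2 * p) - K \<le> dirichlet_energy u g"
    using dirichlet_energy_coercive by blast
  show ?thesis
  proof (rule that[of "2 * p * K"])
    fix \<Omega> u g assume \<Omega>: "\<Omega> \<subseteq> D" and u: "minimizing_pair \<Omega> u g"
    then have "sobolev_pair p D u g" using sobolev_pair_mono by (auto simp: minimizing_pair_def)
    moreover have "dirichlet_energy u g \<le> 0"
      using u sobolev_pair_zero[OF p_pos, of \<Omega>] dirichlet_energy_zero unfolding minimizing_pair_def by metis
    ultimately have "Lp_energy p g / (2 * p) \<le> K" using K[of u g] by linarith
    then show "Lp_energy p g \<le> 2 * p * K" using p_pos by (simp add: pos_divide_le_eq mult.commute)
  qed
qed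

text \<open>The gradients gs n need not converge, so a gradient for u is found through the midpoint
  hulls of the tails, whose members also converge to u pointwise. The resulting pair is a pair over
  D only; passing to {u \<noteq> 0} is the purpose of the truncation.\<close>

lemma minimizing_pair_limit:
  assumes \<Omega>: "\<And>n. \<Omega> n \<subseteq> D" and u: "\<And>n. minimizing_pair (\<Omega> n) (us n) (gs n)"
    and lim: "\<And>x. (\<lambda>n. us n x) \<longlonglongrightarrow> u x"
    and unif: "\<And>K e. compact K \<Longrightarrow> e > 0 \<Longrightarrow> \<forall>\<^sub>F n in sequentially. \<forall>x\<in>K. \<bar>us n x - u x\<bar> < e"
  obtains h where "minimizing_pair {x. u x \<noteq> 0} u h"
proof -
  have uZ: "sobolev_pair p (\<Omega> n) (us n) (gs n)" for n using u by (simp add: minimizing_pair_def)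
  have uD: "sobolev_pair p D (us n) (gs n)" for n by (rule sobolev_pair_mono[OF \<Omega> uZ])
  obtain B where B: "\<And>\<Omega> u g. \<Omega> \<subseteq> D \<Longrightarrow> minimizing_pair \<Omega> u g \<Longrightarrow> Lp_energy p g \<le> B"
    using minimizing_pair_energy_bounded by blast
  have hullD: "sobolev_pair p D v h" if "midpoint_hull us gs n v h" for n v h
    using that
  proof induction
    case (midpoint u g v h)
    show ?case by (rule sobolev_pair_midpoint[OF midpoint.IH])
  qed (rule uD)
  have "\<exists>vs hs v h. (\<forall>n. midpoint_hull us gs n (vs n) (hs n)) \<and> sobolev_pair p D v h \<and>
      (\<lambda>n. Lp_energy p (\<lambda>x. hs n x - h x)) \<longlonglongrightarrow> 0 \<and> (\<forall>x. (\<lambda>n. vs n x) \<longlonglongrightarrow> v x)"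
  proof (rule nested_midpoint_convex[OF order_refl, of "midpoint_hull us gs" B])
    show "\<exists>u g. midpoint_hull us gs n u g \<and> Lp_energy p g \<le> B" for n
      using midpoint_hull.base[of n n us gs] B[OF \<Omega> u] by blast
  qed (blast intro: hullD midpoint_hull_mono midpoint_hull.midpoint)+
  then obtain vs hs v h where hull: "\<And>n. midpoint_hull us gs n (vs n) (hs n)" and vh: "sobolev_pair p D v h"
    and hlim: "(\<lambda>n. Lp_energy p (\<lambda>x. hs n x - h x)) \<longlonglongrightarrow> 0" and vlim: "\<And>x. (\<lambda>n. vs n x) \<longlonglongrightarrow> v x" by blast
  have "(\<lambda>n. vs n x) \<longlonglongrightarrow> u x" for x
  proof (rule LIMSEQ_I)
    fix e :: real assume "e > 0"
    then obtain N where N: "\<And>k. k \<ge> N \<Longrightarrow> \<bar>us k x - u x\<bar> < e" using LIMSEQ_D[OF lim] by (metis real_norm_def)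
    \<comment> \<open>Intervals are convex, so the estimate for all k \<ge> N extends to the whole
      hull.\<close>
    have hN: "\<bar>w x - u x\<bar> < e" if "midpoint_hull us gs n w k" "n \<ge> N" for n w k
      using that
    proof (induction rule: midpoint_hull.induct)
      case (midpoint u' g v' h)
      then have "\<bar>u' x - u x\<bar> < e" "\<bar>v' x - u x\<bar> < e" by auto
      then show ?case unfolding abs_less_iff by argo
    qed (use N in auto)
    show "\<exists>no. \<forall>n\<ge>no. norm (vs n x - u x) < e" using hN[OF hull] by auto
  qed
  then have "v = u" using vlim LIMSEQ_unique by blast
  with vh have uh: "sobolev_pair p D u h" by simp
  let ?P = "{x. u x \<noteq> 0}"
  have PD: "?P \<subseteq> D" using sobolev_pair_outside[OF uh] by blast
  have le_test: "dirichlet_energy u h \<le> dirichlet_energy \<phi> (grad \<phi>)" if \<phi>: "\<phi> \<in> test_functions ?P" for \<phi>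
  proof -
    obtain K where K: "smooth \<phi>" "compact K" "K \<subseteq> ?P" "\<And>x. x \<notin> K \<Longrightarrow> \<phi> x = 0"
      using \<phi> unfolding test_functions_iff by blast
    \<comment> \<open>On the compact set K the continuous |u| has a positive minimum; once us n is
      closer to u than that, it cannot vanish on K, so K lies in \<Omega> n.\<close>
    have "\<exists>\<delta>>0. \<forall>x\<in>K. \<delta> \<le> \<bar>u x\<bar>"
    proof (cases "K = {}")
      case False
      have "continuous_on K (\<lambda>x. \<bar>u x\<bar>)"
        using continuous_on_subset[OF sobolev_pair_continuous[OF uh]] by (intro continuous_intros) auto
      then obtain x where x: "x \<in> K" "\<And>y. y \<in> K \<Longrightarrow> \<bar>u x\<bar> \<le> \<bar>u y\<bar>"
        using continuous_attains_inf[OF K(2) False, of "\<lambda>x. \<bar>u x\<bar>"] by blast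
      then show ?thesis using K(3) by (intro exI[of _ "\<bar>u x\<bar>"]) auto
    qed (auto intro: exI[of _ 1])
    then obtain \<delta> where \<delta>: "\<delta> > 0" "\<And>x. x \<in> K \<Longrightarrow> \<delta> \<le> \<bar>u x\<bar>" by blast
    obtain N where N: "\<And>n x. n \<ge> N \<Longrightarrow> x \<in> K \<Longrightarrow> \<bar>us n x - u x\<bar> < \<delta>"
      using unif[OF K(2) \<delta>(1)] unfolding eventually_sequentially by blast
    have le: "dirichlet_energy (us n) (gs n) \<le> dirichlet_energy \<phi> (grad \<phi>)" if n: "n \<ge> N" for n
    proof -
      have "K \<subseteq> \<Omega> n"
      proof
        fix x assume x: "x \<in> K"
        then have "us n x \<noteq> 0" using N[OF n x] \<delta>(2)[OF x] by auto
        then show "x \<in> \<Omega> n" using sobolev_pair_outside[OF uZ] by blast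
      qed
      then have "\<phi> \<in> test_functions (\<Omega> n)" using K unfolding test_functions_iff by blast
      then show ?thesis using u[of n] sobolev_pair_test_function[OF _ p_pos] unfolding minimizing_pair_def by blast
    qed
    have hle: "dirichlet_energy w k \<le> dirichlet_energy \<phi> (grad \<phi>)" if "midpoint_hull us gs n w k" "n \<ge> N" for n w k
      using that
    proof (induction rule: midpoint_hull.induct)
      case (midpoint u' g v' h)
      then have "dirichlet_energy u' g \<le> dirichlet_energy \<phi> (grad \<phi>)" "dirichlet_energy v' h \<le> dirichlet_energy \<phi> (grad \<phi>)" by auto
      then show ?case using dirichlet_energy_midpoint_le[OF hullD[OF midpoint(1)] hullD[OF midpoint(2)]] by argo
    qed (use le in auto)
    show ?thesis
    proof (rule dirichlet_energy_lsc[OF _ uh])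
      show "sobolev_pair p D (vs (n + N)) (hs (n + N))" for n by (rule hullD[OF hull])
      show "(\<lambda>n. Lp_energy p (\<lambda>x. hs (n + N) x - h x)) \<longlonglongrightarrow> 0" by (rule LIMSEQ_ignore_initial_segment[OF hlim])
      show "dirichlet_energy (vs (n + N)) (hs (n + N)) \<le> dirichlet_energy \<phi> (grad \<phi>)" for n
        by (rule hle[OF hull]) simp
    qed (rule tendsto_const)
  qed
  \<comment> \<open>The pair with h is not known to be admissible on {u \<noteq> 0}. The one with k
    is, and its energy is not larger, so the comparison with test functions carries over.\<close>
  obtain k where k: "sobolev_pair p ?P u k" "Lp_energy p k \<le> Lp_energy p h"
    using sobolev_pair_nonzero_set[OF uh] by blast
  have "minimizing_pair ?P u k"
    unfolding minimizing_pair_def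
  proof (intro conjI allI impI k(1))
    fix w l assume w: "sobolev_pair p ?P w l"
    obtain \<phi> where \<phi>: "l \<in> Lp_space p" "\<And>n. \<phi> n \<in> test_functions ?P" "\<And>x. (\<lambda>n. \<phi> n x) \<longlonglongrightarrow> w x"
      "(\<lambda>n. Lp_energy p (\<lambda>x. grad (\<phi> n) x - l x)) \<longlonglongrightarrow> 0"
      using sobolev_pairE[OF w] by blast
    have \<phi>Z: "sobolev_pair p D (\<phi> n) (grad (\<phi> n))" for n
      by (rule sobolev_pair_mono[OF PD sobolev_pair_test_function[OF \<phi>(2) p_pos]])
    have wD: "sobolev_pair p D w l" by (rule sobolev_pair_mono[OF PD w])
    \<comment> \<open>General competitors are reached from test functions; the corrections a n and
      f(\<phi> n - w) disappear in the limit.\<close>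
    obtain a where a: "a \<longlonglongrightarrow> 0" "\<And>n. Lp_energy p (grad (\<phi> n)) \<le> Lp_energy p l + a n"
      using Lp_energy_upper_limit[OF p_gt_1 grad_test_function_Lp[OF \<phi>(2) p_pos] \<phi>(1,4)] by blast
    have f0: "(\<lambda>n. f (\<lambda>x. \<phi> n x - w x)) \<longlonglongrightarrow> 0" by (rule f_tendsto_0[OF sobolev_pair_diff[OF p_pos \<phi>Z wD] \<phi>(4)])
    have "dirichlet_energy u k \<le> (Lp_energy p l + a n) / p - f w - f (\<lambda>x. \<phi> n x - w x)" for n
    proof -
      have "Lp_energy p (grad (\<phi> n)) / p \<le> (Lp_energy p l + a n) / p" using a(2)[of n] p_pos by (simp add: divide_right_mono)
      moreover have "Lp_energy p k / p \<le> Lp_energy p h / p" using k(2) p_pos by (simp add: divide_right_mono)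
      ultimately show ?thesis using le_test[OF \<phi>(2), of n] f_diff[OF \<phi>Z wD, of n] unfolding dirichlet_energy_def by linarith
    qed
    moreover have "(\<lambda>n. (Lp_energy p l + a n) / p - f w - f (\<lambda>x. \<phi> n x - w x)) \<longlonglongrightarrow> (Lp_energy p l + 0) / p - f w - 0"
      using p_pos by (intro tendsto_intros a(1) f0) auto
    ultimately have "dirichlet_energy u k \<le> (Lp_energy p l + 0) / p - f w - 0" by (intro LIMSEQ_le_const) auto
    then show "dirichlet_energy u k \<le> dirichlet_energy w l" by (simp add: dirichlet_energy_def)
  qed
  then show ?thesis by (rule that)
qed

end

section \<open>Lower semicontinuity of the cost and of the measure\<close>

text \<open>Adding a turns the cost into one integral of an almost everywhere nonnegative function
  minus a number. The pointwise identity is (J + a) + J^- + a^- = J^+ + a^+, where only the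
  integrals of J + a and of J^+ can be infinite.\<close>

lemma ennreal_integral_decomposition:
  fixes J a :: "'a \<Rightarrow> real"
  assumes J: "J \<in> borel_measurable M" and a: "integrable M a" and le: "AE x in M. - a x \<le> J x"
  shows "enn2ereal (\<integral>\<^sup>+x. ennreal (J x) \<partial>M) - enn2ereal (\<integral>\<^sup>+x. ennreal (- J x) \<partial>M)
    = enn2ereal (\<integral>\<^sup>+x. ennreal (J x + a x) \<partial>M) - ereal (integral\<^sup>L M a)"
proof -
  note [measurable] = J borel_measurable_integrable[OF a]
  let ?A = "\<integral>\<^sup>+x. ennreal (J x + a x) \<partial>M" and ?B = "\<integral>\<^sup>+x. ennreal (- J x) \<partial>M" and ?C = "\<integral>\<^sup>+x. ennreal (- a x) \<partial>M"
    and ?P = "\<integral>\<^sup>+x. ennreal (J x) \<partial>M" and ?Q = "\<integral>\<^sup>+x. ennreal (a x) \<partial>M"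
  have Q: "?Q \<noteq> \<infinity>" "?C \<noteq> \<infinity>" using a by (auto simp: real_integrable_def)
  have "?B \<le> ?Q" using le by (intro nn_integral_mono_AE) (auto elim!: eventually_mono intro!: ennreal_leI)
  then have B: "?B \<noteq> \<infinity>" using Q(1) by (auto simp: top_unique)
  have "?A + (?B + ?C) = (\<integral>\<^sup>+x. ennreal (J x + a x) + (ennreal (- J x) + ennreal (- a x)) \<partial>M)"
    by (simp add: nn_integral_add)
  also have "\<dots> = (\<integral>\<^sup>+x. ennreal (J x) + ennreal (a x) \<partial>M)"
  proof (rule nn_integral_cong_AE)
    have pos: "ennreal y = ennreal (max 0 y)" for y by (simp add: max_def ennreal_neg)
    have plus: "ennreal (max 0 y + max 0 z) = ennreal y + ennreal z" for y z
      unfolding pos[of y] pos[of z] by (rule ennreal_plus) auto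
    show "AE x in M. ennreal (J x + a x) + (ennreal (- J x) + ennreal (- a x)) = ennreal (J x) + ennreal (a x)"
      using le
    proof eventually_elim
      case (elim x)
      have "ennreal (J x + a x) + (ennreal (- J x) + ennreal (- a x)) = ennreal ((J x + a x) + (max 0 (- J x) + max 0 (- a x)))"
        unfolding plus[of "- J x" "- a x", symmetric] using elim by (intro ennreal_plus[symmetric]) auto
      also have "(J x + a x) + (max 0 (- J x) + max 0 (- a x)) = max 0 (J x) + max 0 (a x)" by (simp add: max_def)
      also have "ennreal \<dots> = ennreal (J x) + ennreal (a x)" by (rule plus)
      finally show ?case .
    qed
  qed
  also have "\<dots> = ?P + ?Q" by (simp add: nn_integral_add)
  finally have eq: "?A + (?B + ?C) = ?P + ?Q" .
  obtain b c q where bcq: "?B = ennreal b" "b \<ge> 0" "?C = ennreal c" "c \<ge> 0" "?Q = ennreal q" "q \<ge> 0"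
    using B Q by (metis ennreal_cases infinity_ennreal_def)
  have int: "integral\<^sup>L M a = q - c"
    using real_lebesgue_integral_def[OF a] bcq by simp
  show ?thesis
  proof (cases ?A)
    case (real r)
    then have "?P + ?Q = ennreal (r + (b + c))" using eq bcq by (simp add: ennreal_plus)
    then have "?P \<noteq> \<infinity>" by auto
    then obtain s where s: "?P = ennreal s" "s \<ge> 0" by (metis ennreal_cases infinity_ennreal_def)
    then have "ennreal (s + q) = ennreal (r + (b + c))" using \<open>?P + ?Q = ennreal (r + (b + c))\<close> bcq by (simp add: ennreal_plus)
    then have "s + q = r + (b + c)" using s real bcq by (subst (asm) ennreal_inj) auto
    then show ?thesis using real s bcq int by simp
  next
    case top
    then have "?P = top" using eq bcq by (metis ennreal_add_eq_top ennreal_neq_top infinity_ennreal_def)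
    then show ?thesis using top bcq int by simp
  qed
qed

text \<open>Every y below the left side is a nonnegative real r, and r - c is a strict lower bound
  of \<psi> near l.\<close>

lemma lower_semicontinuous_le_liminf:
  assumes "lower_semicontinuous \<psi>" "s \<longlonglongrightarrow> l"
  shows "ennreal (\<psi> l + c) \<le> liminf (\<lambda>n. ennreal (\<psi> (s n) + c))"
  unfolding le_Liminf_iff
proof (intro allI impI)
  fix y assume y: "y < ennreal (\<psi> l + c)"
  then obtain r where r: "y = ennreal r" "r \<ge> 0" by (cases y) auto
  with y have "r < \<psi> l + c" by (metis ennreal_leI not_less)
  then have "r - c < \<psi> l" by simp
  then have "\<forall>\<^sub>F t in nhds l. r - c < \<psi> t" using assms(1) by (simp add: lower_semicontinuous_def)
  then have "\<forall>\<^sub>F n in sequentially. r - c < \<psi> (s n)" using assms(2) by (rule eventually_compose_filterlim)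
  then show "\<forall>\<^sub>F n in sequentially. y < ennreal (\<psi> (s n) + c)"
    by eventually_elim (use r in \<open>auto intro!: ennreal_lessI\<close>)
qed

lemma cost_cong_AE:
  assumes "AE x in lebesgue_on D. u x = v x" shows "cost D j u = cost D j v"
proof -
  have "(\<integral>\<^sup>+x. ennreal (j x (u x)) \<partial>lebesgue_on D) = (\<integral>\<^sup>+x. ennreal (j x (v x)) \<partial>lebesgue_on D)"
    "(\<integral>\<^sup>+x. ennreal (- j x (u x)) \<partial>lebesgue_on D) = (\<integral>\<^sup>+x. ennreal (- j x (v x)) \<partial>lebesgue_on D)"
    using assms by (auto intro!: nn_integral_cong_AE elim!: eventually_mono)
  then show ?thesis by (simp add: cost_def)
qed

text \<open>One sup bound M for the whole sequence lets a single a make all integrands nonnegative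
  almost everywhere, so the cost becomes an integral to which Fatou's lemma applies.\<close>

lemma cost_lower_semicontinuous:
  fixes u :: "'a::euclidean_space \<Rightarrow> real"
  assumes j: "integrand_on D j" "\<And>x. x \<in> D \<Longrightarrow> lower_semicontinuous (j x)"
    and a: "integrable (lebesgue_on D) a" "AE x in lebesgue_on D. \<forall>s. \<bar>s\<bar> \<le> M \<longrightarrow> - a x \<le> j x s"
    and u: "\<And>n. us n \<in> borel_measurable lebesgue" "\<And>n x. \<bar>us n x\<bar> \<le> M" "\<And>x. (\<lambda>n. us n x) \<longlonglongrightarrow> u x"
    and c: "\<And>n. cost D j (us n) = c n" "c \<longlonglongrightarrow> c0"
  shows "cost D j u \<le> c0"
proof -
  have jm: "(\<lambda>x. j x (v x)) \<in> borel_measurable (lebesgue_on D)" if "v \<in> borel_measurable lebesgue" for v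
  proof -
    have "(\<lambda>x. (x, v x)) \<in> lebesgue_on D \<rightarrow>\<^sub>M lebesgue_on D \<Otimes>\<^sub>M borel"
      by (rule measurable_Pair[OF measurable_ident_sets[OF refl] measurable_restrict_space1[OF that]])
    from measurable_compose[OF this j(1)[unfolded integrand_on_def]] show ?thesis by simp
  qed
  have um: "u \<in> borel_measurable lebesgue" by (rule borel_measurable_LIMSEQ_metric[OF u(1,3)])
  have uM: "\<bar>u x\<bar> \<le> M" for x
    using tendsto_rabs[OF u(3)[of x]] u(2)[of _ x] by (intro LIMSEQ_le_const2) auto
  let ?E = "\<lambda>v. \<integral>\<^sup>+x. ennreal (j x (v x) + a x) \<partial>lebesgue_on D"
  have cost_eq: "cost D j v = enn2ereal (?E v) - ereal (integral\<^sup>L (lebesgue_on D) a)"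
    if "v \<in> borel_measurable lebesgue" "\<And>x. \<bar>v x\<bar> \<le> M" for v
    unfolding cost_def
    by (rule ennreal_integral_decomposition[OF jm[OF that(1)] a(1)])
      (use a(2) that(2) in \<open>auto elim!: eventually_mono\<close>)
  let ?I = "integral\<^sup>L (lebesgue_on D) a"
  have "?E u \<le> (\<integral>\<^sup>+x. liminf (\<lambda>n. ennreal (j x (us n x) + a x)) \<partial>lebesgue_on D)"
    by (intro nn_integral_mono lower_semicontinuous_le_liminf[OF j(2) u(3)]) (auto simp: space_restrict_space)
  also have "\<dots> \<le> liminf (\<lambda>n. ?E (us n))"
  proof (rule nn_integral_liminf)
    show "(\<lambda>x. ennreal (j x (us n x) + a x)) \<in> borel_measurable (lebesgue_on D)" for n
      using jm[OF u(1)[of n]] borel_measurable_integrable[OF a(1)] by measurable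
  qed
  finally have E: "?E u \<le> liminf (\<lambda>n. ?E (us n))" .
  show ?thesis
  \<comment> \<open>Comparing with every y above c0 avoids subtracting limits in the extended reals,
    where c0 may be infinite.\<close>
  proof (rule dense_ge)
    fix y assume y: "c0 < y"
    have "\<forall>\<^sub>F n in sequentially. c n < y" using c(2) y by (rule order_tendstoD)
    then have ev: "\<forall>\<^sub>F n in sequentially. enn2ereal (?E (us n)) \<le> y + ereal ?I"
    proof eventually_elim
      case (elim n)
      then have "enn2ereal (?E (us n)) - ereal ?I \<le> y"
        using cost_eq[OF u(1,2), of n] c(1)[of n] by simp
      then show ?case by (simp add: ereal_minus_le)
    qed
    have "enn2ereal (?E u) \<le> y + ereal ?I"
    proof -
      \<comment> \<open>\<open>e2ennreal\<close> sends negative values to 0, so the bound must be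
        nonnegative to be recovered afterwards.\<close>
      have nn: "y + ereal ?I \<ge> 0" using eventually_happens'[OF sequentially_bot ev] by (auto intro: order_trans[OF enn2ereal_nonneg])
      have "\<forall>\<^sub>F n in sequentially. ?E (us n) \<le> e2ennreal (y + ereal ?I)"
        using ev
      proof eventually_elim
        case (elim n)
        then show ?case using e2ennreal_mono[OF elim] by simp
      qed
      then have "liminf (\<lambda>n. ?E (us n)) \<le> e2ennreal (y + ereal ?I)" by (intro Liminf_le) auto
      then have "?E u \<le> e2ennreal (y + ereal ?I)" using E by (rule order_trans[rotated])
      then have "enn2ereal (?E u) \<le> enn2ereal (e2ennreal (y + ereal ?I))" by (simp add: less_eq_ennreal.rep_eq)
      then show ?thesis using nn by (simp add: enn2ereal_e2ennreal)
    qed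
    then show "cost D j u \<le> y" unfolding cost_eq[OF um uM] by (simp add: ereal_minus_le)
  qed
qed

text \<open>Where u x \<noteq> 0, also us n x \<noteq> 0 eventually, so x lies in \<Omega> n; hence
  the indicator is at most the lower limit of those of the \<Omega> n.\<close>

lemma measure_nonzero_set_le:
  fixes u :: "'a::euclidean_space \<Rightarrow> real"
  assumes lim: "\<And>x. (\<lambda>n. us n x) \<longlonglongrightarrow> u x" and us: "\<And>n x. x \<notin> \<Omega> n \<Longrightarrow> us n x = 0"
    and \<Omega>: "\<And>n. \<Omega> n \<in> lmeasurable" "\<And>n. measure lebesgue (\<Omega> n) \<le> m" and P: "{x. u x \<noteq> 0} \<in> sets lebesgue"
  shows "measure lebesgue {x. u x \<noteq> 0} \<le> m"
proof -
  have m: "m \<ge> 0" using \<Omega>(2)[of 0] measure_nonneg[of lebesgue "\<Omega> 0"] by linarith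
  have "emeasure lebesgue {x. u x \<noteq> 0} = (\<integral>\<^sup>+x. indicator {x. u x \<noteq> 0} x \<partial>lebesgue)" using P by simp
  also have "\<dots> \<le> (\<integral>\<^sup>+x. liminf (\<lambda>n. indicator (\<Omega> n) x) \<partial>lebesgue)"
  proof (rule nn_integral_mono)
    fix x
    show "indicator {x. u x \<noteq> 0} x \<le> liminf (\<lambda>n. indicator (\<Omega> n) x :: ennreal)"
    proof (cases "u x = 0")
      case False
      then have "\<forall>\<^sub>F n in sequentially. us n x \<noteq> 0" using lim[of x] by (rule tendsto_imp_eventually_ne[rotated])
      then have "\<forall>\<^sub>F n in sequentially. (1::ennreal) \<le> indicator (\<Omega> n) x"
        by eventually_elim (use us in \<open>auto simp: indicator_def\<close>)
      then have "1 \<le> liminf (\<lambda>n. indicator (\<Omega> n) x :: ennreal)" by (rule Liminf_bounded)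
      then show ?thesis using False by simp
    qed simp
  qed
  also have "\<dots> \<le> liminf (\<lambda>n. \<integral>\<^sup>+x. indicator (\<Omega> n) x \<partial>lebesgue)"
    using \<Omega>(1) by (intro nn_integral_liminf) (auto simp: fmeasurableD)
  also have "\<dots> \<le> ennreal m"
  proof (rule Liminf_le)
    show "\<forall>\<^sub>F n in sequentially. (\<integral>\<^sup>+x. indicator (\<Omega> n) x \<partial>lebesgue) \<le> ennreal m"
      using \<Omega> by (auto intro!: always_eventually simp: fmeasurableD emeasure_eq_measure2 ennreal_leI)
  qed simp
  finally show ?thesis using m by (simp add: measure_def enn2real_leI)
qed

theorem theorem1p2:
  fixes D :: "'a::euclidean_space set"
    and p m :: real
    and f :: "('a \<Rightarrow> real) \<Rightarrow> real"
    and j :: "'a \<Rightarrow> real \<Rightarrow> real"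
  assumes "open D" and "emeasure lebesgue D < \<infinity>"
    and "p > real DIM('a)" and "p > 1"
    and "f \<in> W1p_0_dual p D"
    and "0 < m" and "m \<le> measure lebesgue D"
    and "integrand_on D j"
    and "\<And>x. x \<in> D \<Longrightarrow> lower_semicontinuous (j x)"
    and "\<And>M. M > 0 \<Longrightarrow> \<exists>a. integrable (lebesgue_on D) a \<and>
           (AE x in lebesgue_on D. \<forall>s. \<bar>s\<bar> \<le> M \<longrightarrow> - a x \<le> j x s)"
  shows "\<exists>\<Omega>opt. open \<Omega>opt \<and> \<Omega>opt \<subseteq> D \<and> measure lebesgue \<Omega>opt \<le> m \<and>
           (\<forall>\<Omega>. open \<Omega> \<and> \<Omega> \<subseteq> D \<and> measure lebesgue \<Omega> \<le> m \<longrightarrow>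
              cost D j (state_function p f \<Omega>opt) \<le> cost D j (state_function p f \<Omega>))"
proof -
  interpret p_Laplace_problem D p f
    by unfold_locales (fact assms)+
  define A where "A = {\<Omega>. open \<Omega> \<and> \<Omega> \<subseteq> D \<and> measure lebesgue \<Omega> \<le> m}"
  define cst where "cst = (\<lambda>\<Omega>. cost D j (state_function p f \<Omega>))"
  have AE_D: "AE x in lebesgue_on D. P x" if "AE x in lebesgue. P x" for P
    using that D_sets by (auto simp: AE_restrict_space_iff elim: eventually_mono)
  \<comment> \<open>The empty set is admissible, so the infimum, which may be infinite, is a limit
    of values of the cost.\<close>
  have "{} \<in> A" using assms(6) by (simp add: A_def)
  then have "cst ` A \<noteq> {}" by blast
  from Inf_as_limit[OF this] obtain c where c: "\<And>n. c n \<in> cst ` A" "c \<longlonglongrightarrow> Inf (cst ` A)" by blast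
  then have "\<forall>n. \<exists>\<Omega>. \<Omega> \<in> A \<and> c n = cst \<Omega>" by blast
  then obtain \<Omega> where \<Omega>: "\<And>n. \<Omega> n \<in> A" "\<And>n. c n = cst (\<Omega> n)" by metis
  have \<Omega>D: "open (\<Omega> n)" "\<Omega> n \<subseteq> D" "measure lebesgue (\<Omega> n) \<le> m" for n using \<Omega>(1)[of n] by (auto simp: A_def)
  have "\<exists>u g. minimizing_pair (\<Omega> n) u g \<and> (AE x in lebesgue. u x = state_function p f (\<Omega> n) x)" for n
    using state_function_minimizing_pair[OF \<Omega>D(1,2)] by blast
  then obtain us gs where us: "\<And>n. minimizing_pair (\<Omega> n) (us n) (gs n)" "\<And>n. AE x in lebesgue. us n x = state_function p f (\<Omega> n) x"
    by metis
  have usZ: "sobolev_pair p (\<Omega> n) (us n) (gs n)" for n using us(1) by (simp add: minimizing_pair_def)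
  obtain B where B: "\<And>\<Omega> u g. \<Omega> \<subseteq> D \<Longrightarrow> minimizing_pair \<Omega> u g \<Longrightarrow> Lp_energy p g \<le> B"
    using minimizing_pair_energy_bounded by blast
  have gsB: "Lp_energy p (gs n) \<le> B" for n by (rule B[OF \<Omega>D(2) us(1)])
  obtain r u where r: "strict_mono r" "\<And>x. (\<lambda>n. us (r n) x) \<longlonglongrightarrow> u x"
    "\<And>K e. compact K \<Longrightarrow> e > 0 \<Longrightarrow> \<forall>\<^sub>F n in sequentially. \<forall>x\<in>K. \<bar>us (r n) x - u x\<bar> < e"
    using sobolev_pair_compactness[where \<Omega> = \<Omega> and us = us and gs = gs, OF \<Omega>D(2) usZ gsB] by blast
  define P where "P = {x. u x \<noteq> 0}"
  obtain h where h: "minimizing_pair P u h"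
    
    using minimizing_pair_limit[where \<Omega> = "\<lambda>n. \<Omega> (r n)" and us = "\<lambda>n. us (r n)" and gs = "\<lambda>n. gs (r n)",
        OF \<Omega>D(2) us(1) r(2,3)] unfolding P_def by blast
  have uZ: "sobolev_pair p P u h" using h by (simp add: minimizing_pair_def)
  have PD: "P \<subseteq> D"
  proof
    fix x assume "x \<in> P"
    show "x \<in> D"
    proof (rule ccontr)
      assume "x \<notin> D"
      then have "us (r n) x = 0" for n using sobolev_pair_outside[OF usZ] \<Omega>D(2) by blast
      then have "u x = 0" using r(2)[of x] by (simp add: LIMSEQ_const_iff)
      with \<open>x \<in> P\<close> show False by (simp add: P_def)
    qed
  qed
  have Po: "open P" unfolding P_def
    by (intro open_Collect_neq sobolev_pair_continuous[OF uZ] continuous_on_const)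
  have Pm: "measure lebesgue P \<le> m" unfolding P_def
  proof (rule measure_nonzero_set_le[OF r(2)])
    show "\<Omega> (r n) \<in> lmeasurable" for n by (rule subset_D_finite(1)[OF \<Omega>D(1,2)])
    show "us (r n) x = 0" if "x \<notin> \<Omega> (r n)" for n x by (rule sobolev_pair_outside[OF usZ that])
    show "{x. u x \<noteq> 0} \<in> sets lebesgue" using Po by (simp add: P_def borel_open)
  qed (rule \<Omega>D(3))
  \<comment> \<open>The chosen state function of P agrees almost everywhere with a minimizer w, and
    uniqueness identifies w with the limit u.\<close>
  obtain w k where w: "minimizing_pair P w k" "AE x in lebesgue. w x = state_function p f P x"
    using state_function_minimizing_pair[OF Po PD] by blast
  have "w = u" by (rule minimizing_pair_unique[OF PD w(1) h])
  then have "cst P = cost D j u"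
    unfolding cst_def using w(2) by (intro cost_cong_AE AE_D) (auto elim: eventually_mono)
  also have "\<dots> \<le> Inf (cst ` A)"
  proof -
    \<comment> \<open>E lies strictly above 2^p times all the energies, as the sup bound demands; M
      then bounds all the us n at once, and the hypothesis on j is used for this M.\<close>
    define E where "E = 2 powr p * B + 1"
    define M where "M = sup_constant * E powr (1 / p)"
    have E: "2 powr p * Lp_energy p (gs n) < E" for n
    proof -
      have "2 powr p * Lp_energy p (gs n) \<le> 2 powr p * B" by (intro mult_left_mono gsB) simp
      then show ?thesis unfolding E_def by linarith
    qed
    have "0 \<le> 2 powr p * Lp_energy p (gs 0)" by (simp add: Lp_energy_nonneg)
    then have "E > 0" using E[of 0] by linarith
    then have "M > 0" using sup_constant_pos by (simp add: M_def)
    then obtain a where a: "integrable (lebesgue_on D) a" "AE x in lebesgue_on D. \<forall>s. \<bar>s\<bar> \<le> M \<longrightarrow> - a x \<le> j x s"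
      using assms(10) by blast
    show ?thesis
    proof (rule cost_lower_semicontinuous[OF assms(8,9) a])
      show "us (r n) \<in> borel_measurable lebesgue" for n by (rule sobolev_pair_measurable[OF usZ])
      show "\<bar>us (r n) x\<bar> \<le> M" for n x
        unfolding M_def by (rule sobolev_pair_bounded[OF sobolev_pair_mono[OF \<Omega>D(2) usZ] E])
      show "cost D j (us (r n)) = (c \<circ> r) n" for n
        unfolding o_def \<Omega>(2) cst_def by (rule cost_cong_AE[OF AE_D[OF us(2)]])
      show "(c \<circ> r) \<longlonglongrightarrow> Inf (cst ` A)" by (rule LIMSEQ_subseq_LIMSEQ[OF c(2) r(1)])
    qed (use r(2) in auto)
  qed
  finally have "cst P \<le> Inf (cst ` A)" .
  moreover have "Inf (cst ` A) \<le> cst \<Omega>" if "open \<Omega> \<and> \<Omega> \<subseteq> D \<and> measure lebesgue \<Omega> \<le> m" for \<Omega>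
    using that by (intro Inf_lower imageI) (simp only: A_def mem_Collect_eq)
  ultimately have "cst P \<le> cst \<Omega>" if "open \<Omega> \<and> \<Omega> \<subseteq> D \<and> measure lebesgue \<Omega> \<le> m" for \<Omega>
    using that order_trans by blast
  then show ?thesis using Po PD Pm unfolding cst_def by blast
qed

end
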